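(* Let $X$ be the toric surface over a field $k$ given by the complete fan in the lattice $N=\mathbb{Z}^2$ whose rays are generated by $(1,0)$, $(0,1)$, $(-1,1)$ and $(-1,-1)$, with the four maximal cones spanned by cyclically consecutive rays (so $X$ is the blow-up of the weighted projective space $\mathbb{P}(1,1,2)$ at a smooth torus-fixed point). There is no smooth toric variety $U$ and finite subgroup $G$ of the torus of $U$ such that $X=U/G$.
   Context: For a finite subgroup $G$ of the torus of a toric variety $U$, the quotient $U/G$ is regarded as a toric variety and the quotient map $U\to U/G$ as a toric morphism. *)

theory Defs
  imports
    "HOL-Analysis.Analysis"
    "HOL-Library.Poly_Mapping"
    "HOL-Computational_Algebra.Fraction_Field"
    "HOL-Computational_Algebra.Polynomial"
    "HOL-Algebra.RingHom"
    "HOL-Algebra.Generated_Rings"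
begin

text \<open>
  Integral separated schemes of finite type over a field \<open>k\<close> are represented by their models
  (Zariski's models, Chevalley's schemes, EGA I, 8): a scheme with function field \<open>K\<close> is the set of the local rings of its points, as subrings of \<open>K\<close>. A dominant morphism
  \<open>V \<rightarrow> W\<close> is an embedding of function fields \<open>K(W) \<rightarrow> K(V)\<close> for which every local ring of \<open>V\<close>
  dominates one of \<open>W\<close>.

  All function fields that occur are subfields of \<open>k(x\<^sub>0, x\<^sub>1, x\<^sub>2, \<dots>)\<close>, the fraction field of the
  Laurent polynomial ring in countably many variables. The torus \<open>T = \<bbbG>\<^sub>m\<^sup>n\<close> of rank \<open>n\<close> has
  function field \<open>k(x\<^sub>0, \<dots>, x\<^sub>n\<^sub>-\<^sub>1)\<close>, and the product of a variety with \<open>T\<close> uses the variables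
  \<open>x\<^sub>n, \<dots>, x\<^sub>2\<^sub>n\<^sub>-\<^sub>1\<close> for the factor \<open>T\<close>.
\<close>

type_synonym exponent = "nat \<Rightarrow>\<^sub>0 int"
type_synonym 'k laurent = "exponent \<Rightarrow>\<^sub>0 'k"
type_synonym 'k ratfun = "'k laurent fract"

definition scal :: "'k::field \<Rightarrow> 'k ratfun" where
  "scal c = Fract (Poly_Mapping.single 0 c) 1"

definition chi :: "exponent \<Rightarrow> 'k::field ratfun" where
  "chi m = Fract (Poly_Mapping.single m 1) 1"


subsection \<open>Rings, local rings and models\<close>

definition ring_on :: "'a::comm_ring_1 set \<Rightarrow> 'a ring" where
  "ring_on A = \<lparr>carrier = A, mult = (*), one = 1, zero = 0, add = (+)\<rparr>"

definition quotients :: "'a::field set \<Rightarrow> 'a set" where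
  "quotients A = {a / b | a b. a \<in> A \<and> b \<in> A}"

definition localization :: "'a::field set \<Rightarrow> 'a set \<Rightarrow> 'a set" where
  "localization A P = {a / s | a s. a \<in> A \<and> s \<in> A - P}"

definition Spec :: "'a::field set \<Rightarrow> 'a set set" where
  "Spec A = {localization A P | P. primeideal P (ring_on A)}"

text \<open>The maximal ideal, if \<open>A\<close> is local.\<close>

definition nonunits :: "'a::field set \<Rightarrow> 'a set" where
  "nonunits A = {x \<in> A. \<forall>y\<in>A. x * y \<noteq> 1}"

definition local_subring :: "'a::field set \<Rightarrow> 'a set \<Rightarrow> bool" where
  "local_subring A K \<longleftrightarrow> subring A (ring_on K) \<and> ideal (nonunits A) (ring_on A)"

definition dominates :: "'a::field set \<Rightarrow> 'a set \<Rightarrow> bool" where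
  "dominates A B \<longleftrightarrow> B \<subseteq> A \<and> nonunits B \<subseteq> nonunits A"

text \<open>\<open>lies_over h A B\<close>: the point with local ring \<open>A\<close> is mapped to the point with local ring \<open>B\<close>
  by the morphism with comorphism \<open>h\<close>.\<close>

definition lies_over :: "('a::field \<Rightarrow> 'a) \<Rightarrow> 'a set \<Rightarrow> 'a set \<Rightarrow> bool" where
  "lies_over h A B \<longleftrightarrow> h ` B \<subseteq> A \<and> h ` nonunits B \<subseteq> nonunits A"


subsection \<open>Tori\<close>

definition char_lattice :: "nat \<Rightarrow> exponent set" where
  "char_lattice n = {m. Poly_Mapping.keys m \<subseteq> {..<n}}"

definition semigroup_ring :: "exponent set \<Rightarrow> 'k::field ratfun set" where
  "semigroup_ring S = {Fract p 1 | p. Poly_Mapping.keys p \<subseteq> S}"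

abbreviation torus_ring :: "nat \<Rightarrow> 'k::field ratfun set" where
  "torus_ring n \<equiv> semigroup_ring (char_lattice n)"

definition torus_field :: "nat \<Rightarrow> 'k::field ratfun set" where
  "torus_field n = quotients (torus_ring n)"

text \<open>The \<open>k\<close>-algebra map \<open>\<chi>\<^sup>m \<mapsto> \<chi>\<^sup>\<phi>\<^sup>(\<^sup>m\<^sup>)\<close> for an injective additive map \<open>\<phi>\<close> of exponents, on Laurent
  polynomials and then on rational functions.\<close>

definition laurent_map :: "(exponent \<Rightarrow> exponent) \<Rightarrow> 'k::field laurent \<Rightarrow> 'k laurent" where
  "laurent_map \<phi> p =
     (\<Sum>m\<in>Poly_Mapping.keys p. Poly_Mapping.single (\<phi> m) (Poly_Mapping.lookup p m))"

definition char_map :: "(exponent \<Rightarrow> exponent) \<Rightarrow> 'k::field ratfun \<Rightarrow> 'k ratfun" where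
  "char_map \<phi> x =
     (THE y. \<exists>a b. b \<noteq> 0 \<and> x = Fract a b \<and> y = Fract (laurent_map \<phi> a) (laurent_map \<phi> b))"

definition shift :: "nat \<Rightarrow> exponent \<Rightarrow> exponent" where
  "shift n m = (\<Sum>i\<in>Poly_Mapping.keys m. Poly_Mapping.single (i + n) (Poly_Mapping.lookup m i))"

text \<open>\<open>second n\<close> is pullback along the projection \<open>V \<times> T \<rightarrow> T\<close> (pullback along \<open>V \<times> T \<rightarrow> V\<close> is the
  inclusion), and \<open>coaction n\<close>, \<open>\<chi>\<^sup>m \<mapsto> \<chi>\<^sup>m \<otimes> \<chi>\<^sup>m\<close>, is pullback along the action \<open>V \<times> T \<rightarrow> V\<close>; for
  \<open>V = T\<close> the latter is the comultiplication of \<open>T\<close>.\<close>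

definition second :: "nat \<Rightarrow> 'k::field ratfun \<Rightarrow> 'k ratfun" where
  "second n = char_map (shift n)"

definition coaction :: "nat \<Rightarrow> 'k::field ratfun \<Rightarrow> 'k ratfun" where
  "coaction n = char_map (\<lambda>m. m + shift n m)"

text \<open>\<open>char_map\<close> is well defined for the exponent maps used here:\<close>

lemma laurent_map_sum:
  assumes "finite S" "Poly_Mapping.keys p \<subseteq> S"
  shows "laurent_map \<phi> p = (\<Sum>m\<in>S. Poly_Mapping.single (\<phi> m) (Poly_Mapping.lookup p m))"
  unfolding laurent_map_def
  by (rule sum.mono_neutral_left) (use assms in \<open>auto simp: in_keys_iff\<close>)

lemma laurent_map_single [simp]: "laurent_map \<phi> (Poly_Mapping.single m c) = Poly_Mapping.single (\<phi> m) c"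
  by (subst laurent_map_sum[of "{m}"]) auto

lemma laurent_map_0 [simp]: "laurent_map \<phi> 0 = 0"
  by (simp add: laurent_map_def)

lemma laurent_map_add: "laurent_map \<phi> (p + q) = laurent_map \<phi> p + laurent_map \<phi> q"
proof -
  let ?S = "Poly_Mapping.keys p \<union> Poly_Mapping.keys q"
  have "finite ?S" "Poly_Mapping.keys (p + q) \<subseteq> ?S" by (auto simp: Poly_Mapping.keys_add)
  then show ?thesis
    by (simp add: laurent_map_sum[of ?S] lookup_add single_add sum.distrib)
qed

lemma laurent_map_uminus: "laurent_map \<phi> (- p) = - laurent_map \<phi> p"
  using laurent_map_add[of \<phi> p "- p"] by (simp add: eq_neg_iff_add_eq_0 add.commute)

lemma laurent_induct:
  fixes p :: "'k::field laurent"
  assumes "\<And>m c. P (Poly_Mapping.single m c)" "\<And>f g. P f \<Longrightarrow> P g \<Longrightarrow> P (f + g)"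
  shows "P p"
proof -
  have eq: "p = (\<Sum>m\<in>Poly_Mapping.keys p. Poly_Mapping.single m (Poly_Mapping.lookup p m))"
    by (rule poly_mapping_eqI) (auto simp: lookup_sum lookup_single when_def in_keys_iff)
  have "P (\<Sum>m\<in>S. Poly_Mapping.single m (Poly_Mapping.lookup p m))" if "finite S" for S
    using that
  proof (induction S)
    case empty then show ?case using assms(1)[of 0 0] by simp
  next
    case (insert x F) then show ?case using assms by simp
  qed
  then show ?thesis using eq by (metis finite_keys)
qed

lemma laurent_map_mult:
  assumes "\<And>a b. \<phi> (a + b) = \<phi> a + \<phi> b"
  shows "laurent_map \<phi> (p * q) = laurent_map \<phi> p * laurent_map \<phi> q"
proof -
  have S: "laurent_map \<phi> (Poly_Mapping.single m c * q) = Poly_Mapping.single (\<phi> m) c * laurent_map \<phi> q" for m c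
  proof (induction q rule: laurent_induct)
    case (1 k v) then show ?case by (simp add: mult_single assms)
  next
    case (2 f g) then show ?case by (simp add: laurent_map_add distrib_left)
  qed
  show ?thesis
  proof (induction p rule: laurent_induct)
    case (1 k v) then show ?case by (simp add: S)
  next
    case (2 f g) then show ?case by (simp add: laurent_map_add distrib_right)
  qed
qed

lemma laurent_map_eq_0:
  assumes "inj \<phi>" "laurent_map \<phi> p = 0" shows "p = 0"
proof (rule poly_mapping_eqI)
  fix m
  have "Poly_Mapping.lookup (laurent_map \<phi> p) (\<phi> m) = Poly_Mapping.lookup p m"
    unfolding laurent_map_def lookup_sum
    using assms(1) by (auto simp: lookup_single when_def inj_eq in_keys_iff sum.delta
      cong: if_cong)
  then show "Poly_Mapping.lookup p m = Poly_Mapping.lookup 0 m" using assms(2) by simp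
qed

lemma char_map_Fract:
  assumes "\<And>a b. \<phi> (a + b) = \<phi> a + \<phi> b" "inj \<phi>" "b \<noteq> 0"
  shows "char_map \<phi> (Fract a b) = Fract (laurent_map \<phi> a) (laurent_map \<phi> b)"
  unfolding char_map_def
proof (rule the_equality)
  fix y
  assume "\<exists>c d. d \<noteq> 0 \<and> Fract a b = Fract c d \<and> y = Fract (laurent_map \<phi> c) (laurent_map \<phi> d)"
  then obtain c d where cd: "d \<noteq> 0" "Fract a b = Fract c d"
      "y = Fract (laurent_map \<phi> c) (laurent_map \<phi> d)" by blast
  then have "a * d = c * b" using assms(3) by (simp add: eq_fract)
  then have "laurent_map \<phi> a * laurent_map \<phi> d = laurent_map \<phi> c * laurent_map \<phi> b"
    by (metis laurent_map_mult assms(1))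
  moreover have "laurent_map \<phi> d \<noteq> 0" "laurent_map \<phi> b \<noteq> 0"
    using laurent_map_eq_0[OF assms(2)] cd(1) assms(3) by blast+
  ultimately show "y = Fract (laurent_map \<phi> a) (laurent_map \<phi> b)"
    using cd(3) by (simp add: eq_fract)
qed (use assms(3) in blast)

lemma lookup_shift:
  "Poly_Mapping.lookup (shift n m) i = (if i < n then 0 else Poly_Mapping.lookup m (i - n))"
proof -
  have "Poly_Mapping.lookup (shift n m) i
      = (\<Sum>j\<in>Poly_Mapping.keys m. if n \<le> i \<and> j = i - n then Poly_Mapping.lookup m j else 0)"
    unfolding shift_def lookup_sum by (rule sum.cong) (auto simp: lookup_single when_def)
  then show ?thesis by (auto simp: in_keys_iff not_le)
qed

lemma shift_add: "shift n (a + b) = shift n a + shift n b"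
  by (rule poly_mapping_eqI) (simp add: lookup_shift lookup_add)

lemma inj_shift: "inj (shift n)"
proof (rule injI, rule poly_mapping_eqI)
  fix a b :: exponent and i assume "shift n a = shift n b"
  then have "Poly_Mapping.lookup (shift n a) (i + n) = Poly_Mapping.lookup (shift n b) (i + n)" by simp
  then show "Poly_Mapping.lookup a i = Poly_Mapping.lookup b i" by (simp add: lookup_shift)
qed

lemma inj_diagonal: "inj (\<lambda>m. m + shift n m)"
proof (rule injI, rule poly_mapping_eqI)
  fix a b :: exponent and i assume eq: "a + shift n a = b + shift n b"
  have e: "Poly_Mapping.lookup a i + (if i < n then 0 else Poly_Mapping.lookup a (i - n))
     = Poly_Mapping.lookup b i + (if i < n then 0 else Poly_Mapping.lookup b (i - n))" for i
    using arg_cong[OF eq, of "\<lambda>m. Poly_Mapping.lookup m i"] by (simp add: lookup_add lookup_shift)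
  show "Poly_Mapping.lookup a i = Poly_Mapping.lookup b i"
  proof (induction i rule: less_induct)
    case (less i)
    then show ?case using e[of i] by (cases "n = 0"; cases "i < n") auto
  qed
qed

lemma chi_maps:
  "second n (chi m :: 'k::field ratfun) = chi (shift n m)"
  "coaction n (chi m :: 'k ratfun) = chi m * second n (chi m)"
  "char_map uminus (chi m :: 'k ratfun) = inverse (chi m)"
proof -
  have o: "laurent_map \<phi> 1 = (1 :: 'k laurent)" if "\<phi> 0 = 0" for \<phi>
    using laurent_map_single[of \<phi> 0 "1::'k"] that by (simp add: single_one)
  have s: "shift n 0 = 0" by (simp add: shift_def)
  show 1: "second n (chi m :: 'k ratfun) = chi (shift n m)"
    unfolding second_def chi_def
    by (subst char_map_Fract) (auto simp: shift_add inj_shift o s)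
  have "coaction n (chi m :: 'k ratfun) = chi (m + shift n m)"
    unfolding coaction_def chi_def
    by (subst char_map_Fract) (auto simp: shift_add inj_diagonal o s)
  then show "coaction n (chi m :: 'k ratfun) = chi m * second n (chi m)"
    by (simp add: 1) (simp add: chi_def mult_single)
  have "char_map uminus (chi m :: 'k ratfun) = chi (- m)"
    unfolding chi_def by (subst char_map_Fract) (auto simp: o)
  moreover have "chi m * chi (- m) = (1 :: 'k ratfun)"
    by (simp add: chi_def mult_single single_one One_fract_def)
  ultimately show "char_map uminus (chi m :: 'k ratfun) = inverse (chi m)"
    by (metis inverse_unique)
qed

text \<open>\<open>A \<otimes>\<^sub>k k[T]\<close>\<close>

definition tensor_torus :: "nat \<Rightarrow> 'k::field ratfun set \<Rightarrow> 'k ratfun set" where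
  "tensor_torus n A = generate_ring (ring_on UNIV) (A \<union> second n ` torus_ring n)"

text \<open>Closed subgroup schemes of \<open>T\<close> correspond to the Hopf ideals \<open>I\<close> of \<open>k[T]\<close>; such a subgroup
  scheme is finite if \<open>k[T]/I\<close> has finite dimension. (A finite group of \<open>k\<close>-points of \<open>T\<close> is
  included, as the reduced subscheme it forms.) The conditions after the first say that the subscheme
  is closed under multiplication, contains the unit, is closed under inversion, and is finite.\<close>

definition finite_torus_subgroup :: "nat \<Rightarrow> 'k::field ratfun set \<Rightarrow> bool" where
  "finite_torus_subgroup n I \<longleftrightarrow>
     ideal I (ring_on (torus_ring n)) \<and>
     coaction n ` I \<subseteq> genideal (ring_on (torus_ring (2 * n))) (I \<union> second n ` I) \<and>
     I \<subseteq> genideal (ring_on (torus_ring n)) {chi m - 1 | m. m \<in> char_lattice n} \<and>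
     char_map uminus ` I \<subseteq> I \<and>
     (\<exists>F. finite F \<and> F \<subseteq> torus_ring n \<and>
       (\<forall>f\<in>torus_ring n. \<exists>c. f - (\<Sum>g\<in>F. scal (c g) * g) \<in> I))"


subsection \<open>Toric varieties\<close>

text \<open>\<open>n\<close> is the dimension; the function field is that of the torus of rank \<open>n\<close>.\<close>

definition affine_model :: "nat \<Rightarrow> 'k::field ratfun set \<Rightarrow> bool" where
  "affine_model n A \<longleftrightarrow>
     (\<exists>F. finite F \<and> F \<subseteq> torus_field n \<and> A = generate_ring (ring_on UNIV) (range scal \<union> F)) \<and>
     quotients A = torus_field n"

text \<open>The last condition is separatedness: distinct points have unrelated local rings.\<close>

definition variety :: "nat \<Rightarrow> 'k::field ratfun set set \<Rightarrow> bool" where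
  "variety n V \<longleftrightarrow>
     (\<exists>\<A>. finite \<A> \<and> \<A> \<noteq> {} \<and> (\<forall>A\<in>\<A>. affine_model n A) \<and> V = (\<Union>A\<in>\<A>. Spec A)) \<and>
     (\<forall>P\<in>V. \<forall>Q\<in>V. \<forall>R. local_subring R (torus_field n) \<and> dominates R P \<and> dominates R Q
        \<longrightarrow> P = Q)"

definition normal_variety :: "nat \<Rightarrow> 'k::field ratfun set set \<Rightarrow> bool" where
  "normal_variety n V \<longleftrightarrow> variety n V \<and>
     (\<forall>R\<in>V. \<forall>x\<in>torus_field n.
        (\<exists>p. lead_coeff p = 1 \<and> (\<forall>i. Polynomial.coeff p i \<in> R) \<and> poly p x = 0) \<longrightarrow> x \<in> R)"

text \<open>The torus is an open subscheme, and its multiplication extends to a morphism \<open>V \<times> T \<rightarrow> V\<close>,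
  which is then automatically a group action.\<close>

definition toric_variety :: "nat \<Rightarrow> 'k::field ratfun set set \<Rightarrow> bool" where
  "toric_variety n V \<longleftrightarrow> normal_variety n V \<and> Spec (torus_ring n) \<subseteq> V \<and>
     (\<forall>A. affine_model n A \<and> Spec A \<subseteq> V \<longrightarrow>
        (\<forall>P\<in>Spec (tensor_torus n A). \<exists>Q\<in>V. lies_over (coaction n) P Q))"

text \<open>Representatives \<open>D\<close> of \<open>k\<close>-derivations from the local ring \<open>R\<close> to its residue field \<open>\<kappa>\<close>.\<close>

definition residue_derivation :: "'k::field ratfun set \<Rightarrow> ('k ratfun \<Rightarrow> 'k ratfun) \<Rightarrow> bool" where
  "residue_derivation R D \<longleftrightarrow>
     (\<forall>f\<in>R. D f \<in> R) \<and>
     (\<forall>f\<in>R. \<forall>g\<in>R. D (f + g) - (D f + D g) \<in> nonunits R) \<and>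
     (\<forall>f\<in>R. \<forall>g\<in>R. D (f * g) - (f * D g + g * D f) \<in> nonunits R) \<and>
     (\<forall>c. D (scal c) \<in> nonunits R)"

text \<open>\<open>Der\<^sub>k(R, \<kappa>)\<close>, which is the \<open>\<kappa>\<close>-dual of \<open>\<Omega>\<^sub>R\<^sub>/\<^sub>k \<otimes> \<kappa>\<close>, has dimension \<open>n\<close> over \<open>\<kappa>\<close>:
  \<open>E 0, \<dots>, E (n - 1)\<close> represent a basis.\<close>

definition tangent_dim :: "'k::field ratfun set \<Rightarrow> nat \<Rightarrow> bool" where
  "tangent_dim R n \<longleftrightarrow> (\<exists>E :: nat \<Rightarrow> 'k ratfun \<Rightarrow> 'k ratfun.
     (\<forall>i<n. residue_derivation R (E i)) \<and>
     (\<forall>D. residue_derivation R D \<longrightarrow>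
        (\<exists>c. (\<forall>i<n. c i \<in> R) \<and> (\<forall>f\<in>R. D f - (\<Sum>i<n. c i * E i f) \<in> nonunits R))) \<and>
     (\<forall>c. (\<forall>i<n. c i \<in> R) \<and> (\<forall>f\<in>R. (\<Sum>i<n. c i * E i f) \<in> nonunits R) \<longrightarrow>
        (\<forall>i<n. c i \<in> nonunits R)))"

text \<open>Smoothness over \<open>k\<close> as in Hartshorne, III.10: \<open>\<Omega>\<^sub>V\<^sub>/\<^sub>k \<otimes> \<kappa>(x)\<close> has dimension \<open>n = dim V\<close> at every
  point \<open>x\<close>, closed or not.\<close>

definition smooth :: "nat \<Rightarrow> 'k::field ratfun set set \<Rightarrow> bool" where
  "smooth n V \<longleftrightarrow> (\<forall>R\<in>V. tangent_dim R n)"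


subsection \<open>Toric surfaces from fans\<close>

text \<open>A fan in \<open>N\<^sub>\<real> = \<real>\<^sup>2\<close> is given as the set of all its cones; \<open>m\<close> in the dual lattice has coordinates
  \<open>lookup m 0\<close> and \<open>lookup m 1\<close>.\<close>

definition dual_semigroup :: "(real \<times> real) set \<Rightarrow> exponent set" where
  "dual_semigroup \<sigma> = {m \<in> char_lattice 2. \<forall>u\<in>\<sigma>.
     (real_of_int (Poly_Mapping.lookup m 0), real_of_int (Poly_Mapping.lookup m 1)) \<bullet> u \<ge> 0}"

definition toric_surface :: "(real \<times> real) set set \<Rightarrow> 'k::field ratfun set set" where
  "toric_surface \<Sigma> = (\<Union>\<sigma>\<in>\<Sigma>. Spec (semigroup_ring (dual_semigroup \<sigma>)))"


subsection \<open>Toric morphisms and quotients\<close>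

text \<open>Morphisms which restrict to a homomorphism of tori: characters pull back to characters.\<close>

definition dominant_toric_morphism ::
  "nat \<Rightarrow> 'k::field ratfun set set \<Rightarrow> nat \<Rightarrow> 'k ratfun set set \<Rightarrow> ('k ratfun \<Rightarrow> 'k ratfun) \<Rightarrow> bool"
where
  "dominant_toric_morphism n V r W h \<longleftrightarrow>
     h \<in> ring_hom (ring_on (torus_field r)) (ring_on (torus_field n)) \<and>
     (\<forall>c. h (scal c) = scal c) \<and>
     (\<forall>m\<in>char_lattice r. \<exists>m'\<in>char_lattice n. h (chi m) = chi m') \<and>
     (\<forall>P\<in>V. \<exists>Q\<in>W. lies_over h P Q)"

definition preimage ::
  "'k::field ratfun set set \<Rightarrow> ('k ratfun \<Rightarrow> 'k ratfun) \<Rightarrow> 'k ratfun set set \<Rightarrow> 'k ratfun set set"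
where
  "preimage V h W' = {P \<in> V. \<exists>Q\<in>W'. lies_over h P Q}"

text \<open>\<open>A\<^sup>G\<close> for a torus-stable \<open>A\<close> and the subgroup scheme \<open>G\<close> with ideal \<open>I\<close>: the elements whose
  images under the coaction \<open>A \<rightarrow> A \<otimes> k[G] = (A \<otimes> k[T]) / (A \<otimes> I)\<close> and under \<open>f \<mapsto> f \<otimes> 1\<close> agree.\<close>

definition invariants :: "nat \<Rightarrow> 'k::field ratfun set \<Rightarrow> 'k ratfun set \<Rightarrow> 'k ratfun set" where
  "invariants n I A =
     {f \<in> A. coaction n f - f \<in> genideal (ring_on (tensor_torus n A)) (second n ` I)}"

text \<open>\<open>W = V/G\<close> as toric varieties, with quotient map \<open>h\<close>: over the members \<open>Spec B\<close> of an affine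
  open cover of \<open>W\<close>, the toric morphism \<open>h\<close> is the map \<open>Spec A \<rightarrow> Spec A\<^sup>G\<close> with \<open>Spec A\<close> the (torus-stable,
  hence \<open>G\<close>-stable) inverse image of \<open>Spec B\<close>.\<close>

definition toric_quotient_map ::
  "nat \<Rightarrow> 'k::field ratfun set set \<Rightarrow> 'k ratfun set \<Rightarrow>
   nat \<Rightarrow> 'k ratfun set set \<Rightarrow> ('k ratfun \<Rightarrow> 'k ratfun) \<Rightarrow> bool"
where
  "toric_quotient_map n V I r W h \<longleftrightarrow> dominant_toric_morphism n V r W h \<and>
     (\<exists>\<B>. W = (\<Union>B\<in>\<B>. Spec B) \<and>
       (\<forall>B\<in>\<B>. affine_model r B \<and>
         (\<exists>A. affine_model n A \<and> Spec A = preimage V h (Spec B) \<and>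
              coaction n ` A \<subseteq> tensor_torus n A \<and> h ` B = invariants n I A)))"

definition is_toric_quotient ::
  "nat \<Rightarrow> 'k::field ratfun set set \<Rightarrow> 'k ratfun set \<Rightarrow> nat \<Rightarrow> 'k ratfun set set \<Rightarrow> bool"
where
  "is_toric_quotient n V I r W \<longleftrightarrow> (\<exists>h. toric_quotient_map n V I r W h)"


end

theory Submission
  imports Defs
begin

text \<open>
  Write \<open>M = \<int>\<^sup>2\<close> for the character lattice of the torus of \<open>X\<close> and \<open>M'\<close> for that of \<open>U\<close>. A torus-stable
  affine chart of \<open>U\<close> is the spectrum of a semigroup ring \<open>k[S]\<close> with \<open>S \<subseteq> M'\<close>, and its \<open>G\<close>-invariants are
  \<open>k[S \<inter> L]\<close>, where the lattice \<open>L\<close> of characters that are trivial on \<open>G\<close> contains \<open>N M'\<close> for some \<open>N > 0\<close>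
  (distinct grouplike elements of the finite-dimensional Hopf algebra \<open>k[G]\<close> are linearly independent).
  So over the chart of \<open>X\<close> with cone spanned by neighbouring rays \<open>u, v\<close>, the semigroup \<open>S\<close> is the set of
  lattice points of \<open>M'\<close> in the dual cone. At the fixed point the irreducible elements of \<open>S\<close> give linearly independent
  tangent vectors, so by smoothness there are at most two of them, and they form a basis of \<open>M'\<close>.
  If \<open>g\<^sub>u\<close> is the positive generator of \<open>u(N M')\<close>, this yields \<open>g\<^sub>u g\<^sub>v = det(u, v) D\<close>, where \<open>D = [M : N M']\<close>
  does not depend on the chart. The determinants of the four charts are \<open>1, 1, 2, 1\<close> in cyclic
  order, and then \<open>(g\<^sub>1 g\<^sub>2) (g\<^sub>3 g\<^sub>4) = (g\<^sub>2 g\<^sub>3) (g\<^sub>4 g\<^sub>1)\<close> reads \<open>2 D\<^sup>2 = D\<^sup>2\<close>.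
\<close>

subsection \<open>Laurent polynomials as rational functions\<close>

text \<open>The contradiction rests on the parity of the number of rays. Around a cycle of odd
  length, equations \<open>g_u g_v = det(u, v) D\<close> can always be solved in positive reals;
  around a cycle of length four they force the two products of opposite determinants to agree.
  Neither the dimension of U nor reducedness of G is given. In characteristic p the group can be
  infinitesimal (for instance mu_p), so L has to be read off the Hopf algebra and not off k-points.
  The dimension is bounded afterwards, because M' embeds in M after multiplication by N. Passing
  from N to a multiple t N scales every g by t and D by t^2, so the equations do not depend on the
  choice of N. The quotient is described on an affine cover of X that need not consist of the charts
  of the cones, and taking invariants retains only S \<inter> L. Two recognition steps bridge this:
  the local ring at the fixed point determines the semigroup of a chart of X around it, and
  normality of U recovers S from S \<inter> L by dividing exponents by N.\<close>

definition lp :: "'k::field laurent \<Rightarrow> 'k ratfun" where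
  "lp p = Fract p 1"

lemma lp_add: "lp (p + q) = lp p + lp q"
  and lp_mult: "lp (p * q) = lp p * lp q"
  and lp_diff: "lp (p - q) = lp p - lp q"
  and lp_uminus: "lp (- p) = - lp p"
  and lp_0 [simp]: "lp 0 = 0"
  and lp_1 [simp]: "lp 1 = 1"
  by (simp_all add: lp_def fract_collapse)

lemma lp_eq_iff [simp]: "lp p = lp q \<longleftrightarrow> p = q"
  by (simp add: lp_def eq_fract)

lemma lp_eq_0_iff [simp]: "lp p = 0 \<longleftrightarrow> p = 0"
  using lp_eq_iff[of p 0] by (simp del: lp_eq_iff)

lemma scal_lp: "scal c = lp (Poly_Mapping.single 0 c)"
  by (simp add: scal_def lp_def)

lemma chi_lp: "chi m = lp (Poly_Mapping.single m 1)"
  by (simp add: chi_def lp_def)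

lemma lp_single: "lp (Poly_Mapping.single m c) = scal c * chi m"
  by (simp add: scal_lp chi_lp flip: lp_mult) (simp add: mult_single)

lemma scal_0 [simp]: "scal 0 = 0" and scal_1 [simp]: "scal 1 = 1"
  and scal_mult: "scal (c * d) = scal c * scal d"
  and scal_add: "scal (c + d) = scal c + scal d"
  by (simp_all add: scal_lp single_add mult_single single_one flip: lp_mult lp_add)

lemma chi_add: "chi (a + b) = chi a * chi b"
  by (simp add: chi_lp mult_single flip: lp_mult)

lemma chi_0 [simp]: "chi 0 = 1"
  by (simp add: chi_lp single_one)

lemma chi_nonzero [simp]: "chi m \<noteq> 0"
  by (metis chi_0 chi_add mult_zero_left right_minus zero_neq_one)

lemma chi_uminus: "chi (- m) = inverse (chi m)"
  by (metis chi_0 chi_add inverse_unique right_minus)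

lemma chi_of_nat_mult: "chi (of_nat j * m) = chi m ^ j"
  by (induction j) (simp_all add: distrib_right chi_add)

lemma single_inject [simp]:
  "Poly_Mapping.single a (1::'k::zero_neq_one) = Poly_Mapping.single b 1 \<longleftrightarrow> a = b"
  by (metis lookup_single_eq lookup_single_not_eq zero_neq_one)

lemma chi_inject [simp]: "chi a = chi b \<longleftrightarrow> a = b"
  by (simp add: chi_lp)

lemma semigroup_ring_lp: "semigroup_ring S = {lp p | p. Poly_Mapping.keys p \<subseteq> S}"
  by (simp add: semigroup_ring_def lp_def)

lemma lp_in_semigroup_ring [simp]: "lp p \<in> semigroup_ring S \<longleftrightarrow> Poly_Mapping.keys p \<subseteq> S"
  by (auto simp: semigroup_ring_lp)

lemma semigroup_ringE:
  assumes "x \<in> semigroup_ring S"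
  obtains p where "x = lp p" "Poly_Mapping.keys p \<subseteq> S"
  using assms by (auto simp: semigroup_ring_lp)

lemma chi_in_semigroup_ring [simp]: "chi m \<in> semigroup_ring S \<longleftrightarrow> m \<in> S"
  by (simp add: chi_lp)

lemma keys_add_subset:
  assumes "Poly_Mapping.keys p \<subseteq> S" "Poly_Mapping.keys q \<subseteq> S"
  shows "Poly_Mapping.keys (p + q) \<subseteq> S"
  using keys_add[of p q] assms by blast

lemma laurent_induct_on [consumes 1, case_names zero single add]:
  fixes p :: "'k::field laurent"
  assumes "Poly_Mapping.keys p \<subseteq> S" "P 0"
    and "\<And>m c. m \<in> S \<Longrightarrow> P (Poly_Mapping.single m c)"
    and "\<And>f g. Poly_Mapping.keys f \<subseteq> S \<Longrightarrow> Poly_Mapping.keys g \<subseteq> S \<Longrightarrow> P f \<Longrightarrow> P g \<Longrightarrow> P (f + g)"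
  shows "P p"
proof -
  have eq: "p = (\<Sum>m\<in>Poly_Mapping.keys p. Poly_Mapping.single m (Poly_Mapping.lookup p m))"
    by (rule poly_mapping_eqI) (auto simp: lookup_sum lookup_single when_def in_keys_iff)
  let ?f = "\<lambda>T. \<Sum>m\<in>T. Poly_Mapping.single m (Poly_Mapping.lookup p m)"
  have "Poly_Mapping.keys (?f T) \<subseteq> S \<and> P (?f T)" if "finite T" "T \<subseteq> S" for T
    using that
  proof (induction T)
    case empty then show ?case using assms(2) by simp
  next
    case (insert x F)
    have "Poly_Mapping.keys (Poly_Mapping.single x (Poly_Mapping.lookup p x)) \<subseteq> S"
      using insert.prems by auto
    moreover have "Poly_Mapping.keys (Poly_Mapping.single x (Poly_Mapping.lookup p x) + ?f F) \<subseteq> S"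
      by (rule keys_add_subset) (use insert calculation in auto)
    ultimately show ?case using insert assms(3,4) by auto
  qed
  from this[OF finite_keys assms(1)] eq show ?thesis by metis
qed

definition monoid_on :: "'a::comm_monoid_add set \<Rightarrow> bool" where
  "monoid_on S \<longleftrightarrow> 0 \<in> S \<and> (\<forall>a\<in>S. \<forall>b\<in>S. a + b \<in> S)"

lemma char_lattice_iff: "m \<in> char_lattice n \<longleftrightarrow> (\<forall>i\<ge>n. Poly_Mapping.lookup m i = 0)"
  by (simp add: char_lattice_def in_keys_iff subset_iff) (meson not_le)

lemma monoid_on_char_lattice: "monoid_on (char_lattice n)"
  by (simp add: monoid_on_def char_lattice_iff lookup_add)

lemma char_lattice_0 [simp]: "0 \<in> char_lattice n"
  and char_lattice_add: "a \<in> char_lattice n \<Longrightarrow> b \<in> char_lattice n \<Longrightarrow> a + b \<in> char_lattice n"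
  and char_lattice_uminus: "a \<in> char_lattice n \<Longrightarrow> - a \<in> char_lattice n"
  using monoid_on_char_lattice[of n] by (auto simp: monoid_on_def char_lattice_def)

lemma char_lattice_diff: "a \<in> char_lattice n \<Longrightarrow> b \<in> char_lattice n \<Longrightarrow> a - b \<in> char_lattice n"
  using char_lattice_add[OF _ char_lattice_uminus] by fastforce

lemma char_lattice_of_nat_mult: "a \<in> char_lattice n \<Longrightarrow> of_nat j * a \<in> char_lattice n"
  by (induction j) (simp_all add: distrib_right char_lattice_add)

lemma keys_mult_subset:
  assumes "monoid_on S" "Poly_Mapping.keys p \<subseteq> S" "Poly_Mapping.keys q \<subseteq> S"
  shows "Poly_Mapping.keys (p * q) \<subseteq> S"
proof
  fix k assume "k \<in> Poly_Mapping.keys (p * q)"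
  then obtain a b where "k = a + b" "a \<in> Poly_Mapping.keys p" "b \<in> Poly_Mapping.keys q"
    using keys_mult[of p q] by blast
  then show "k \<in> S" using assms by (auto simp: monoid_on_def)
qed

lemma lookup_single_times:
  "Poly_Mapping.lookup (Poly_Mapping.single a c * q) (a + k) = c * Poly_Mapping.lookup (q :: 'k::field laurent) k"
  by (induction q rule: laurent_induct)
    (simp_all add: mult_single lookup_single when_def distrib_left lookup_add)

lemma keys_single_times:
  assumes "(c :: 'k::field) \<noteq> 0" "k \<in> Poly_Mapping.keys (q :: 'k laurent)"
  shows "a + k \<in> Poly_Mapping.keys (Poly_Mapping.single a c * q)"
  using assms lookup_single_times[of a c q k] by (simp add: in_keys_iff)

subsection \<open>Subrings of the field of rational functions\<close>

definition subring_set :: "'a::comm_ring_1 set \<Rightarrow> bool" where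
  "subring_set A \<longleftrightarrow> 1 \<in> A \<and> (\<forall>x\<in>A. - x \<in> A) \<and> (\<forall>x\<in>A. \<forall>y\<in>A. x + y \<in> A \<and> x * y \<in> A)"

lemma subring_setD:
  assumes "subring_set A"
  shows "1 \<in> A" "0 \<in> A" "x \<in> A \<Longrightarrow> - x \<in> A" "x \<in> A \<Longrightarrow> y \<in> A \<Longrightarrow> x + y \<in> A"
    "x \<in> A \<Longrightarrow> y \<in> A \<Longrightarrow> x - y \<in> A" "x \<in> A \<Longrightarrow> y \<in> A \<Longrightarrow> x * y \<in> A"
proof -
  show "0 \<in> A" using assms unfolding subring_set_def by (metis add.right_inverse)
  show "x - y \<in> A" if "x \<in> A" "y \<in> A"
    using assms that unfolding subring_set_def by (metis diff_conv_add_uminus)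
qed (use assms in \<open>auto simp: subring_set_def\<close>)

lemma ring_on_simps [simp]:
  "carrier (ring_on A) = A" "x \<otimes>\<^bsub>ring_on A\<^esub> y = x * y" "x \<oplus>\<^bsub>ring_on A\<^esub> y = x + y"
  "\<one>\<^bsub>ring_on A\<^esub> = 1" "\<zero>\<^bsub>ring_on A\<^esub> = 0"
  by (simp_all add: ring_on_def)

lemma cring_ring_on:
  assumes "subring_set A"
  shows "cring (ring_on A)"
proof (rule cringI)
  note A = subring_setD[OF assms]
  show "abelian_group (ring_on A)"
    by (rule abelian_groupI) (use A in \<open>auto simp: algebra_simps intro: bexI[of _ "- x" for x]\<close>)
  show "Group.comm_monoid (ring_on A)"
    by (rule comm_monoidI) (use A in \<open>auto simp: algebra_simps\<close>)
qed (auto simp: algebra_simps)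

lemma ring_on_uminus:
  assumes "subring_set A" "x \<in> A"
  shows "\<ominus>\<^bsub>ring_on A\<^esub> x = - x"
proof -
  interpret cring "ring_on A" by (rule cring_ring_on[OF assms(1)])
  show ?thesis
    using minus_equality[of "- x" x] assms subring_setD(3)[OF assms(1)] by simp
qed

lemma ideal_ring_onI:
  assumes "subring_set A" "I \<subseteq> A" "0 \<in> I" "\<And>x y. x \<in> I \<Longrightarrow> y \<in> I \<Longrightarrow> x + y \<in> I"
    "\<And>a x. a \<in> A \<Longrightarrow> x \<in> I \<Longrightarrow> a * x \<in> I"
  shows "ideal I (ring_on A)"
proof (rule idealI)
  interpret cring "ring_on A" by (rule cring_ring_on[OF assms(1)])
  show "ring (ring_on A)" by (rule ring_axioms)
  have "- x \<in> I" if "x \<in> I" for x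
    using assms(5)[of "- 1" x] that subring_setD[OF assms(1)] by simp
  moreover have "inv\<^bsub>add_monoid (ring_on A)\<^esub> x = - x" if "x \<in> I" for x
    using ring_on_uminus[OF assms(1), of x] assms(2) that by (auto simp: a_inv_def)
  ultimately show "subgroup I (add_monoid (ring_on A))"
    by (intro subgroup.intro) (use assms in auto)
qed (use assms(5) in \<open>simp_all, metis mult.commute\<close>)

lemma ideal_ring_onD:
  assumes "ideal I (ring_on A)"
  shows "I \<subseteq> A" "0 \<in> I" "x \<in> I \<Longrightarrow> y \<in> I \<Longrightarrow> x + y \<in> I" "a \<in> A \<Longrightarrow> x \<in> I \<Longrightarrow> a * x \<in> I"
proof -
  interpret ideal I "ring_on A" by fact
  show "I \<subseteq> A" using a_subset by simp
  show "0 \<in> I" using additive_subgroup.zero_closed[OF is_additive_subgroup] by simp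
  show "x + y \<in> I" if "x \<in> I" "y \<in> I" using additive_subgroup.a_closed[OF is_additive_subgroup, of x y] that by simp
  show "a * x \<in> I" if "a \<in> A" "x \<in> I" using I_l_closed[of x a] that by simp
qed

lemma genideal_ring_on_subset:
  assumes "ideal J (ring_on A)" "H \<subseteq> J"
  shows "genideal (ring_on A) H \<subseteq> J"
  using assms by (auto simp: genideal_def)

text \<open>An ideal of the larger ring meets \<open>A'\<close> in an ideal of
  \<open>A'\<close>.\<close>

lemma genideal_ring_on_mono:
  assumes "subring_set A'" "A' \<subseteq> A" "H \<subseteq> A'" "H \<subseteq> H'" "subring_set A"
  shows "genideal (ring_on A') H \<subseteq> genideal (ring_on A) H'"
proof -
  have "genideal (ring_on A') H \<subseteq> J" if J: "ideal J (ring_on A)" "H' \<subseteq> J" for J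
  proof -
    have "ideal (J \<inter> A') (ring_on A')"
      by (rule ideal_ring_onI)
        (use assms ideal_ring_onD[OF J(1)] subring_setD[OF assms(1)] in auto)
    then show ?thesis using genideal_ring_on_subset[of "J \<inter> A'" A' H] assms(3,4) J(2) by blast
  qed
  then show ?thesis by (auto simp: genideal_def[of "ring_on A" H'])
qed

lemma subring_set_UNIV: "subring_set UNIV"
  by (simp add: subring_set_def)

lemma subring_set_generate_ring: "subring_set (generate_ring (ring_on UNIV) H)"
proof -
  have "- x \<in> generate_ring (ring_on UNIV) H" if "x \<in> generate_ring (ring_on UNIV) H" for x
    using generate_ring.a_inv[OF that] ring_on_uminus[OF subring_set_UNIV, of x] by simp
  then show ?thesis
    using generate_ring.one[of "ring_on UNIV" H] generate_ring.eng_add[of _ "ring_on UNIV" H]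
      generate_ring.eng_mult[of _ "ring_on UNIV" H]
    by (auto simp: subring_set_def)
qed

lemma generate_ring_subset:
  assumes "subring_set A" "H \<subseteq> A"
  shows "generate_ring (ring_on UNIV) H \<subseteq> A"
proof
  fix x assume "x \<in> generate_ring (ring_on UNIV) H"
  then show "x \<in> A"
  proof (induction)
    case (a_inv h)
    then show ?case
      using subring_setD(3)[OF assms(1)] ring_on_uminus[OF subring_set_UNIV, of h] by simp
  qed (use assms subring_setD[OF assms(1)] in auto)
qed

lemma generate_ring_incl_ring_on: "H \<subseteq> generate_ring (ring_on UNIV) H"
  by (auto intro: generate_ring.incl)

lemma subring_set_semigroup_ring:
  assumes "monoid_on S"
  shows "subring_set (semigroup_ring S :: 'k::field ratfun set)"
proof -
  have "(1 :: 'k ratfun) \<in> semigroup_ring S"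
    using assms chi_in_semigroup_ring[of 0 S, where ?'a = 'k] by (simp add: monoid_on_def)
  then show ?thesis
    unfolding subring_set_def
    by (auto elim!: semigroup_ringE simp: keys_mult_subset[OF assms] keys_add_subset
        simp flip: lp_add lp_mult lp_uminus)
qed

lemma semigroup_ring_mono: "S \<subseteq> T \<Longrightarrow> semigroup_ring S \<subseteq> semigroup_ring T"
  by (auto elim!: semigroup_ringE)

lemma scal_in_semigroup_ring: "monoid_on S \<Longrightarrow> scal c \<in> semigroup_ring S"
  by (auto simp: scal_lp monoid_on_def)

lemma semigroup_ring_subset:
  assumes "subring_set A" "range scal \<subseteq> A" "\<And>m. m \<in> S \<Longrightarrow> chi m \<in> A"
  shows "semigroup_ring S \<subseteq> (A :: 'k::field ratfun set)"
proof
  fix x :: "'k ratfun" assume "x \<in> semigroup_ring S"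
  then obtain p where p: "x = lp p" "Poly_Mapping.keys p \<subseteq> S" by (rule semigroup_ringE)
  from p(2) have "lp p \<in> A"
    by (induction p rule: laurent_induct_on)
      (use assms(2,3) subring_setD[OF assms(1)] in \<open>auto simp: lp_single lp_add image_subset_iff\<close>)
  then show "x \<in> A" by (simp add: p)
qed

subsection \<open>Contractions of Laurent polynomials\<close>

text \<open>The linear map with chi^m \<mapsto> w(m) chi^(f m). For constant \<open>f\<close> it is
  a linear functional with values \<open>w\<close> on characters; for a projection of exponents it
  contracts one tensor factor against such a functional.\<close>

definition push :: "(exponent \<Rightarrow> exponent) \<Rightarrow> (exponent \<Rightarrow> 'k) \<Rightarrow> 'k::field laurent \<Rightarrow> 'k laurent" where
  "push f w p = (\<Sum>m\<in>Poly_Mapping.keys p. Poly_Mapping.single (f m) (w m * Poly_Mapping.lookup p m))"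

lemma push_sum:
  assumes "finite S" "Poly_Mapping.keys p \<subseteq> S"
  shows "push f w p = (\<Sum>m\<in>S. Poly_Mapping.single (f m) (w m * Poly_Mapping.lookup p m))"
  unfolding push_def
  by (rule sum.mono_neutral_left) (use assms in \<open>auto simp: in_keys_iff\<close>)

lemma push_single [simp]: "push f w (Poly_Mapping.single m c) = Poly_Mapping.single (f m) (w m * c)"
  by (subst push_sum[of "{m}"]) auto

lemma push_0 [simp]: "push f w 0 = 0"
  by (simp add: push_def)

lemma push_add: "push f w (p + q) = push f w p + push f w q"
proof -
  let ?S = "Poly_Mapping.keys p \<union> Poly_Mapping.keys q"
  have "finite ?S" "Poly_Mapping.keys (p + q) \<subseteq> ?S" by (auto simp: Poly_Mapping.keys_add)
  then show ?thesis
    by (simp add: push_sum[of ?S] lookup_add single_add sum.distrib distrib_left)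
qed

lemma push_uminus: "push f w (- p) = - push f w p"
  using push_add[of f w p "- p"] by (simp add: eq_neg_iff_add_eq_0 add.commute)

lemma push_diff: "push f w (p - q) = push f w p - push f w q"
  using push_add[of f w p "- q"] by (simp add: push_uminus)

lemma keys_push: "Poly_Mapping.keys (push f w p) \<subseteq> f ` Poly_Mapping.keys p"
proof -
  have "Poly_Mapping.keys (\<Sum>m\<in>T. Poly_Mapping.single (f m) (w m * Poly_Mapping.lookup p m)) \<subseteq> f ` T"
    if "finite T" for T using that
  proof (induction T)
    case (insert x F)
    have "Poly_Mapping.keys (Poly_Mapping.single (f x) (w x * Poly_Mapping.lookup p x)) \<subseteq> {f x}" by simp
    then show ?case using insert by (auto dest!: subsetD[OF Poly_Mapping.keys_add])
  qed simp
  then show ?thesis by (simp add: push_def)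
qed

text \<open>For additive \<open>f\<close> one takes \<open>b = f a\<close>, and \<open>w'\<close> is
  the translate of \<open>w\<close> by \<open>a\<close>. If \<open>w\<close> is invariant under this
  translation, the contraction is linear over the monomial.\<close>

lemma push_mult_single:
  assumes "\<And>e. f (a + e) = b + f e" "\<And>e. w (a + e) = w' e"
  shows "push f w (Poly_Mapping.single a c * p) = Poly_Mapping.single b c * push f w' p"
  by (induction p rule: laurent_induct)
    (simp_all add: mult_single assms distrib_left push_add mult.left_commute[of c])

lemma laurent_map_push: "laurent_map \<phi> p = push \<phi> (\<lambda>_. 1) p"
  by (simp add: laurent_map_def push_def)

lemma laurent_map_diff: "laurent_map \<phi> (p - q) = laurent_map \<phi> p - laurent_map \<phi> q"
  using laurent_map_add[of \<phi> p "- q"] by (simp add: laurent_map_uminus)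

lemma push_cong:
  assumes "\<And>m. m \<in> Poly_Mapping.keys p \<Longrightarrow> f m = g m" "\<And>m. m \<in> Poly_Mapping.keys p \<Longrightarrow> w m = v m"
  shows "push f w p = push g v p"
  unfolding push_def by (rule sum.cong) (use assms in auto)

lemma push_functional_delta:
  "push (\<lambda>_. 0) (\<lambda>e. if e = k then 1 else 0) p = Poly_Mapping.single 0 (Poly_Mapping.lookup p k)"
  by (induction p rule: laurent_induct)
    (auto simp: push_add lookup_add single_add lookup_single when_def)

section \<open>Exponents of the two factors of T \<times> T\<close>

definition lo :: "nat \<Rightarrow> exponent \<Rightarrow> exponent" where
  "lo n m = (\<Sum>i\<in>Poly_Mapping.keys m \<inter> {..<n}. Poly_Mapping.single i (Poly_Mapping.lookup m i))"

definition hi :: "nat \<Rightarrow> exponent \<Rightarrow> exponent" where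
  "hi n m = (\<Sum>i\<in>Poly_Mapping.keys m \<inter> {n..}. Poly_Mapping.single (i - n) (Poly_Mapping.lookup m i))"

lemma lookup_lo [simp]: "Poly_Mapping.lookup (lo n m) i = (if i < n then Poly_Mapping.lookup m i else 0)"
  by (auto simp: lo_def lookup_sum lookup_single when_def in_keys_iff)

lemma lookup_hi [simp]: "Poly_Mapping.lookup (hi n m) i = Poly_Mapping.lookup m (i + n)"
proof -
  have "Poly_Mapping.lookup (hi n m) i =
      (\<Sum>j\<in>Poly_Mapping.keys m \<inter> {n..}. if j = i + n then Poly_Mapping.lookup m j else 0)"
    unfolding hi_def lookup_sum by (rule sum.cong) (auto simp: lookup_single when_def)
  then show ?thesis by (auto simp: in_keys_iff)
qed

lemma lo_add: "lo n (a + b) = lo n a + lo n b" and hi_add: "hi n (a + b) = hi n a + hi n b"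
  by (rule poly_mapping_eqI; simp add: lookup_add)+

lemma lo_char_lattice [simp]: "lo n m \<in> char_lattice n"
  by (simp add: char_lattice_iff)

lemma lo_eq [simp]: "m \<in> char_lattice n \<Longrightarrow> lo n m = m"
  and hi_eq_0 [simp]: "m \<in> char_lattice n \<Longrightarrow> hi n m = 0"
  and lo_shift [simp]: "lo n (shift n m) = 0"
  and hi_shift [simp]: "hi n (shift n m) = m"
  by (rule poly_mapping_eqI; auto simp: char_lattice_iff lookup_shift)+

lemma hi_char_lattice: "m \<in> char_lattice (2 * n) \<Longrightarrow> hi n m \<in> char_lattice n"
  by (simp add: char_lattice_iff)

lemma char_lattice_mono: "m \<le> n \<Longrightarrow> char_lattice m \<subseteq> char_lattice n"
  by (auto simp: char_lattice_iff)

lemma shift_char_lattice: "m \<in> char_lattice n \<Longrightarrow> shift n m \<in> char_lattice (2 * n)"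
  by (auto simp: char_lattice_iff lookup_shift)

lemma lo_0 [simp]: "lo n 0 = 0" and hi_0 [simp]: "hi n 0 = 0"
  by (rule poly_mapping_eqI; simp)+

subsection \<open>The coaction of the torus\<close>

definition diag :: "nat \<Rightarrow> 'k::field laurent \<Rightarrow> 'k laurent" where
  "diag n = laurent_map (\<lambda>m. m + shift n m)"

lemma laurent_map_1: "\<phi> 0 = 0 \<Longrightarrow> laurent_map \<phi> 1 = (1 :: 'k::field laurent)"
  using laurent_map_single[of \<phi> 0 "1::'k"] by (simp add: single_one)

lemma shift_0 [simp]: "shift n 0 = 0"
  by (simp add: shift_def)

lemma second_lp: "second n (lp p) = lp (laurent_map (shift n) p)"
  unfolding second_def lp_def
  by (subst char_map_Fract) (auto simp: shift_add inj_shift laurent_map_1)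

lemma coaction_Fract:
  "b \<noteq> 0 \<Longrightarrow> coaction n (Fract a b) = Fract (diag n a) (diag n b)"
  unfolding coaction_def diag_def
  by (subst char_map_Fract) (auto simp: shift_add inj_diagonal algebra_simps)

lemma diag_1 [simp]: "diag n 1 = 1"
  by (simp add: diag_def laurent_map_1)

lemma diag_nonzero: "p \<noteq> 0 \<Longrightarrow> diag n p \<noteq> 0"
  using laurent_map_eq_0[OF inj_diagonal] by (auto simp: diag_def)

lemma coaction_lp: "coaction n (lp p) = lp (diag n p)"
  by (simp add: lp_def coaction_Fract)

lemma coaction_quotient:
  "b \<noteq> 0 \<Longrightarrow> coaction n (lp a / lp b) = lp (diag n a) / lp (diag n b)"
  by (simp add: lp_def coaction_Fract)

lemma diag_single [simp]: "diag n (Poly_Mapping.single m c) = Poly_Mapping.single (m + shift n m) c"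
  by (simp add: diag_def)

lemma diag_add: "diag n (p + q) = diag n p + diag n q"
  and diag_0 [simp]: "diag n 0 = 0"
  by (simp_all add: diag_def laurent_map_add)

lemma keys_laurent_map: "Poly_Mapping.keys (laurent_map \<phi> p) \<subseteq> \<phi> ` Poly_Mapping.keys p"
  by (simp add: laurent_map_push keys_push)

lemma keys_shift:
  assumes "Poly_Mapping.keys p \<subseteq> char_lattice n"
  shows "Poly_Mapping.keys (laurent_map (shift n) p) \<subseteq> char_lattice (2 * n)"
  using keys_laurent_map[of "shift n" p] assms shift_char_lattice by fastforce

text \<open>The coaction sends chi^m to chi^m \<otimes> chi^m, so evaluating \<mu> on the first
  factor leaves \<mu>(m) chi^m.\<close>

lemma push_diag:
  assumes "Poly_Mapping.keys p \<subseteq> char_lattice n"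
  shows "push (hi n) (\<lambda>e. \<mu> (lo n e)) (diag n p) = push (\<lambda>m. m) \<mu> p"
  using assms
  by (induction p rule: laurent_induct_on) (simp_all add: diag_add push_add lo_add hi_add)

section \<open>Torus-stable subrings of the function field\<close>

lemma torus_field_quotient:
  assumes "x \<in> torus_field n"
  obtains a b where "b \<noteq> 0" "Poly_Mapping.keys a \<subseteq> char_lattice n" "Poly_Mapping.keys b \<subseteq> char_lattice n"
    "x = lp a / lp b"
proof -
  obtain a b where ab: "Poly_Mapping.keys a \<subseteq> char_lattice n" "Poly_Mapping.keys b \<subseteq> char_lattice n"
      "x = lp a / lp b"
    using assms by (auto simp: torus_field_def quotients_def elim!: semigroup_ringE)
  show thesis
  proof (cases "b = 0")
    case True
    \<comment> \<open>A zero denominator is allowed in \<open>quotients\<close>; the fraction is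
      then 0, which is also 0/1.\<close>
    then show thesis using ab by (intro that[of 1 0]) (auto simp: char_lattice_def)
  next
    case False
    then show thesis using ab that by blast
  qed
qed

text \<open>Denominators come only from \<open>A\<close>, hence involve only the variables of the
  first factor; the second factor contributes Laurent polynomials. The elements with such a
  denominator form a subring.\<close>

lemma tensor_common_denominator:
  assumes A: "A \<subseteq> torus_field n" and x: "x \<in> tensor_torus n A"
  shows "\<exists>e p. e \<noteq> 0 \<and> Poly_Mapping.keys e \<subseteq> char_lattice n \<and>
     Poly_Mapping.keys p \<subseteq> char_lattice (2 * n) \<and> lp e * x = lp p"
    (is "?P x")
proof -
  note mono = monoid_on_char_lattice
  have sub: "Poly_Mapping.keys p \<subseteq> char_lattice (2 * n)" if "Poly_Mapping.keys p \<subseteq> char_lattice n" for p :: "'a laurent"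
    using that char_lattice_mono[of n "2 * n"] by auto
  have k1: "Poly_Mapping.keys (1 :: 'a laurent) \<subseteq> char_lattice n"
    by simp
  have "subring_set {x. ?P x}"
    unfolding subring_set_def
  proof (intro conjI ballI)
    show "1 \<in> {x. ?P x}"
      using k1 sub[OF k1] by (auto intro!: exI[of _ 1] simp: lp_1)
  next
    fix x assume "x \<in> {x. ?P x}"
    then obtain e p where "e \<noteq> 0" "Poly_Mapping.keys e \<subseteq> char_lattice n"
      "Poly_Mapping.keys p \<subseteq> char_lattice (2 * n)" "lp e * x = lp p" by blast
    then show "- x \<in> {x. ?P x}"
      by (intro CollectI exI[of _ e] exI[of _ "- p"]) (simp add: lp_uminus)
  next
    fix x y assume "x \<in> {x. ?P x}" "y \<in> {x. ?P x}"
    then obtain e p d q where ep: "e \<noteq> 0" "Poly_Mapping.keys e \<subseteq> char_lattice n"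
      "Poly_Mapping.keys p \<subseteq> char_lattice (2 * n)" "lp e * x = lp p" and
      dq: "d \<noteq> 0" "Poly_Mapping.keys d \<subseteq> char_lattice n"
      "Poly_Mapping.keys q \<subseteq> char_lattice (2 * n)" "lp d * y = lp q" by blast
    have ed: "e * d \<noteq> 0" "Poly_Mapping.keys (e * d) \<subseteq> char_lattice n"
      by (use ep dq in simp) (intro keys_mult_subset[OF mono] ep dq)
    have "lp (e * d) * (x + y) = lp d * (lp e * x) + lp e * (lp d * y)"
      by (simp add: lp_mult algebra_simps)
    also have "\<dots> = lp (d * p + e * q)" by (simp add: ep dq lp_add lp_mult)
    finally have "lp (e * d) * (x + y) = lp (d * p + e * q)" .
    moreover have "Poly_Mapping.keys (d * p + e * q) \<subseteq> char_lattice (2 * n)"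
      by (intro keys_add_subset keys_mult_subset[OF mono] sub ep dq)
    ultimately show "x + y \<in> {x. ?P x}" using ed by blast
    have "lp (e * d) * (x * y) = (lp e * x) * (lp d * y)"
      by (simp add: lp_mult algebra_simps)
    also have "\<dots> = lp (p * q)" by (simp add: ep dq lp_mult)
    finally have "lp (e * d) * (x * y) = lp (p * q)" .
    moreover have "Poly_Mapping.keys (p * q) \<subseteq> char_lattice (2 * n)"
      by (intro keys_mult_subset[OF mono] ep dq)
    ultimately show "x * y \<in> {x. ?P x}" using ed by blast
  qed
  moreover have "?P x" if xA: "x \<in> A" for x
  proof -
    obtain a b where "b \<noteq> 0" "Poly_Mapping.keys a \<subseteq> char_lattice n" "Poly_Mapping.keys b \<subseteq> char_lattice n"
      "x = lp a / lp b" by (rule torus_field_quotient[OF subsetD[OF A xA]])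
    then show ?thesis by (intro exI[of _ b] exI[of _ a]) (simp add: sub)
  qed
  moreover have "?P x" if xs: "x \<in> second n ` torus_ring n" for x
  proof -
    obtain p where "x = second n (lp p)" "Poly_Mapping.keys p \<subseteq> char_lattice n"
      using xs by (auto elim!: semigroup_ringE)
    then show ?thesis
      using k1 by (intro exI[of _ 1] exI[of _ "laurent_map (shift n) p"]) (simp add: second_lp keys_shift)
  qed
  ultimately have "tensor_torus n A \<subseteq> {x. ?P x}"
    unfolding tensor_torus_def by (intro generate_ring_subset) auto
  then show ?thesis using x by blast
qed

text \<open>If \<open>f(xy)\<close> is a Laurent polynomial in \<open>y\<close> with coefficients in \<open>k(x)\<close>, then replacing \<open>y\<close>
  by \<open>y/x\<close> and comparing coefficients at one monomial in \<open>x\<close> shows that \<open>f\<close> is a Laurent polynomial.\<close>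

lemma coaction_stable_imp_laurent:
  assumes A: "A \<subseteq> torus_field n" and f: "f \<in> torus_field n" "coaction n f \<in> tensor_torus n A"
  shows "f \<in> torus_ring n"
proof -
  obtain g d where gd: "d \<noteq> 0" "Poly_Mapping.keys g \<subseteq> char_lattice n" "Poly_Mapping.keys d \<subseteq> char_lattice n"
      "f = lp g / lp d"
    by (rule torus_field_quotient[OF f(1)])
  obtain e r where er: "e \<noteq> 0" "Poly_Mapping.keys e \<subseteq> char_lattice n"
      "Poly_Mapping.keys r \<subseteq> char_lattice (2 * n)" "lp e * coaction n f = lp r"
    using tensor_common_denominator[OF A f(2)] by blast
  have "lp (diag n d) \<noteq> 0" using diag_nonzero[OF gd(1)] by simp
  then have "lp e * lp (diag n g) = lp (diag n d) * lp r"
    using er(4) by (simp add: gd(4) coaction_quotient[OF gd(1)] field_simps)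
  then have eq: "diag n g * e = diag n d * r"
    by (simp add: mult.commute flip: lp_mult)
  obtain k where k: "k \<in> Poly_Mapping.keys e" using er(1) by (metis keys_eq_empty ex_in_conv)
  \<comment> \<open>Under y \<mapsto> y/x the monomial x^a y^b becomes x^(a-b) y^b, so
    \<open>?T\<close> extracts the coefficient of x^k. The choice of \<open>k\<close> among the
    exponents of \<open>e\<close> makes \<open>?T e\<close> a nonzero constant.\<close>
  let ?w = "\<lambda>m. if lo n m - hi n m = k then 1 else 0 :: 'a"
  let ?T = "push (hi n) ?w"
  have T: "?T (diag n p * q) = p * ?T q" if "Poly_Mapping.keys p \<subseteq> char_lattice n" for p q
    using that
  proof (induction p rule: laurent_induct_on)
    case (single m c)
    then show ?case
      unfolding diag_single by (intro push_mult_single) (auto simp: lo_add hi_add)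
  qed (simp_all add: diag_add distrib_right push_add)
  have "?T e = Poly_Mapping.single 0 (Poly_Mapping.lookup e k)"
    unfolding push_functional_delta[symmetric] by (rule push_cong) (use er(2) in auto)
  then have "g * Poly_Mapping.single 0 (Poly_Mapping.lookup e k) = d * ?T r"
    using T[OF gd(2), of e] T[OF gd(3), of r] eq by simp
  from arg_cong[OF this, of lp]
  have eq': "lp g * scal (Poly_Mapping.lookup e k) = lp d * lp (?T r)"
    by (simp only: lp_mult scal_lp)
  have c: "Poly_Mapping.lookup e k \<noteq> 0" using k by (simp add: in_keys_iff)
  have "lp g = scal (inverse (Poly_Mapping.lookup e k)) * (lp g * scal (Poly_Mapping.lookup e k))"
    using c by (simp add: mult.left_commute flip: scal_mult)
  also have "\<dots> = lp d * (scal (inverse (Poly_Mapping.lookup e k)) * lp (?T r))"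
    by (simp add: eq' mult.left_commute)
  finally have "f = scal (inverse (Poly_Mapping.lookup e k)) * lp (?T r)"
    using gd(1) by (simp add: gd(4))
  moreover have "Poly_Mapping.keys (?T r) \<subseteq> char_lattice n"
    using keys_push[of "hi n" ?w r] er(3) hi_char_lattice by fastforce
  ultimately show ?thesis
    by (simp add: subring_setD(6)[OF subring_set_semigroup_ring[OF monoid_on_char_lattice]]
        scal_in_semigroup_ring[OF monoid_on_char_lattice])
qed

lemma push_column_diag:
  assumes "Poly_Mapping.keys p \<subseteq> char_lattice n"
  shows "push (lo n) (\<lambda>e. if hi n e = k then 1 else 0) (diag n p) = Poly_Mapping.single k (Poly_Mapping.lookup p k)"
  using assms
  by (induction p rule: laurent_induct_on)
    (auto simp: diag_add push_add lo_add hi_add lookup_add single_add lookup_single when_def)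

text \<open>Characters of the second factor are a basis of A \<otimes> k[T] over A, and the
  contraction reads off the coefficient at chi^k.\<close>

lemma tensor_columns:
  assumes A: "A \<subseteq> torus_ring n" "subring_set A" "range scal \<subseteq> A" and x: "x \<in> tensor_torus n A"
  shows "\<exists>p. x = lp p \<and> (\<forall>k. lp (push (lo n) (\<lambda>e. if hi n e = k then 1 else 0) p) \<in> A)"
proof -
  let ?C = "\<lambda>k. push (lo n) (\<lambda>e. if hi n e = k then 1 else 0 :: 'a)"
  define Q where "Q = {lp p | p. \<forall>k. lp (?C k p) \<in> A}"
  note sA = subring_setD[OF A(2)]
  have Qadd: "x + y \<in> Q" if "x \<in> Q" "y \<in> Q" for x y
    using that sA(4) unfolding Q_def by (auto simp: push_add simp flip: lp_add) (metis lp_add)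
  have Qminus: "- x \<in> Q" if "x \<in> Q" for x
    using that sA(3) unfolding Q_def by (auto simp: push_uminus simp flip: lp_uminus) (metis lp_uminus)
  \<comment> \<open>The multipliers of \<open>Q\<close> form a ring, so it suffices that the
    generators of A \<otimes> k[T] are multipliers and that 1 lies in \<open>Q\<close>; closure of
    \<open>Q\<close> under products need not be shown directly.\<close>
  let ?R = "{x. \<forall>y\<in>Q. x * y \<in> Q}"
  have "subring_set ?R"
    unfolding subring_set_def using Qadd Qminus by (auto simp: distrib_right mult.assoc)
  moreover have "A \<subseteq> ?R"
  proof safe
    fix x y assume "x \<in> A" "y \<in> Q"
    obtain p where p: "x = lp p" "Poly_Mapping.keys p \<subseteq> char_lattice n"
      using semigroup_ringE[OF subsetD[OF A(1) \<open>x \<in> A\<close>]] .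
    obtain q where "y = lp q" "\<And>k. lp (?C k q) \<in> A"
      using \<open>y \<in> Q\<close> unfolding Q_def by blast
    with p \<open>x \<in> A\<close> have pq: "x = lp p" "Poly_Mapping.keys p \<subseteq> char_lattice n" "lp p \<in> A"
        "y = lp q" "\<And>k. lp (?C k q) \<in> A" by auto
    have "?C k (p * q) = p * ?C k q" for k
      using pq(2)
    proof (induction p rule: laurent_induct_on)
      case (single m c)
      then show ?case by (intro push_mult_single) (auto simp: lo_add hi_add)
    qed (simp_all add: distrib_right push_add)
    then show "x * y \<in> Q" using pq sA(6) by (auto simp: Q_def lp_mult intro!: exI[of _ "p * q"])
  qed
  moreover have "second n ` torus_ring n \<subseteq> ?R"
  proof safe
    fix x y :: "'a ratfun" assume "x \<in> torus_ring n" "y \<in> Q"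
    obtain p where p: "x = lp p"
      using semigroup_ringE[OF \<open>x \<in> torus_ring n\<close>] .
    obtain q where "y = lp q" "\<And>k. lp (?C k q) \<in> A"
      using \<open>y \<in> Q\<close> unfolding Q_def by blast
    with p have pq: "x = lp p" "y = lp q" "\<And>k. lp (?C k q) \<in> A" by auto
    have "lp (?C k (laurent_map (shift n) p * q)) \<in> A" for k
    proof (induction p rule: laurent_induct)
      case (1 m c)
      have "?C k (Poly_Mapping.single (shift n m) c * q) = Poly_Mapping.single 0 c * ?C (k - m) q"
        by (intro push_mult_single) (auto simp: lo_add hi_add algebra_simps)
      then show ?case using pq(3) sA(6) A(3) by (simp add: lp_mult image_subset_iff flip: scal_lp)
    next
      case (2 f g)
      then show ?case using sA(4) by (simp add: laurent_map_add distrib_right push_add lp_add)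
    qed
    then show "second n x * y \<in> Q"
      by (auto simp: Q_def pq second_lp lp_mult intro!: exI[of _ "laurent_map (shift n) p * q"])
  qed
  ultimately have "tensor_torus n A \<subseteq> ?R"
    unfolding tensor_torus_def by (intro generate_ring_subset) auto
  moreover have "1 \<in> Q"
  proof -
    have "lp (?C k 1) \<in> A" for k
      unfolding single_one[symmetric] push_single using A(3) sA(1,2)
      by (auto simp: single_one)
    then show ?thesis by (auto simp: Q_def intro!: exI[of _ 1])
  qed
  ultimately have "x \<in> Q" using x by fastforce
  then show ?thesis by (auto simp: Q_def)
qed

text \<open>Stability under the torus means grading by characters: the column at chi^k of the
  coaction of f is the homogeneous component c chi^k of f, and columns lie in
  \<open>A\<close>.\<close>

lemma coaction_stable_imp_semigroup_ring:
  assumes A: "subring_set A" "range scal \<subseteq> A" "A \<subseteq> torus_field n" "coaction n ` A \<subseteq> tensor_torus n A"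
  shows "A = semigroup_ring {m \<in> char_lattice n. chi m \<in> A}"
proof
  have AT: "A \<subseteq> torus_ring n"
    using coaction_stable_imp_laurent[OF A(3)] A(3,4) by blast
  show "A \<subseteq> semigroup_ring {m \<in> char_lattice n. chi m \<in> A}"
  proof
    fix f assume f: "f \<in> A"
    then obtain p where p: "f = lp p" "Poly_Mapping.keys p \<subseteq> char_lattice n"
      using AT by (auto elim!: semigroup_ringE)
    have "coaction n f \<in> tensor_torus n A" using A(4) f by blast
    then obtain q where q: "lp (diag n p) = lp q"
        "\<And>k. lp (push (lo n) (\<lambda>e. if hi n e = k then 1 else 0) q) \<in> A"
      using tensor_columns[OF AT A(1,2)] unfolding p coaction_lp by blast
    have "chi k \<in> A" if "k \<in> Poly_Mapping.keys p" for k
    proof -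
      let ?c = "Poly_Mapping.lookup p k"
      have c: "?c \<noteq> 0" using that by (simp add: in_keys_iff)
      have "scal ?c * chi k \<in> A"
        using q(2)[of k, folded q(1)[unfolded lp_eq_iff]] by (simp add: push_column_diag[OF p(2)] flip: lp_single)
      then have "scal (inverse ?c) * (scal ?c * chi k) \<in> A"
        using A(2) subring_setD(6)[OF A(1)] by blast
      moreover have "scal (inverse ?c) * (scal ?c * chi k) = chi k"
        using c by (simp flip: mult.assoc scal_mult)
      ultimately show ?thesis by simp
    qed
    then show "f \<in> semigroup_ring {m \<in> char_lattice n. chi m \<in> A}" using p by auto
  qed
qed (rule semigroup_ring_subset[OF A(1,2)], simp)

subsection \<open>Invariants of a finite subgroup scheme\<close>

text \<open>A character restricts to 1 on the subgroup scheme with ideal \<open>I\<close> exactly if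
  chi^m - 1 lies in \<open>I\<close>; this is the lattice L of the overview.\<close>

definition trivial_chars :: "nat \<Rightarrow> 'k::field ratfun set \<Rightarrow> exponent set" where
  "trivial_chars n I = {m \<in> char_lattice n. chi m - 1 \<in> I}"

text \<open>A linear functional \<open>\<mu>\<close> on \<open>k[T]\<close> that vanishes on \<open>I'\<close> induces a map
  \<open>\<mu> \<otimes> id: k[T] \<otimes> k[T] \<rightarrow> k[T]\<close>, which takes \<open>I' \<otimes> 1 + 1 \<otimes> I\<close> into \<open>I\<close>. The functional is given by
  its values on characters.\<close>

lemma contraction_genideal:
  fixes I :: "'k::field ratfun set"
  assumes I: "ideal I (ring_on (torus_ring n))"
    and I': "I' \<subseteq> torus_ring n" "\<And>m x. m \<in> char_lattice n \<Longrightarrow> x \<in> I' \<Longrightarrow> chi m * x \<in> I'"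
    and \<mu>: "\<And>p. lp p \<in> I' \<Longrightarrow> push (\<lambda>_. 0) \<mu> p = 0"
    and x: "lp p \<in> genideal (ring_on (torus_ring (2 * n))) (I' \<union> second n ` I)"
  shows "lp (push (hi n) (\<lambda>e. \<mu> (lo n e)) p) \<in> I"
proof -
  \<comment> \<open>Multiplication by a monomial replaces \<mu> by a translate. To be an ideal,
    \<open>J\<close> must therefore test all functionals vanishing on \<open>I'\<close> at once; the
    translates are among them because \<open>I'\<close> is stable under characters.\<close>
  define Ann :: "(exponent \<Rightarrow> 'k) set" where "Ann = {\<mu>. \<forall>p. lp p \<in> I' \<longrightarrow> push (\<lambda>_. 0) \<mu> p = 0}"
  let ?T = "\<lambda>\<mu>. push (hi n) (\<lambda>e. \<mu> (lo n e))"
  define J where "J = {lp p | p. Poly_Mapping.keys p \<subseteq> char_lattice (2 * n) \<and> (\<forall>\<mu>\<in>Ann. lp (?T \<mu> p) \<in> I)}"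
  have JI: "lp p \<in> J \<longleftrightarrow> Poly_Mapping.keys p \<subseteq> char_lattice (2 * n) \<and> (\<forall>\<mu>\<in>Ann. lp (?T \<mu> p) \<in> I)" for p
    by (auto simp: J_def)
  note I_D = ideal_ring_onD[OF I]
  note mono = monoid_on_char_lattice
  have translate: "(\<lambda>e. \<mu> (m + e)) \<in> Ann" if "\<mu> \<in> Ann" "m \<in> char_lattice n" for \<mu> m
  proof -
    have "push (\<lambda>_. 0) (\<lambda>e. \<mu> (m + e)) p = 0" if p: "lp p \<in> I'" for p
    proof -
      have "lp (Poly_Mapping.single m 1 * p) \<in> I'"
        using I'(2)[OF \<open>m \<in> char_lattice n\<close> p] by (simp add: chi_lp lp_mult)
      then have "push (\<lambda>_. 0) \<mu> (Poly_Mapping.single m 1 * p) = 0"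
        using \<open>\<mu> \<in> Ann\<close> by (simp add: Ann_def)
      moreover have "push (\<lambda>_. 0) \<mu> (Poly_Mapping.single m 1 * p)
          = Poly_Mapping.single 0 1 * push (\<lambda>_. 0) (\<lambda>e. \<mu> (m + e)) p"
        by (rule push_mult_single) auto
      ultimately show ?thesis by (simp add: single_one)
    qed
    then show ?thesis by (simp add: Ann_def)
  qed
  have mult: "lp (?T \<mu> (q * p)) \<in> I"
    if "Poly_Mapping.keys q \<subseteq> char_lattice (2 * n)" "lp p \<in> J" "\<mu> \<in> Ann" for q p \<mu>
    using that(1)
  proof (induction q rule: laurent_induct_on)
    case zero then show ?case using I_D(2) by simp
  next
    case (single m c)
    have "?T \<mu> (Poly_Mapping.single m c * p)
        = Poly_Mapping.single (hi n m) c * push (hi n) (\<lambda>e. \<mu> (lo n m + lo n e)) p"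
      by (rule push_mult_single) (simp_all add: lo_add hi_add)
    moreover have "lp (push (hi n) (\<lambda>e. \<mu> (lo n m + lo n e)) p) \<in> I"
      using that(2) translate[OF that(3), of "lo n m"] by (auto simp: JI)
    moreover have "lp (Poly_Mapping.single (hi n m) c) \<in> torus_ring n"
      using hi_char_lattice[OF single] by (simp add: subset_iff)
    ultimately show ?case using I_D(4) by (simp add: lp_mult)
  next
    case (add f g)
    then show ?case using I_D(3) by (simp add: distrib_right push_add lp_add)
  qed
  have "ideal J (ring_on (torus_ring (2 * n)))"
  proof (rule ideal_ring_onI)
    show "subring_set (torus_ring (2 * n) :: 'k ratfun set)"
      by (rule subring_set_semigroup_ring[OF mono])
    show "J \<subseteq> torus_ring (2 * n)" by (auto simp: J_def)
    show "0 \<in> J" using JI[of 0] I_D(2) by simp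
  next
    fix x y assume xy: "x \<in> J" "y \<in> J"
    then obtain p q where pq: "x = lp p" "y = lp q" by (auto simp: J_def)
    have "lp (p + q) \<in> J"
      using xy I_D(3) unfolding pq JI by (auto simp: push_add lp_add dest!: subsetD[OF Poly_Mapping.keys_add])
    then show "x + y \<in> J" by (simp add: pq lp_add)
  next
    fix a x :: "'k ratfun" assume "a \<in> torus_ring (2 * n)" and x: "x \<in> J"
    then obtain q where q: "a = lp q" "Poly_Mapping.keys q \<subseteq> char_lattice (2 * n)"
      by (blast elim: semigroup_ringE)
    obtain p where p: "x = lp p" "Poly_Mapping.keys p \<subseteq> char_lattice (2 * n)" using x by (auto simp: J_def)
    have "lp (q * p) \<in> J"
      unfolding JI using mult[OF q(2) x[unfolded p(1)]] keys_mult_subset[OF mono q(2) p(2)] by blast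
    then show "a * x \<in> J" by (simp add: p q lp_mult)
  qed
  moreover have "I' \<subseteq> J"
  proof
    fix x assume x: "x \<in> I'"
    then obtain p where p: "x = lp p" "Poly_Mapping.keys p \<subseteq> char_lattice n"
      using I'(1) by (blast elim: semigroup_ringE)
    have "?T \<mu> p = 0" if "\<mu> \<in> Ann" for \<mu>
    proof -
      have "?T \<mu> p = push (\<lambda>_. 0) \<mu> p" by (rule push_cong) (use p(2) in auto)
      then show ?thesis using that x p(1) by (auto simp: Ann_def)
    qed
    then show "x \<in> J"
      unfolding p(1) JI using p(2) char_lattice_mono[of n "2 * n"] I_D(2) by auto
  qed
  moreover have "second n ` I \<subseteq> J"
  proof safe
    fix x assume x: "x \<in> I"
    then obtain p where p: "x = lp p" "Poly_Mapping.keys p \<subseteq> char_lattice n"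
      using I_D(1) by (blast elim: semigroup_ringE)
    have "?T \<mu> (laurent_map (shift n) p) = Poly_Mapping.single 0 (\<mu> 0) * p" for \<mu>
      by (induction p rule: laurent_induct)
        (simp_all add: laurent_map_add push_add distrib_left mult_single)
    then have "lp (?T \<mu> (laurent_map (shift n) p)) = scal (\<mu> 0) * x" for \<mu>
      by (simp add: lp_mult p flip: scal_lp)
    then have "lp (?T \<mu> (laurent_map (shift n) p)) \<in> I" for \<mu>
      using I_D(4)[OF scal_in_semigroup_ring[OF mono] x] by simp
    then show "second n x \<in> J"
      unfolding p(1) second_lp JI using keys_shift[OF p(2)] by blast
  qed
  ultimately have "genideal (ring_on (torus_ring (2 * n))) (I' \<union> second n ` I) \<subseteq> J"
    by (intro genideal_ring_on_subset) auto
  then have "lp p \<in> J" using x by blast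
  then show ?thesis unfolding JI using \<mu> by (auto simp: Ann_def)
qed

text \<open>Coaction minus identity sends chi^m to chi^m \<otimes> (chi^m - 1). Contracting the
  first factor with the coefficient functional at k isolates c (chi^k - 1), so invariance can be
  tested one monomial at a time.\<close>

lemma invariants_semigroup_ring:
  fixes I :: "'k::field ratfun set"
  assumes I: "ideal I (ring_on (torus_ring n))" and S: "monoid_on S" "S \<subseteq> char_lattice n"
  shows "invariants n I (semigroup_ring S) = semigroup_ring (S \<inter> trivial_chars n I)"
proof -
  note mono = monoid_on_char_lattice
  note I_D = ideal_ring_onD[OF I]
  let ?A = "semigroup_ring S :: 'k ratfun set"
  let ?TT = "tensor_torus n ?A"
  have sub: "subring_set ?TT" unfolding tensor_torus_def by (rule subring_set_generate_ring)
  have gens: "?A \<union> second n ` torus_ring n \<subseteq> ?TT"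
    unfolding tensor_torus_def by (rule generate_ring_incl_ring_on)
  have "S \<subseteq> char_lattice (2 * n)" using S(2) char_lattice_mono[of n "2 * n"] by auto
  then have "?A \<subseteq> torus_ring (2 * n)" by (rule semigroup_ring_mono)
  moreover have "second n ` torus_ring n \<subseteq> (torus_ring (2 * n) :: 'k ratfun set)"
    by (auto simp: second_lp keys_shift elim!: semigroup_ringE)
  ultimately have TT: "?TT \<subseteq> torus_ring (2 * n)"
    unfolding tensor_torus_def by (intro generate_ring_subset subring_set_semigroup_ring mono) auto
  show ?thesis
  proof (intro equalityI subsetI)
    fix f assume f: "f \<in> invariants n I ?A"
    then obtain p where p: "f = lp p" "Poly_Mapping.keys p \<subseteq> S"
      by (auto simp: invariants_def elim!: semigroup_ringE)
    have kp: "Poly_Mapping.keys p \<subseteq> char_lattice n" using p(2) S(2) by auto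
    \<comment> \<open>Passing to the ring of T \<times> T can only enlarge the ideal. With the empty
      set as \<open>I'\<close> the contraction is available for every functional, in particular for
      coefficient functionals.\<close>
    have "genideal (ring_on ?TT) (second n ` I)
        \<subseteq> genideal (ring_on (torus_ring (2 * n))) ({} \<union> second n ` I)"
    proof (rule genideal_ring_on_mono[OF sub TT])
      show "second n ` I \<subseteq> ?TT" using gens I_D(1) by blast
      show "subring_set (torus_ring (2 * n) :: 'k ratfun set)"
        by (rule subring_set_semigroup_ring[OF mono])
    qed simp
    then have in_gen: "lp (diag n p - p) \<in> genideal (ring_on (torus_ring (2 * n))) ({} \<union> second n ` I)"
      using f by (auto simp: invariants_def p coaction_lp lp_diff)
    have "k \<in> trivial_chars n I" if k: "k \<in> Poly_Mapping.keys p" for k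
    proof -
      let ?c = "Poly_Mapping.lookup p k"
      define \<mu> :: "exponent \<Rightarrow> 'k" where "\<mu> = (\<lambda>e. if e = k then 1 else 0)"
      have c: "?c \<noteq> 0" using k by (simp add: in_keys_iff)
      have "lp (push (hi n) (\<lambda>e. \<mu> (lo n e)) (diag n p - p)) \<in> I"
        by (rule contraction_genideal[OF I _ _ _ in_gen]) auto
      moreover have "push (\<lambda>m. m) \<mu> p = Poly_Mapping.single k ?c"
        unfolding \<mu>_def by (induction p rule: laurent_induct)
          (auto simp: push_add lookup_add single_add lookup_single when_def)
      moreover have "push (hi n) (\<lambda>e. \<mu> (lo n e)) p = push (\<lambda>_. 0) \<mu> p"
        by (rule push_cong) (use kp in auto)
      ultimately have "lp (Poly_Mapping.single k ?c - Poly_Mapping.single 0 ?c) \<in> I"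
        by (simp add: push_diff push_diag[OF kp] push_functional_delta[of k p, folded \<mu>_def])
      then have "scal ?c * (chi k - 1) \<in> I"
        by (simp add: lp_diff lp_single right_diff_distrib)
      then have "scal (inverse ?c) * (scal ?c * (chi k - 1)) \<in> I"
        by (rule I_D(4)[OF scal_in_semigroup_ring[OF mono]])
      moreover have "scal (inverse ?c) * (scal ?c * (chi k - 1)) = chi k - 1"
        using c by (simp flip: mult.assoc scal_mult)
      ultimately show ?thesis using k kp by (auto simp: trivial_chars_def)
    qed
    then show "f \<in> semigroup_ring (S \<inter> trivial_chars n I)" using p by auto
  next
    fix f :: "'k ratfun" assume "f \<in> semigroup_ring (S \<inter> trivial_chars n I)"
    then obtain p where p: "f = lp p" "Poly_Mapping.keys p \<subseteq> S \<inter> trivial_chars n I"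
      by (auto elim!: semigroup_ringE)
    have "coaction n f - f \<in> J" if J: "ideal J (ring_on ?TT)" "second n ` I \<subseteq> J" for J
      using p(2) unfolding p(1) coaction_lp
    proof (induction p rule: laurent_induct_on)
      case zero
      then show ?case using ideal_ring_onD(2)[OF J(1)] by simp
    next
      case (single m c)
      then have "second n (chi m - 1) \<in> J" using J(2) by (auto simp: trivial_chars_def)
      moreover have "lp (Poly_Mapping.single m c) \<in> ?TT" using gens single by auto
      ultimately have "lp (Poly_Mapping.single m c) * second n (chi m - 1) \<in> J"
        using ideal_ring_onD(4)[OF J(1)] by blast
      moreover have "second n (chi m - 1) = (chi (shift n m) - 1 :: 'k ratfun)"
        unfolding chi_lp lp_1[symmetric] lp_diff[symmetric] second_lp
        by (simp add: laurent_map_diff laurent_map_1)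
      ultimately show ?case by (simp add: lp_single chi_add algebra_simps)
    next
      case (add f g)
      then show ?case using ideal_ring_onD(3)[OF J(1) add(3,4)] by (simp add: diag_add lp_add algebra_simps)
    qed
    then have "coaction n f - f \<in> genideal (ring_on ?TT) (second n ` I)"
      by (auto simp: genideal_def)
    then show "f \<in> invariants n I ?A" using p by (auto simp: invariants_def)
  qed
qed

section \<open>The exponent of the character group of a finite subgroup\<close>

lemma trivial_chars_add:
  assumes "ideal I (ring_on (torus_ring n))" "a \<in> trivial_chars n I" "b \<in> trivial_chars n I"
  shows "a + b \<in> trivial_chars n (I :: 'k::field ratfun set)"
proof -
  have "chi a * (chi b - 1) + (chi a - 1) \<in> I"
    using assms by (intro ideal_ring_onD(3,4)[OF assms(1)]) (auto simp: trivial_chars_def)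
  then show ?thesis using assms(2,3) by (simp add: trivial_chars_def char_lattice_add chi_add algebra_simps)
qed

lemma trivial_chars_of_nat_mult:
  assumes "ideal I (ring_on (torus_ring n))" "a \<in> trivial_chars n I"
  shows "of_nat j * a \<in> trivial_chars n (I :: 'k::field ratfun set)"
proof (induction j)
  case 0
  then show ?case using ideal_ring_onD(2)[OF assms(1)] by (simp add: trivial_chars_def)
next
  case (Suc j)
  then show ?case using trivial_chars_add[OF assms(1,2) Suc] by (simp add: distrib_right)
qed

text \<open>Sending all exponents to 0 is evaluation at the unit of T; the generators vanish there
  and 1 does not. With the third condition of \<open>finite_torus_subgroup\<close> this keeps 1 out
  of the ideal of the subgroup.\<close>

lemma augmentation_ideal_proper:
  assumes "(1 :: 'k::field ratfun) \<in> genideal (ring_on (torus_ring n)) {chi m - 1 | m. m \<in> char_lattice n}"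
  shows False
proof -
  let ?\<epsilon> = "laurent_map (\<lambda>_. 0) :: 'k laurent \<Rightarrow> 'k laurent"
  define J where "J = {lp p | p. Poly_Mapping.keys p \<subseteq> char_lattice n \<and> ?\<epsilon> p = 0}"
  have "ideal J (ring_on (torus_ring n))"
  proof (rule ideal_ring_onI)
    show "subring_set (torus_ring n :: 'k ratfun set)"
      by (rule subring_set_semigroup_ring[OF monoid_on_char_lattice])
    show "J \<subseteq> torus_ring n" by (auto simp: J_def)
    show "0 \<in> J" unfolding J_def using lp_0 by (force intro!: exI[of _ 0])
  next
    fix x y assume "x \<in> J" "y \<in> J"
    then obtain p q where "x = lp p" "y = lp q" "Poly_Mapping.keys p \<subseteq> char_lattice n" "?\<epsilon> p = 0"
      "Poly_Mapping.keys q \<subseteq> char_lattice n" "?\<epsilon> q = 0" by (auto simp: J_def)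
    then show "x + y \<in> J"
      unfolding J_def
      by (intro CollectI exI[of _ "p + q"]) (simp add: lp_add laurent_map_add keys_add_subset)
  next
    fix a x :: "'k ratfun" assume "a \<in> torus_ring n" "x \<in> J"
    then obtain p q where "a = lp p" "x = lp q" "Poly_Mapping.keys p \<subseteq> char_lattice n"
      "Poly_Mapping.keys q \<subseteq> char_lattice n" "?\<epsilon> q = 0" by (auto simp: J_def elim!: semigroup_ringE)
    then show "a * x \<in> J"
      unfolding J_def
      by (intro CollectI exI[of _ "p * q"])
        (simp add: lp_mult laurent_map_mult keys_mult_subset[OF monoid_on_char_lattice])
  qed
  moreover have "chi m - 1 \<in> J" if "m \<in> char_lattice n" for m
  proof -
    have "Poly_Mapping.keys (Poly_Mapping.single m 1 + - 1 :: 'k laurent) \<subseteq> char_lattice n"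
      by (rule keys_add_subset) (use that in auto)
    then show ?thesis
      unfolding J_def
      by (intro CollectI exI[of _ "Poly_Mapping.single m 1 - 1"])
        (simp add: laurent_map_diff laurent_map_1 chi_lp lp_diff single_one)
  qed
  ultimately have "genideal (ring_on (torus_ring n)) {chi m - 1 | m. m \<in> char_lattice n} \<subseteq> J"
    by (intro genideal_ring_on_subset) auto
  then have "1 \<in> J" using assms by blast
  then obtain p where "lp p = 1" "?\<epsilon> p = 0" by (auto simp: J_def)
  then show False using lp_eq_iff[of p 1] by (simp add: laurent_map_1)
qed

text \<open>A basis of \<open>W\<close> together with the vectors \<open>g i\<close> is independent,
  so a linear map can be prescribed on it. \<pi> stands in for the quotient map by \<open>W\<close>
  without forming the quotient space.\<close>

lemma (in vector_space) independent_modulo_projection: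
  fixes g :: "nat \<Rightarrow> 'b"
  assumes W: "subspace W" and g: "\<And>i. i < j \<Longrightarrow> g i \<notin> span (W \<union> g ` {..<i})"
  shows "independent (g ` {..<j})" "inj_on g {..<j}"
    and "\<exists>\<pi>. Vector_Spaces.linear scale scale \<pi> \<and> (\<forall>x\<in>W. \<pi> x = 0) \<and> (\<forall>i<j. \<pi> (g i) = g i)"
proof -
  obtain B where B: "B \<subseteq> W" "independent B" "W \<subseteq> span B"
    by (rule maximal_independent_subset)
  have ind: "independent (B \<union> g ` {..<i})" if "i \<le> j" for i
    using that
  proof (induction i)
    case 0 then show ?case using B(2) by simp
  next
    case (Suc i)
    have "g i \<notin> span (B \<union> g ` {..<i})"
      using g[of i] Suc.prems span_mono[of "B \<union> g ` {..<i}" "W \<union> g ` {..<i}"] B(1) by auto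
    then show ?case
      using Suc by (simp add: lessThan_Suc independent_insert)
  qed
  show "independent (g ` {..<j})" using independent_mono[OF ind[of j]] by simp
  have "g i \<noteq> g i'" if "i < i'" "i' < j" for i i'
    using g[of i'] that span_base[of "g i" "W \<union> g ` {..<i'}"] by auto
  then show "inj_on g {..<j}" by (metis inj_onI lessThan_iff nat_neq_iff)
  interpret vp: vector_space_pair scale scale by unfold_locales
  obtain \<pi> where \<pi>: "Vector_Spaces.linear scale scale \<pi>"
      "\<forall>x\<in>B \<union> g ` {..<j}. \<pi> x = (if x \<in> g ` {..<j} then x else 0)"
    using vp.linear_independent_extend[OF ind[OF order_refl], of "\<lambda>x. if x \<in> g ` {..<j} then x else 0"]
    by blast
  interpret \<pi>: Vector_Spaces.linear scale scale \<pi> by (rule \<pi>(1))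
  have "b \<notin> g ` {..<j}" if "b \<in> B" for b
    using that B(1) g span_base[of b "W \<union> C" for C] by blast
  then have "\<pi> x = 0" if "x \<in> W" for x
    using \<pi>.eq_0_on_span[of B x] \<pi>(2) that B(3) by auto
  then show "\<exists>\<pi>. Vector_Spaces.linear scale scale \<pi> \<and> (\<forall>x\<in>W. \<pi> x = 0) \<and> (\<forall>i<j. \<pi> (g i) = g i)"
    using \<pi> by (intro exI[of _ \<pi>]) auto
qed

lemma laurent_vector_space: "vector_space (\<lambda>(c::'k::field) (p::'k laurent). Poly_Mapping.single 0 c * p)"
proof
  fix a b :: 'k and p :: "'k laurent"
  show "Poly_Mapping.single 0 a * (Poly_Mapping.single 0 b * p) = Poly_Mapping.single 0 (a * b) * p"
    by (simp add: mult_single flip: mult.assoc)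
qed (simp_all add: distrib_left distrib_right single_add single_one)

lemma push_delta:
  "push (\<lambda>m. m) (\<lambda>m. if m = k then 1 else 0) p = Poly_Mapping.single k (Poly_Mapping.lookup p k)"
  by (induction p rule: laurent_induct)
    (auto simp: push_add lookup_add single_add lookup_single when_def)

text \<open>Characters are grouplike in the Hopf algebra \<open>k[T]/I\<close>. As in Dedekind's lemma, distinct grouplike
  elements are linearly independent, so among \<open>\<chi>\<^sup>0, \<chi>\<^sup>m, \<chi>\<^sup>2\<^sup>m, \<dots>\<close> two coincide in \<open>k[T]/I\<close>.\<close>

lemma character_power_trivial:
  fixes I :: "'k::field ratfun set"
  assumes I: "ideal I (ring_on (torus_ring n))" "1 \<notin> I"
    and coI: "coaction n ` I \<subseteq> genideal (ring_on (torus_ring (2 * n))) (I \<union> second n ` I)"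
    and F: "finite F" "F \<subseteq> torus_ring n" "\<forall>f\<in>torus_ring n. \<exists>c. f - (\<Sum>g\<in>F. scal (c g) * g) \<in> I"
    and m: "m \<in> char_lattice n"
  shows "\<exists>l. 0 < l \<and> l \<le> card F \<and> of_nat l * m \<in> trivial_chars n I"
proof -
  interpret vs: vector_space "\<lambda>(c::'k) (p::'k laurent). Poly_Mapping.single 0 c * p"
    by (rule laurent_vector_space)
  note I_D = ideal_ring_onD[OF I(1)]
  note mono = monoid_on_char_lattice
  define W where "W = {p. lp p \<in> I}"
  define g where "g i = Poly_Mapping.single (of_nat i * m) (1::'k)" for i
  have lp_g: "lp (g i) = chi (of_nat i * m)" for i by (simp add: g_def chi_lp)
  have im: "of_nat i * m \<in> char_lattice n" for i by (rule char_lattice_of_nat_mult[OF m])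
  have "scal c * x \<in> I" if "x \<in> I" for c x
    using I_D(4)[OF scal_in_semigroup_ring[OF mono] that] .
  then have W: "vs.subspace W"
    using I_D(2,3) by (auto simp: vs.subspace_def W_def lp_add lp_mult simp flip: scal_lp)
  \<comment> \<open>\<open>F\<close> spans k[T] modulo \<open>I\<close>, so
    \<open>card F + 1\<close> characters cannot be independent modulo \<open>I\<close>.\<close>
  have "\<exists>j\<le>card F. g j \<in> vs.span (W \<union> g ` {..<j})"
  proof (rule ccontr)
    assume "\<not> ?thesis"
    then have nd: "\<And>i. i < Suc (card F) \<Longrightarrow> g i \<notin> vs.span (W \<union> g ` {..<i})" by auto
    note ind = vs.independent_modulo_projection[OF W nd]
    obtain \<pi> where \<pi>: "Vector_Spaces.linear (\<lambda>c p. Poly_Mapping.single 0 c * p) (\<lambda>c p. Poly_Mapping.single 0 c * p) \<pi>"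
        "\<forall>x\<in>W. \<pi> x = 0" "\<forall>i<Suc (card F). \<pi> (g i) = g i"
      using ind(3) by blast
    interpret \<pi>: Vector_Spaces.linear "\<lambda>c p. Poly_Mapping.single 0 c * p" "\<lambda>c p. Poly_Mapping.single 0 c * p" \<pi>
      by (rule \<pi>(1))
    let ?G = "lp -` F :: 'k laurent set"
    have inj: "inj (lp :: 'k laurent \<Rightarrow> _)" by (simp add: inj_on_def)
    have FG: "F = lp ` ?G"
    proof
      show "F \<subseteq> lp ` ?G"
      proof
        fix f assume "f \<in> F"
        moreover obtain p where "f = lp p" using semigroup_ringE[OF subsetD[OF F(2) \<open>f \<in> F\<close>]] .
        ultimately show "f \<in> lp ` ?G" by blast
      qed
    qed auto
    have fG: "finite ?G" using F(1) inj by (rule finite_vimageI)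
    have "card (lp ` ?G) = card ?G" by (rule card_image) (simp add: inj_on_def)
    with fG FG have G: "finite ?G" "card ?G = card F" by simp_all
    have "g i \<in> vs.span (\<pi> ` ?G)" if i: "i < Suc (card F)" for i
    proof -
      have "lp (g i) \<in> torus_ring n" using im by (simp add: lp_g)
      then obtain c where c: "lp (g i) - (\<Sum>f\<in>F. scal (c f) * f) \<in> I" using F(3) by blast
      let ?s = "\<Sum>p\<in>?G. Poly_Mapping.single 0 (c (lp p)) * p"
      have "(\<Sum>f\<in>F. scal (c f) * f) = (\<Sum>p\<in>?G. scal (c (lp p)) * lp p)"
        by (subst FG, subst sum.reindex) (auto simp: inj_on_def)
      also have "\<dots> = lp ?s"
        using G(1) by (induction rule: finite_induct) (simp_all add: lp_add lp_mult scal_lp)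
      finally have "g i - ?s \<in> W" using c by (simp add: W_def lp_diff)
      then have "\<pi> (g i) - \<pi> ?s = 0" using \<pi>(2) by (simp flip: \<pi>.diff)
      then have "g i = (\<Sum>p\<in>?G. Poly_Mapping.single 0 (c (lp p)) * \<pi> p)"
        using \<pi>(3) i by (simp add: \<pi>.sum \<pi>.scale)
      also have "\<dots> \<in> vs.span (\<pi> ` ?G)"
        by (intro vs.span_sum vs.span_scale vs.span_base imageI)
      finally show ?thesis .
    qed
    then have "card (g ` {..<Suc (card F)}) \<le> card (\<pi> ` ?G)"
      using vs.independent_span_bound[OF _ ind(1)] G(1) by blast
    also have "\<dots> \<le> card F" using card_image_le[OF G(1)] G(2) by metis
    finally show False using card_image[OF ind(2)] by simp
  qed
  then obtain j' where j': "j' \<le> card F" "g j' \<in> vs.span (W \<union> g ` {..<j'})" by blast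
  \<comment> \<open>Minimality makes the powers before \<open>j\<close> independent modulo
    \<open>I\<close>, which is what allows a projection fixing each of them.\<close>
  define j where "j = (LEAST j. g j \<in> vs.span (W \<union> g ` {..<j}))"
  have j: "g j \<in> vs.span (W \<union> g ` {..<j})" "j \<le> card F"
    unfolding j_def using LeastI[of "\<lambda>j. g j \<in> vs.span (W \<union> g ` {..<j})", OF j'(2)]
      Least_le[of "\<lambda>j. g j \<in> vs.span (W \<union> g ` {..<j})", OF j'(2)] j'(1) by auto
  have nd: "\<And>i. i < j \<Longrightarrow> g i \<notin> vs.span (W \<union> g ` {..<i})"
    unfolding j_def by (drule not_less_Least)
  obtain \<pi> where \<pi>: "Vector_Spaces.linear (\<lambda>c p. Poly_Mapping.single 0 c * p) (\<lambda>c p. Poly_Mapping.single 0 c * p) \<pi>"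
      "\<forall>x\<in>W. \<pi> x = 0" "\<forall>i<j. \<pi> (g i) = g i"
    using vs.independent_modulo_projection(3)[OF W nd] by blast
  interpret \<pi>: Vector_Spaces.linear "\<lambda>c p. Poly_Mapping.single 0 c * p" "\<lambda>c p. Poly_Mapping.single 0 c * p" \<pi>
    by (rule \<pi>(1))
  obtain r y where ry: "r \<in> W" "y \<in> vs.span (g ` {..<j})" "g j = r + y"
    using j(1) vs.span_eq_iff[THEN iffD2, OF W] unfolding vs.span_Un by auto
  let ?K = "(\<lambda>i. of_nat i * m) ` {..<j}"
  have "vs.subspace {p. Poly_Mapping.keys p \<subseteq> ?K}"
  proof (rule vs.subspaceI)
    fix c :: 'k and p :: "'k laurent" assume "p \<in> {p. Poly_Mapping.keys p \<subseteq> ?K}"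
    then show "Poly_Mapping.single 0 c * p \<in> {p. Poly_Mapping.keys p \<subseteq> ?K}"
      using lookup_single_times[of 0 c p] by (auto simp: in_keys_iff subset_iff)
  qed (simp_all add: keys_add_subset)
  then have "vs.span (g ` {..<j}) \<subseteq> {p. Poly_Mapping.keys p \<subseteq> ?K}"
    by (intro vs.span_minimal) (auto simp: g_def)
  then have ky: "Poly_Mapping.keys y \<subseteq> ?K" using ry(2) by blast
  have "y \<noteq> 0"
  proof
    assume "y = 0"
    then have "chi (of_nat j * m) \<in> I" using ry by (simp add: W_def flip: lp_g)
    then have "chi (- (of_nat j * m)) * chi (of_nat j * m) \<in> I"
      using im[of j] by (intro I_D(4)) (auto simp: char_lattice_uminus)
    then show False using I(2) by (simp flip: chi_add)
  qed
  then obtain e where e: "e \<in> Poly_Mapping.keys y" by (metis keys_eq_empty ex_in_conv)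
  then obtain i where i: "i < j" "e = of_nat i * m" using ky by auto
  let ?c = "Poly_Mapping.lookup y e"
  have c: "?c \<noteq> 0" using e by (simp add: in_keys_iff)
  have fix_span: "\<pi> q = q" if "q \<in> vs.span (g ` {..<j})" for q
  proof -
    interpret id: vector_space_pair "\<lambda>(c::'k) (p::'k laurent). Poly_Mapping.single 0 c * p"
      "\<lambda>(c::'k) (p::'k laurent). Poly_Mapping.single 0 c * p" by unfold_locales
    show ?thesis
      using id.linear_eq_on[OF \<pi>(1) vs.linear_id that] \<pi>(3) by (auto simp: id_def)
  qed
  \<comment> \<open>\<mu> reads the coefficient at \<open>e\<close> after projecting modulo
    \<open>I\<close>, so it vanishes on \<open>I\<close>. Its value on \<open>g j\<close> is
    \<open>?c\<close>, and on the earlier powers it is the delta function at \<open>e\<close>.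
    Contracting the coproduct of the relation r = g_j - y therefore leaves ?c (chi^(j m) - chi^e) in
    \<open>I\<close>: all other terms of \<open>y\<close> disappear.\<close>
  define \<mu> where "\<mu> a = Poly_Mapping.lookup (\<pi> (Poly_Mapping.single a 1)) e" for a
  have \<mu>: "push (\<lambda>_. 0) \<mu> q = Poly_Mapping.single 0 (Poly_Mapping.lookup (\<pi> q) e)" for q
  proof (induction q rule: laurent_induct)
    case (1 a b)
    have "\<pi> (Poly_Mapping.single 0 b * Poly_Mapping.single a 1) = Poly_Mapping.single 0 b * \<pi> (Poly_Mapping.single a 1)"
      by (rule \<pi>.scale)
    then show ?case
      using lookup_single_times[of 0 b "\<pi> (Poly_Mapping.single a 1)" e]
      by (simp add: mult_single \<mu>_def mult.commute)
  next
    case (2 p q)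
    then show ?case by (simp add: push_add \<pi>.add lookup_add single_add)
  qed
  have "lp r \<in> I" using ry(1) by (simp add: W_def)
  then have "lp r \<in> torus_ring n" using I_D(1) by blast
  then have kr: "Poly_Mapping.keys r \<subseteq> char_lattice n" by simp
  have "lp (push (hi n) (\<lambda>e. \<mu> (lo n e)) (diag n r)) \<in> I"
  proof (rule contraction_genideal[OF I(1) I_D(1)])
    show "chi m * x \<in> I" if "m \<in> char_lattice n" "x \<in> I" for m x
      using that by (intro I_D(4)) simp_all
    show "push (\<lambda>_. 0) \<mu> p = 0" if "lp p \<in> I" for p
      using that \<pi>(2) by (simp add: \<mu> W_def)
    show "lp (diag n r) \<in> genideal (ring_on (torus_ring (2 * n))) (I \<union> second n ` I)"
      using coI \<open>lp r \<in> I\<close> by (auto simp flip: coaction_lp)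
  qed
  then have "lp (push (\<lambda>m. m) \<mu> r) \<in> I" by (simp add: push_diag[OF kr])
  moreover have "push (\<lambda>m. m) \<mu> r = push (\<lambda>m. m) \<mu> (g j) - push (\<lambda>m. m) \<mu> y"
    using ry(3) by (simp flip: push_diff)
  moreover have "push (\<lambda>m. m) \<mu> (g j) = Poly_Mapping.single (of_nat j * m) ?c"
  proof -
    have "\<pi> (g j) = y" using ry \<pi>(2) fix_span[OF ry(2)] by (simp add: \<pi>.add)
    then show ?thesis by (simp add: g_def \<mu>_def)
  qed
  moreover have "push (\<lambda>m. m) \<mu> y = Poly_Mapping.single e ?c"
  proof -
    have "push (\<lambda>m. m) \<mu> y = push (\<lambda>m. m) (\<lambda>k. if k = e then 1 else 0) y"
    proof (rule push_cong)
      fix k assume "k \<in> Poly_Mapping.keys y"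
      then obtain l where "l < j" "k = of_nat l * m" using ky by auto
      then show "\<mu> k = (if k = e then 1 else 0)"
        using \<pi>(3) by (auto simp: \<mu>_def g_def lookup_single)
    qed simp
    then show ?thesis by (simp add: push_delta)
  qed
  ultimately have "lp (Poly_Mapping.single (of_nat j * m) ?c - Poly_Mapping.single e ?c) \<in> I" by simp
  then have "scal ?c * (chi (of_nat j * m) - chi e) \<in> I"
    by (simp add: lp_diff lp_single right_diff_distrib)
  then have "lp (Poly_Mapping.single (- e) (inverse ?c)) * (scal ?c * (chi (of_nat j * m) - chi e)) \<in> I"
    by (rule I_D(4)[rotated]) (use char_lattice_uminus[OF im] in \<open>auto simp: i(2)\<close>)
  moreover have "lp (Poly_Mapping.single (- e) (inverse ?c)) * (scal ?c * (chi (of_nat j * m) - chi e))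
      = (scal (inverse ?c) * scal ?c) * (chi (- e) * (chi (of_nat j * m) - chi e))"
    by (simp add: lp_single algebra_simps)
  moreover have "\<dots> = chi (of_nat (j - i) * m) - 1"
    using c i by (simp add: right_diff_distrib of_nat_diff algebra_simps flip: scal_mult chi_add)
  ultimately have "of_nat (j - i) * m \<in> trivial_chars n I"
    using im by (simp add: trivial_chars_def)
  then show ?thesis using i(1) j(2) by (intro exI[of _ "j - i"]) auto
qed

text \<open>The order of a character on the subgroup varies with m but is at most
  \<open>card F\<close>, so the factorial of \<open>card F\<close> serves for all
  characters.\<close>

lemma finite_torus_subgroup_exponent:
  fixes I :: "'k::field ratfun set"
  assumes "finite_torus_subgroup n I"
  shows "\<exists>N>0. \<forall>m\<in>char_lattice n. of_nat N * m \<in> trivial_chars n I"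
proof -
  obtain F where F: "finite F" "F \<subseteq> torus_ring n" "\<forall>f\<in>torus_ring n. \<exists>c. f - (\<Sum>g\<in>F. scal (c g) * g) \<in> I"
    using assms by (auto simp: finite_torus_subgroup_def)
  have I: "ideal I (ring_on (torus_ring n))"
    and coI: "coaction n ` I \<subseteq> genideal (ring_on (torus_ring (2 * n))) (I \<union> second n ` I)"
    using assms by (auto simp: finite_torus_subgroup_def)
  have I1: "1 \<notin> I"
    using assms augmentation_ideal_proper[of n, where ?'k = 'k] by (auto simp: finite_torus_subgroup_def)
  have "of_nat (fact (card F)) * m \<in> trivial_chars n I" if m: "m \<in> char_lattice n" for m
  proof -
    obtain l where l: "0 < l" "l \<le> card F" "of_nat l * m \<in> trivial_chars n I"
      using character_power_trivial[OF I I1 coI F m] by blast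
    then have "l dvd fact (card F)" by (intro dvd_fact) auto
    then obtain q where "fact (card F) = q * l" by (metis dvd_def mult.commute)
    then show ?thesis
      using trivial_chars_of_nat_mult[OF I l(3), of q] by (simp add: mult.assoc)
  qed
  then show ?thesis by (intro exI[of _ "fact (card F)"]) auto
qed

subsection \<open>The local ring at the fixed point of an affine toric variety\<close>

definition pointed_monoid :: "exponent set \<Rightarrow> bool" where
  "pointed_monoid S \<longleftrightarrow> monoid_on S \<and> (\<forall>s\<in>S. - s \<in> S \<longrightarrow> s = 0)"

text \<open>For the lattice points of a pointed cone this is the Hilbert basis. Its characters
  represent a basis of the cotangent space at the fixed point.\<close>

definition irreducibles :: "'a::comm_monoid_add set \<Rightarrow> 'a set" where
  "irreducibles S = {s \<in> S. s \<noteq> 0 \<and> (\<forall>a\<in>S. \<forall>b\<in>S. a + b = s \<longrightarrow> a = 0 \<or> b = 0)}"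

text \<open>For pointed \<open>S\<close> this is the maximal ideal of the torus-fixed point, where
  every nontrivial character in \<open>S\<close> vanishes; \<open>origin_ring\<close> is the local
  ring there.\<close>

definition origin :: "exponent set \<Rightarrow> 'k::field ratfun set" where
  "origin S = {lp p | p. Poly_Mapping.keys p \<subseteq> S \<and> Poly_Mapping.lookup p 0 = 0}"

definition origin_ring :: "exponent set \<Rightarrow> 'k::field ratfun set" where
  "origin_ring S = localization (semigroup_ring S) (origin S)"

lemma pointed_sum_0:
  assumes "pointed_monoid S" "a \<in> S" "b \<in> S" "a + b = 0"
  shows "a = 0" "b = 0"
proof -
  have "b = - a" using assms(4) by (simp add: eq_neg_iff_add_eq_0 add.commute)
  then show "a = 0" "b = 0" using assms by (auto simp: pointed_monoid_def)
qed

lemma lookup_mult_0: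
  fixes p q :: "'k::field laurent"
  assumes S: "pointed_monoid S" and "Poly_Mapping.keys p \<subseteq> S" "Poly_Mapping.keys q \<subseteq> S"
  shows "Poly_Mapping.lookup (p * q) 0 = Poly_Mapping.lookup p 0 * Poly_Mapping.lookup q 0"
  using assms(2)
proof (induction p rule: laurent_induct_on)
  case (single a c)
  from assms(3) show ?case
  proof (induction q rule: laurent_induct_on)
    case (single b d)
    then show ?case
      using pointed_sum_0[OF S \<open>a \<in> S\<close> \<open>b \<in> S\<close>] by (auto simp: mult_single lookup_single when_def)
  qed (simp_all add: distrib_left lookup_add)
qed (simp_all add: distrib_right lookup_add)

text \<open>An irreducible s splits in \<open>S\<close> only as 0 + s and s + 0, which makes its
  coefficient obey the Leibniz rule.\<close>

lemma lookup_mult_irreducible: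
  fixes p q :: "'k::field laurent"
  assumes s: "s \<in> irreducibles S" and "Poly_Mapping.keys p \<subseteq> S" "Poly_Mapping.keys q \<subseteq> S"
  shows "Poly_Mapping.lookup (p * q) s
    = Poly_Mapping.lookup p 0 * Poly_Mapping.lookup q s + Poly_Mapping.lookup p s * Poly_Mapping.lookup q 0"
  using assms(2)
proof (induction p rule: laurent_induct_on)
  case (single a c)
  from assms(3) show ?case
  proof (induction q rule: laurent_induct_on)
    case (single b d)
    have "a + b = s \<longleftrightarrow> (a = 0 \<and> b = s) \<or> (a = s \<and> b = 0)" "s \<noteq> 0"
      using s \<open>a \<in> S\<close> \<open>b \<in> S\<close> by (auto simp: irreducibles_def)
    then show ?case
      by (auto simp: mult_single lookup_single when_def)
  qed (simp_all add: distrib_left lookup_add)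
qed (simp_all add: distrib_right lookup_add algebra_simps)

definition origin_rep :: "exponent set \<Rightarrow> 'k::field ratfun \<Rightarrow> 'k laurent \<Rightarrow> 'k laurent \<Rightarrow> bool" where
  "origin_rep S x a b \<longleftrightarrow> Poly_Mapping.keys a \<subseteq> S \<and> Poly_Mapping.keys b \<subseteq> S \<and>
     Poly_Mapping.lookup b 0 \<noteq> 0 \<and> x * lp b = lp a"

lemma origin_rep_nonzero: "origin_rep S x a b \<Longrightarrow> b \<noteq> 0"
  by (auto simp: origin_rep_def)

lemma in_origin_ring_iff: "x \<in> origin_ring S \<longleftrightarrow> (\<exists>a b. origin_rep S x a b)"
proof
  assume "x \<in> origin_ring S"
  then obtain a s where as: "x = a / s" "a \<in> semigroup_ring S" "s \<in> semigroup_ring S" "s \<notin> origin S"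
    by (auto simp: origin_ring_def localization_def)
  obtain p where p: "a = lp p" "Poly_Mapping.keys p \<subseteq> S" using as(2) by (rule semigroup_ringE)
  obtain q where q: "s = lp q" "Poly_Mapping.keys q \<subseteq> S" using as(3) by (rule semigroup_ringE)
  have "Poly_Mapping.lookup q 0 \<noteq> 0" using as(4) q by (auto simp: origin_def)
  moreover from this have "q \<noteq> 0" by auto
  ultimately have "origin_rep S x p q" using p q as(1) by (simp add: origin_rep_def)
  then show "\<exists>a b. origin_rep S x a b" by blast
next
  assume "\<exists>a b. origin_rep S x a b"
  then obtain a b where ab: "origin_rep S x a b" by blast
  then have "x = lp a / lp b"
    using origin_rep_nonzero[OF ab] by (simp add: origin_rep_def eq_divide_eq)
  moreover have "lp b \<notin> origin S" using ab by (auto simp: origin_rep_def origin_def)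
  ultimately show "x \<in> origin_ring S"
    using ab unfolding origin_ring_def localization_def origin_rep_def
    by (intro CollectI exI[of _ "lp a"] exI[of _ "lp b"]) auto
qed

text \<open>\<open>value_at_origin\<close> and \<open>linear_part\<close> are the value and the coefficient of \<open>\<chi>\<^sup>s\<close> in the power series
  expansion at the fixed point, for irreducible \<open>s\<close>.\<close>

definition value_at_origin :: "exponent set \<Rightarrow> 'k::field ratfun \<Rightarrow> 'k" where
  "value_at_origin S x = (THE c. \<exists>a b. origin_rep S x a b \<and> c = Poly_Mapping.lookup a 0 / Poly_Mapping.lookup b 0)"

definition linear_part :: "exponent set \<Rightarrow> exponent \<Rightarrow> 'k::field ratfun \<Rightarrow> 'k" where
  "linear_part S s x = (THE c. \<exists>a b. origin_rep S x a b \<and>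
     c = (Poly_Mapping.lookup a s * Poly_Mapping.lookup b 0 - Poly_Mapping.lookup a 0 * Poly_Mapping.lookup b s)
         / (Poly_Mapping.lookup b 0)\<^sup>2)"

lemma origin_rep_unique:
  assumes "origin_rep S x a b" "origin_rep S x c d"
  shows "a * d = c * b"
proof -
  have "lp (a * d) = lp (c * b)"
  proof -
    have xy: "x * lp b = lp a" "x * lp d = lp c" using assms by (simp_all add: origin_rep_def)
    show ?thesis unfolding lp_mult xy[symmetric] by (simp add: mult_ac)
  qed
  then show ?thesis by simp
qed

lemma value_at_origin_rep:
  assumes S: "pointed_monoid S" and ab: "origin_rep S x a b"
  shows "value_at_origin S x = Poly_Mapping.lookup a 0 / Poly_Mapping.lookup b 0"
  unfolding value_at_origin_def
proof (rule the_equality)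
  fix r assume "\<exists>c d. origin_rep S x c d \<and> r = Poly_Mapping.lookup c 0 / Poly_Mapping.lookup d 0"
  then obtain c d where cd: "origin_rep S x c d" "r = Poly_Mapping.lookup c 0 / Poly_Mapping.lookup d 0"
    by blast
  have "Poly_Mapping.lookup (a * d) 0 = Poly_Mapping.lookup (c * b) 0"
    by (simp add: origin_rep_unique[OF ab cd(1)])
  then show "r = Poly_Mapping.lookup a 0 / Poly_Mapping.lookup b 0"
    using ab cd by (simp add: origin_rep_def lookup_mult_0[OF S] frac_eq_eq)
qed (use ab in blast)

text \<open>This is the quotient rule at the fixed point. Two fractions a/b and c/d of the same
  element satisfy a d = c b, and comparing the coefficients at 0 and at s gives the same result for
  both.\<close>

lemma linear_part_rep:
  assumes S: "pointed_monoid S" and s: "s \<in> irreducibles S" and ab: "origin_rep S x a b"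
  shows "linear_part S s x
    = (Poly_Mapping.lookup a s * Poly_Mapping.lookup b 0 - Poly_Mapping.lookup a 0 * Poly_Mapping.lookup b s)
         / (Poly_Mapping.lookup b 0)\<^sup>2"
  unfolding linear_part_def
proof (rule the_equality)
  fix r assume "\<exists>a b. origin_rep S x a b \<and>
     r = (Poly_Mapping.lookup a s * Poly_Mapping.lookup b 0 - Poly_Mapping.lookup a 0 * Poly_Mapping.lookup b s)
         / (Poly_Mapping.lookup b 0)\<^sup>2"
  then obtain c d where cd: "origin_rep S x c d"
     "r = (Poly_Mapping.lookup c s * Poly_Mapping.lookup d 0 - Poly_Mapping.lookup c 0 * Poly_Mapping.lookup d s)
         / (Poly_Mapping.lookup d 0)\<^sup>2" by blast
  have keys: "Poly_Mapping.keys a \<subseteq> S" "Poly_Mapping.keys b \<subseteq> S" "Poly_Mapping.keys c \<subseteq> S" "Poly_Mapping.keys d \<subseteq> S"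
    and nz: "Poly_Mapping.lookup b 0 \<noteq> 0" "Poly_Mapping.lookup d 0 \<noteq> 0"
    using ab cd by (auto simp: origin_rep_def)
  define a0 as b0 bs c0 cs d0 ds where defs: "a0 = Poly_Mapping.lookup a 0" "as = Poly_Mapping.lookup a s"
    "b0 = Poly_Mapping.lookup b 0" "bs = Poly_Mapping.lookup b s"
    "c0 = Poly_Mapping.lookup c 0" "cs = Poly_Mapping.lookup c s"
    "d0 = Poly_Mapping.lookup d 0" "ds = Poly_Mapping.lookup d s"
  have "a0 * d0 = c0 * b0"
    using arg_cong[OF origin_rep_unique[OF ab cd(1)], of "\<lambda>p. Poly_Mapping.lookup p 0"]
    by (simp add: lookup_mult_0[OF S] keys defs)
  moreover have "a0 * ds + as * d0 = c0 * bs + cs * b0"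
    using arg_cong[OF origin_rep_unique[OF ab cd(1)], of "\<lambda>p. Poly_Mapping.lookup p s"]
    by (simp add: lookup_mult_irreducible[OF s] keys defs)
  ultimately have e: "c0 * b0 = a0 * d0" "cs * b0 = a0 * ds + as * d0 - c0 * bs"
    by (simp_all add: algebra_simps)
  have "(cs * d0 - c0 * ds) * b0\<^sup>2 = d0 * b0 * (cs * b0) - (c0 * b0) * b0 * ds"
    by (simp add: power2_eq_square algebra_simps)
  also have "\<dots> = d0 * b0 * (a0 * ds + as * d0 - c0 * bs) - (a0 * d0) * b0 * ds"
    by (simp only: e)
  also have "\<dots> = as * b0 * d0\<^sup>2 - (c0 * b0) * bs * d0"
    by (simp add: power2_eq_square algebra_simps)
  also have "\<dots> = (as * b0 - a0 * bs) * d0\<^sup>2"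
    unfolding e(1) by (simp add: power2_eq_square algebra_simps)
  finally have "(cs * d0 - c0 * ds) * b0\<^sup>2 = (as * b0 - a0 * bs) * d0\<^sup>2" .
  then show "r = (Poly_Mapping.lookup a s * Poly_Mapping.lookup b 0 - Poly_Mapping.lookup a 0 * Poly_Mapping.lookup b s)
         / (Poly_Mapping.lookup b 0)\<^sup>2"
    using nz by (simp add: cd(2) frac_eq_eq flip: defs)
qed (use ab in blast)

lemma origin_rep_add:
  assumes S: "pointed_monoid S" and "origin_rep S x a b" "origin_rep S y c d"
  shows "origin_rep S (x + y) (a * d + c * b) (b * d)"
proof -
  have m: "monoid_on S" using S by (simp add: pointed_monoid_def)
  have xy: "x * lp b = lp a" "y * lp d = lp c" using assms by (simp_all add: origin_rep_def)
  have "(x + y) * lp (b * d) = (x * lp b) * lp d + (y * lp d) * lp b" by (simp add: lp_mult algebra_simps)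
  also have "\<dots> = lp (a * d + c * b)" by (simp only: xy lp_mult lp_add)
  finally have "(x + y) * lp (b * d) = lp (a * d + c * b)" .
  then show ?thesis
    using assms by (simp add: origin_rep_def keys_add_subset keys_mult_subset[OF m] lookup_mult_0[OF S])
qed

lemma origin_rep_mult:
  assumes S: "pointed_monoid S" and "origin_rep S x a b" "origin_rep S y c d"
  shows "origin_rep S (x * y) (a * c) (b * d)"
proof -
  have m: "monoid_on S" using S by (simp add: pointed_monoid_def)
  have xy: "x * lp b = lp a" "y * lp d = lp c" using assms by (simp_all add: origin_rep_def)
  have "(x * y) * lp (b * d) = (x * lp b) * (y * lp d)" by (simp add: lp_mult algebra_simps)
  also have "\<dots> = lp (a * c)" by (simp only: xy lp_mult)
  finally have "(x * y) * lp (b * d) = lp (a * c)" .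
  then show ?thesis
    using assms by (simp add: origin_rep_def keys_mult_subset[OF m] lookup_mult_0[OF S])
qed

lemma origin_rep_lp:
  assumes "pointed_monoid S" "Poly_Mapping.keys p \<subseteq> S"
  shows "origin_rep S (lp p) p 1"
  using assms by (auto simp: origin_rep_def pointed_monoid_def monoid_on_def lookup_one)

lemma origin_rep_uminus: "origin_rep S x a b \<Longrightarrow> origin_rep S (- x) (- a) b"
  by (simp add: origin_rep_def lp_uminus)

lemma subring_set_origin_ring:
  assumes S: "pointed_monoid S"
  shows "subring_set (origin_ring S :: 'k::field ratfun set)"
proof -
  have "(1 :: 'k ratfun) \<in> origin_ring S"
    using origin_rep_lp[OF S, of 1] S
    by (auto simp: in_origin_ring_iff pointed_monoid_def monoid_on_def)
  then show ?thesis
    unfolding subring_set_def Ball_def in_origin_ring_iff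
    using origin_rep_add[OF S] origin_rep_mult[OF S] origin_rep_uminus[of S] by meson
qed

lemma semigroup_ring_subset_origin_ring:
  assumes "pointed_monoid S" shows "semigroup_ring S \<subseteq> origin_ring S"
proof
  fix x :: "'a ratfun" assume "x \<in> semigroup_ring S"
  then obtain p where "x = lp p" "Poly_Mapping.keys p \<subseteq> S" by (rule semigroup_ringE)
  then show "x \<in> origin_ring S"
    using origin_rep_lp[OF assms] unfolding in_origin_ring_iff by blast
qed

text \<open>If chi^m b = a, then the coefficient of a at m is the constant term of b. As this is
  nonzero, m is an exponent of a.\<close>

lemma chi_in_origin_ring:
  assumes S: "pointed_monoid S"
  shows "chi m \<in> (origin_ring S :: 'k::field ratfun set) \<longleftrightarrow> m \<in> S"
proof
  assume "chi m \<in> (origin_ring S :: 'k ratfun set)"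
  then obtain a b :: "'k laurent" where ab: "origin_rep S (chi m) a b" by (auto simp: in_origin_ring_iff)
  then have "lp (Poly_Mapping.single m 1 * b) = lp a" by (simp add: origin_rep_def chi_lp lp_mult)
  then have "Poly_Mapping.single m 1 * b = a" by simp
  then have "Poly_Mapping.lookup a m \<noteq> 0"
    using lookup_single_times[of m 1 b 0] ab by (auto simp: origin_rep_def)
  then show "m \<in> S" using ab by (auto simp: origin_rep_def in_keys_iff subset_iff)
next
  assume "m \<in> S"
  then show "chi m \<in> (origin_ring S :: 'k ratfun set)"
    using semigroup_ring_subset_origin_ring[OF S] chi_in_semigroup_ring by blast
qed

lemma value_at_origin_add:
  assumes S: "pointed_monoid S" and "x \<in> origin_ring S" "y \<in> origin_ring S"
  shows "value_at_origin S (x + y) = value_at_origin S x + value_at_origin S y"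
proof -
  obtain a b c d where r: "origin_rep S x a b" "origin_rep S y c d"
    using assms by (auto simp: in_origin_ring_iff)
  show ?thesis
    unfolding value_at_origin_rep[OF S r(1)] value_at_origin_rep[OF S r(2)]
      value_at_origin_rep[OF S origin_rep_add[OF S r]]
    using r by (simp add: origin_rep_def lookup_add lookup_mult_0[OF S] add_frac_eq)
qed

lemma value_at_origin_mult:
  assumes S: "pointed_monoid S" and "x \<in> origin_ring S" "y \<in> origin_ring S"
  shows "value_at_origin S (x * y) = value_at_origin S x * value_at_origin S y"
proof -
  obtain a b c d where r: "origin_rep S x a b" "origin_rep S y c d"
    using assms by (auto simp: in_origin_ring_iff)
  show ?thesis
    unfolding value_at_origin_rep[OF S r(1)] value_at_origin_rep[OF S r(2)]
      value_at_origin_rep[OF S origin_rep_mult[OF S r]]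
    using r by (simp add: origin_rep_def lookup_mult_0[OF S])
qed

lemma value_at_origin_lp:
  assumes S: "pointed_monoid S" "Poly_Mapping.keys p \<subseteq> S"
  shows "value_at_origin S (lp p) = Poly_Mapping.lookup p 0"
  using value_at_origin_rep[OF S(1) origin_rep_lp[OF S]] by (simp add: lookup_one)

lemma value_at_origin_scal:
  assumes S: "pointed_monoid S"
  shows "value_at_origin S (scal c) = c"
  unfolding scal_lp
  by (subst value_at_origin_lp[OF S]) (use S in \<open>auto simp: pointed_monoid_def monoid_on_def\<close>)

lemma value_at_origin_uminus:
  assumes S: "pointed_monoid S" and "x \<in> origin_ring S"
  shows "value_at_origin S (- x) = - value_at_origin S x"
proof -
  obtain a b where r: "origin_rep S x a b" using assms(2) by (auto simp: in_origin_ring_iff)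
  show ?thesis
    by (simp add: value_at_origin_rep[OF S r] value_at_origin_rep[OF S origin_rep_uminus[OF r]])
qed

lemma value_at_origin_diff:
  assumes S: "pointed_monoid S" and "x \<in> origin_ring S" "y \<in> origin_ring S"
  shows "value_at_origin S (x - y) = value_at_origin S x - value_at_origin S y"
  using value_at_origin_add[OF S assms(2) subring_setD(3)[OF subring_set_origin_ring[OF S] assms(3)]]
    value_at_origin_uminus[OF S assms(3)] by simp

lemma value_at_origin_sum:
  assumes S: "pointed_monoid S" and "\<And>i. i < (n::nat) \<Longrightarrow> f i \<in> origin_ring S"
  shows "(\<Sum>i<n. f i) \<in> origin_ring S \<and> value_at_origin S (\<Sum>i<n. f i) = (\<Sum>i<n. value_at_origin S (f i))"
  using assms(2)
proof (induction n)
  case 0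
  then show ?case
    using value_at_origin_scal[OF S, of 0] by (simp add: subring_setD(2)[OF subring_set_origin_ring[OF S]])
next
  case (Suc n)
  then show ?case
    by (simp add: subring_setD(4)[OF subring_set_origin_ring[OF S]] value_at_origin_add[OF S])
qed

text \<open>A fraction whose numerator has nonzero constant term may be turned upside down.\<close>

lemma nonunits_origin_ring:
  assumes S: "pointed_monoid S"
  shows "nonunits (origin_ring S) = {x \<in> origin_ring S. value_at_origin S x = (0 :: 'k::field)}"
proof -
  have "(\<forall>y\<in>origin_ring S. x * y \<noteq> 1) \<longleftrightarrow> value_at_origin S x = 0" if x: "x \<in> origin_ring S" for x :: "'k ratfun"
  proof
    assume nu: "\<forall>y\<in>origin_ring S. x * y \<noteq> 1"
    obtain a b where r: "origin_rep S x a b" using x by (auto simp: in_origin_ring_iff)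
    show "value_at_origin S x = 0"
    proof (rule ccontr)
      assume "value_at_origin S x \<noteq> 0"
      then have a0: "Poly_Mapping.lookup a 0 \<noteq> 0" using r by (simp add: value_at_origin_rep[OF S])
      have nz: "lp b \<noteq> 0" "lp a \<noteq> 0" using a0 r by (auto simp: origin_rep_def)
      have xb: "x * lp b = lp a" using r by (simp add: origin_rep_def)
      with nz have "x \<noteq> 0" by auto
      then have inv: "inverse x * lp a = lp b" unfolding xb[symmetric] by (simp flip: mult.assoc)
      then have "origin_rep S (inverse x) b a" using r a0 by (simp add: origin_rep_def)
      then show False using nu \<open>x \<noteq> 0\<close> by (metis in_origin_ring_iff right_inverse)
    qed
  next
    assume x0: "value_at_origin S x = 0"
    show "\<forall>y\<in>origin_ring S. x * y \<noteq> 1"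
    proof
      fix y :: "'k ratfun" assume "y \<in> origin_ring S"
      then have "value_at_origin S (x * y) = 0" using value_at_origin_mult[OF S x] x0 by simp
      then show "x * y \<noteq> 1" using value_at_origin_scal[OF S, of "1 :: 'k"] by auto
    qed
  qed
  then show ?thesis by (auto simp: nonunits_def)
qed

lemma linear_part_add:
  assumes S: "pointed_monoid S" and s: "s \<in> irreducibles S" and "x \<in> origin_ring S" "y \<in> origin_ring S"
  shows "linear_part S s (x + y) = linear_part S s x + linear_part S s y"
proof -
  obtain a b c d where r: "origin_rep S x a b" "origin_rep S y c d"
    using assms by (auto simp: in_origin_ring_iff)
  show ?thesis
    unfolding linear_part_rep[OF S s r(1)] linear_part_rep[OF S s r(2)]
      linear_part_rep[OF S s origin_rep_add[OF S r]]
    using r unfolding origin_rep_def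
    by (simp add: lookup_add lookup_mult_0[OF S] lookup_mult_irreducible[OF s] power2_eq_square add_frac_eq frac_eq_eq)
      (simp add: algebra_simps)
qed

lemma linear_part_mult:
  assumes S: "pointed_monoid S" and s: "s \<in> irreducibles S" and "x \<in> origin_ring S" "y \<in> origin_ring S"
  shows "linear_part S s (x * y)
    = value_at_origin S x * linear_part S s y + value_at_origin S y * linear_part S s x"
proof -
  obtain a b c d where r: "origin_rep S x a b" "origin_rep S y c d"
    using assms by (auto simp: in_origin_ring_iff)
  show ?thesis
    unfolding linear_part_rep[OF S s r(1)] linear_part_rep[OF S s r(2)]
      value_at_origin_rep[OF S r(1)] value_at_origin_rep[OF S r(2)]
      linear_part_rep[OF S s origin_rep_mult[OF S r]]
    using r unfolding origin_rep_def
    by (simp add: lookup_mult_0[OF S] lookup_mult_irreducible[OF s] power2_eq_square add_frac_eq frac_eq_eq)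
      (simp add: algebra_simps)
qed

lemma linear_part_lp:
  assumes S: "pointed_monoid S" "s \<in> irreducibles S" "Poly_Mapping.keys p \<subseteq> S"
  shows "linear_part S s (lp p) = Poly_Mapping.lookup p s"
proof -
  have "s \<noteq> 0" using S(2) by (simp add: irreducibles_def)
  then show ?thesis
    using linear_part_rep[OF S(1,2) origin_rep_lp[OF S(1,3)]] by (simp add: lookup_one when_def)
qed

text \<open>Modulo the maximal ideal an element agrees with its value at the fixed point, so the
  Leibniz rule with these values as coefficients is enough. Each irreducible thus yields a tangent
  vector.\<close>

lemma residue_derivation_linear_part:
  assumes S: "pointed_monoid S" and s: "s \<in> irreducibles S"
  shows "residue_derivation (origin_ring S) (\<lambda>x :: 'k::field ratfun. scal (linear_part S s x))"
  unfolding residue_derivation_def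
proof (intro conjI ballI allI)
  let ?R = "origin_ring S :: 'k ratfun set"
  note R = subring_setD[OF subring_set_origin_ring[OF S, where ?'k = 'k]]
  have scal: "scal c \<in> ?R" for c
    using S semigroup_ring_subset_origin_ring[OF S] scal_in_semigroup_ring[of S c]
    by (auto simp: pointed_monoid_def)
  have zero: "0 \<in> nonunits ?R"
    using R(2) value_at_origin_scal[OF S, of 0] by (simp add: nonunits_origin_ring[OF S])
  fix f g :: "'k ratfun" assume f: "f \<in> ?R"
  show "scal (linear_part S s f) \<in> ?R" by (rule scal)
  assume g: "g \<in> ?R"
  show "scal (linear_part S s (f + g)) - (scal (linear_part S s f) + scal (linear_part S s g)) \<in> nonunits ?R"
    using linear_part_add[OF S s f g] zero by (simp add: scal_add)
  show "scal (linear_part S s (f * g)) - (f * scal (linear_part S s g) + g * scal (linear_part S s f)) \<in> nonunits ?R"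
    using f g scal R
    by (simp add: nonunits_origin_ring[OF S] value_at_origin_diff[OF S] value_at_origin_add[OF S]
        value_at_origin_mult[OF S] value_at_origin_scal[OF S] linear_part_mult[OF S s])
next
  fix c :: 'k
  have "linear_part S s (scal c) = 0"
  proof -
    have "s \<noteq> 0" using s by (simp add: irreducibles_def)
    then show ?thesis
      unfolding scal_lp
      by (subst linear_part_lp[OF S s]) (use S in \<open>auto simp: pointed_monoid_def monoid_on_def lookup_single when_def\<close>)
  qed
  then show "scal (linear_part S s (scal c)) \<in> nonunits (origin_ring S)"
    using subring_setD(2)[OF subring_set_origin_ring[OF S]] value_at_origin_scal[OF S, of 0]
    by (simp add: nonunits_origin_ring[OF S])
qed

text \<open>The tangent vectors of three irreducibles are dual to their characters, so they would be
  independent in a space of dimension at most two.\<close>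

lemma tangent_dim_imp_few_irreducibles:
  assumes S: "pointed_monoid S" and T: "tangent_dim (origin_ring S :: 'k::field ratfun set) n" and n: "n \<le> 2"
    and s: "s 0 \<in> irreducibles S" "s 1 \<in> irreducibles S" "s (2::nat) \<in> irreducibles S"
      "s 0 \<noteq> s 1" "s 0 \<noteq> s 2" "s 1 \<noteq> s 2"
  shows False
proof -
  let ?R = "origin_ring S :: 'k ratfun set"
  note R = subring_setD[OF subring_set_origin_ring[OF S, where ?'k = 'k]]
  obtain E where E: "\<forall>i<n. residue_derivation ?R (E i)"
    "\<And>D. residue_derivation ?R D \<Longrightarrow> (\<exists>c. (\<forall>i<n. c i \<in> ?R) \<and> (\<forall>f\<in>?R. D f - (\<Sum>i<n. c i * E i f) \<in> nonunits ?R))"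
    using T unfolding tangent_dim_def by blast
  have irr: "s j \<in> irreducibles S" if "j < 3" for j
    using that s by (auto simp: numeral_3_eq_3 less_Suc_eq numeral_2_eq_2)
  have "\<exists>c. (\<forall>i<n. c i \<in> ?R) \<and> (\<forall>f\<in>?R. scal (linear_part S (s j) f) - (\<Sum>i<n. c i * E i f) \<in> nonunits ?R)"
    if "j < 3" for j
    using E(2)[OF residue_derivation_linear_part[OF S irr[OF that]]] .
  then have "\<forall>j. \<exists>c. j < 3 \<longrightarrow> (\<forall>i<n. c i \<in> ?R) \<and>
      (\<forall>f\<in>?R. scal (linear_part S (s j) f) - (\<Sum>i<n. c i * E i f) \<in> nonunits ?R)" by blast
  from choice[OF this] obtain c where c': "\<forall>j. j < 3 \<longrightarrow> (\<forall>i<n. c j i \<in> ?R) \<and>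
      (\<forall>f\<in>?R. scal (linear_part S (s j) f) - (\<Sum>i<n. c j i * E i f) \<in> nonunits ?R)" ..
  then have c: "\<And>j i. j < 3 \<Longrightarrow> i < n \<Longrightarrow> c j i \<in> ?R"
    "\<And>j f. j < 3 \<Longrightarrow> f \<in> ?R \<Longrightarrow> scal (linear_part S (s j) f) - (\<Sum>i<n. c j i * E i f) \<in> nonunits ?R"
    by simp_all
  \<comment> \<open>Padding with 0 gives sums of exactly two terms also if \<open>n\<close> is
    smaller than 2.\<close>
  define \<gamma> where "\<gamma> j i = (if i < n then value_at_origin S (c j i) else 0)" for j i
  define e where "e i l = value_at_origin S (E i (chi (s l)))" for i l
  have eq: "(if j = l then 1 else 0) = \<gamma> j 0 * e 0 l + \<gamma> j 1 * e 1 l" if jl: "j < 3" "l < 3" for j l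
  proof -
    have sl: "s l \<in> S" using irr[OF jl(2)] by (simp add: irreducibles_def)
    have chi: "chi (s l) \<in> ?R" using sl by (simp add: chi_in_origin_ring[OF S])
    have Ei: "E i (chi (s l)) \<in> ?R" if "i < n" for i
      using E(1) that chi by (simp add: residue_derivation_def)
    have terms: "c j i * E i (chi (s l)) \<in> ?R" if "i < n" for i
      by (intro R(6) c(1) Ei jl that)
    note sum = value_at_origin_sum[OF S, of n "\<lambda>i. c j i * E i (chi (s l))", OF terms]
    have lin: "linear_part S (s j) (chi (s l)) = (if j = l then 1 else 0 :: 'k)"
    proof -
      have "s j = s l \<longleftrightarrow> j = l"
        using jl s by (auto simp: numeral_3_eq_3 less_Suc_eq numeral_2_eq_2)
      then show ?thesis
        unfolding chi_lp by (subst linear_part_lp[OF S irr[OF jl(1)]]) (use sl in \<open>auto simp: lookup_single when_def\<close>)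
    qed
    have scal: "scal (linear_part S (s j) (chi (s l))) \<in> ?R"
      using residue_derivation_linear_part[OF S irr[OF jl(1)], where ?'k = 'k] chi
      by (simp add: residue_derivation_def)
    have "value_at_origin S (scal (linear_part S (s j) (chi (s l))) - (\<Sum>i<n. c j i * E i (chi (s l)))) = 0"
      using c(2)[OF jl(1) chi] by (simp add: nonunits_origin_ring[OF S])
    then have "(if j = l then 1 else 0) = (\<Sum>i<n. value_at_origin S (c j i * E i (chi (s l))))"
      using sum scal by (simp add: value_at_origin_diff[OF S] value_at_origin_scal[OF S] lin)
    also have "\<dots> = (\<Sum>i<n. \<gamma> j i * e i l)"
      by (rule sum.cong) (auto simp: value_at_origin_mult[OF S] c(1)[OF jl(1)] Ei \<gamma>_def e_def)
    also have "\<dots> = (\<Sum>i<2. \<gamma> j i * e i l)"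
      by (rule sum.mono_neutral_left) (use n in \<open>auto simp: \<gamma>_def\<close>)
    finally show ?thesis by (simp add: numeral_2_eq_2)
  qed
  \<comment> \<open>A product of a 3 x 2 and a 2 x 3 matrix, so its determinant vanishes; by
    \<open>eq\<close> it is the identity matrix.\<close>
  define M where "M j l = \<gamma> j 0 * e 0 l + \<gamma> j 1 * e 1 l" for j l
  have "M 0 0 * (M 1 1 * M 2 2 - M 1 2 * M 2 1) - M 0 1 * (M 1 0 * M 2 2 - M 1 2 * M 2 0)
      + M 0 2 * (M 1 0 * M 2 1 - M 1 1 * M 2 0) = 0"
    unfolding M_def by (simp add: algebra_simps)
  moreover have "M j l = (if j = l then 1 else 0)" if "j < 3" "l < 3" for j l
    using eq[OF that] by (simp add: M_def)
  ultimately show False by simp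
qed

text \<open>chi^m is a root of the monic polynomial t^N - chi^(N m), whose coefficients lie in the
  local ring.\<close>

lemma normal_origin_ring_saturated:
  assumes S: "pointed_monoid S" and V: "normal_variety n (V :: 'k::field ratfun set set)" "origin_ring S \<in> V"
    and m: "m \<in> char_lattice n" "N > 0" "of_nat N * m \<in> S"
  shows "m \<in> S"
proof -
  let ?R = "origin_ring S :: 'k ratfun set"
  note R = subring_setD[OF subring_set_origin_ring[OF S, where ?'k = 'k]]
  let ?p = "[:- chi (of_nat N * m):] + Polynomial.monom (1 :: 'k ratfun) N"
  have "lead_coeff ?p = 1"
    using m(2) by (subst lead_coeff_add_le) (auto simp: degree_monom_eq)
  moreover have "Polynomial.coeff ?p i \<in> ?R" for i
    using R m(3) by (auto simp: coeff_pCons chi_in_origin_ring[OF S] split: nat.split)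
  moreover have "poly ?p (chi m) = 0"
    by (simp add: poly_monom chi_of_nat_mult)
  moreover have "chi m \<in> (torus_field n :: 'k ratfun set)"
  proof -
    have "chi m / chi 0 \<in> (torus_field n :: 'k ratfun set)"
      unfolding torus_field_def quotients_def using m(1)
      by (intro CollectI exI[of _ "chi m"] exI[of _ "chi 0"]) (simp del: chi_0)
    then show ?thesis by simp
  qed
  ultimately have "chi m \<in> ?R"
    using V unfolding normal_variety_def by blast
  then show ?thesis by (simp add: chi_in_origin_ring[OF S])
qed

section \<open>The fixed point as a point of the spectrum\<close>

lemma primeideal_origin:
  assumes S: "pointed_monoid S"
  shows "primeideal (origin S :: 'k::field ratfun set) (ring_on (semigroup_ring S))"
proof -
  have m: "monoid_on S" using S by (simp add: pointed_monoid_def)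
  have O: "lp p \<in> origin S \<longleftrightarrow> Poly_Mapping.keys p \<subseteq> S \<and> Poly_Mapping.lookup p 0 = 0" for p :: "'k laurent"
    by (auto simp: origin_def)
  note sub = subring_set_semigroup_ring[OF m, where ?'k = 'k]
  show ?thesis
  proof (rule primeidealI)
    show "ideal (origin S :: 'k ratfun set) (ring_on (semigroup_ring S))"
    proof (rule ideal_ring_onI[OF sub])
      show "origin S \<subseteq> (semigroup_ring S :: 'k ratfun set)" by (auto simp: origin_def)
      show "0 \<in> (origin S :: 'k ratfun set)" using O[of 0] by simp
    next
      fix x y :: "'k ratfun" assume "x \<in> origin S" "y \<in> origin S"
      then show "x + y \<in> origin S"
        unfolding origin_def by clarsimp (metis add.right_neutral keys_add_subset lookup_add lp_add)
    next
      fix a x :: "'k ratfun" assume "a \<in> semigroup_ring S" "x \<in> origin S"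
      then obtain p q where "a = lp p" "x = lp q" "Poly_Mapping.keys p \<subseteq> S" "Poly_Mapping.keys q \<subseteq> S"
        "Poly_Mapping.lookup q 0 = 0"
        by (auto simp: origin_def elim!: semigroup_ringE)
      then show "a * x \<in> origin S"
        using O[of "p * q"] by (simp add: lp_mult keys_mult_subset[OF m] lookup_mult_0[OF S])
    qed
    show "cring (ring_on (semigroup_ring S :: 'k ratfun set))" by (rule cring_ring_on[OF sub])
    have "lp 1 \<notin> (origin S :: 'k ratfun set)" unfolding O by (simp add: lookup_one)
    then show "carrier (ring_on (semigroup_ring S)) \<noteq> (origin S :: 'k ratfun set)"
      using subring_setD(1)[OF sub] by auto
  next
    fix a b :: "'k ratfun"
    assume ab: "a \<in> carrier (ring_on (semigroup_ring S))" "b \<in> carrier (ring_on (semigroup_ring S))"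
      "a \<otimes>\<^bsub>ring_on (semigroup_ring S)\<^esub> b \<in> origin S"
    obtain p where p: "a = lp p" "Poly_Mapping.keys p \<subseteq> S" using ab(1) by (auto elim: semigroup_ringE)
    obtain q where q: "b = lp q" "Poly_Mapping.keys q \<subseteq> S" using ab(2) by (auto elim: semigroup_ringE)
    have "lp (p * q) \<in> origin S" using ab(3) by (simp add: p q lp_mult)
    then show "a \<in> origin S \<or> b \<in> origin S"
      unfolding p(1) q(1) O using p q by (simp add: lookup_mult_0[OF S])
  qed
qed

lemma origin_ring_in_Spec:
  "pointed_monoid S \<Longrightarrow> origin_ring S \<in> Spec (semigroup_ring S)"
  using primeideal_origin by (auto simp: Spec_def origin_ring_def)

text \<open>The affine cover over which a quotient is described is arbitrary; this identifies its
  member around the fixed point of a cone. The prime \<open>P\<close> contains chi^m for nonzero m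
  in \<open>S\<close>, since otherwise - m would lie in the pointed monoid \<open>C\<close>.\<close>

lemma origin_ring_in_Spec_semigroup_ring:
  assumes C: "pointed_monoid C" and S: "monoid_on S"
    and R: "(origin_ring C :: 'k::field ratfun set) \<in> Spec (semigroup_ring S)"
  shows "S = C"
proof -
  let ?B = "semigroup_ring S :: 'k ratfun set"
  note B = subring_setD[OF subring_set_semigroup_ring[OF S, where ?'k = 'k]]
  obtain P where P: "primeideal P (ring_on ?B)" "origin_ring C = localization ?B P"
    using R by (auto simp: Spec_def)
  have PI: "ideal P (ring_on ?B)" using P(1) by (rule primeideal.axioms)
  have "1 \<notin> P"
  proof
    assume "1 \<in> P"
    then have "P = ?B" using ideal_ring_onD(1)[OF PI] ideal_ring_onD(4)[OF PI, of _ 1] by auto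
    then show False using primeideal.I_notcarr[OF P(1)] by simp
  qed
  have SC: "m \<in> C" if "m \<in> S" for m
  proof -
    have "chi m / 1 \<in> localization ?B P"
      unfolding localization_def using that B(1) \<open>1 \<notin> P\<close>
      by (intro CollectI exI[of _ "chi m"] exI[of _ 1]) simp
    then show ?thesis using P(2) chi_in_origin_ring[OF C, of m, where ?'k = 'k] by simp
  qed
  have chiP: "chi m \<in> P" if "m \<in> S" "m \<noteq> 0" for m
  proof (rule ccontr)
    assume "chi m \<notin> P"
    then have "1 / chi m \<in> localization ?B P"
      unfolding localization_def using that B(1)
      by (intro CollectI exI[of _ 1] exI[of _ "chi m"]) simp
    then have "- m \<in> C"
      using P(2) chi_in_origin_ring[OF C, of "- m", where ?'k = 'k] by (simp add: chi_uminus divide_inverse)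
    then show False using that SC C by (auto simp: pointed_monoid_def)
  qed
  show ?thesis
  proof (intro equalityI subsetI SC)
    fix m assume "m \<in> C"
    then have "chi m \<in> localization ?B P"
      using P(2) chi_in_origin_ring[OF C, of m, where ?'k = 'k] by simp
    then obtain a s where as: "chi m = a / s" "a \<in> ?B" "s \<in> ?B" "s \<notin> P"
      by (auto simp: localization_def)
    obtain p where p: "a = lp p" "Poly_Mapping.keys p \<subseteq> S" using as(2) by (rule semigroup_ringE)
    obtain q where q: "s = lp q" "Poly_Mapping.keys q \<subseteq> S" using as(3) by (rule semigroup_ringE)
    \<comment> \<open>All nontrivial characters of \<open>S\<close> lie in \<open>P\<close>, so a
      denominator outside \<open>P\<close> must have a constant term, and m occurs among the
      exponents of the numerator.\<close>
    have q0: "Poly_Mapping.lookup q 0 \<noteq> 0"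
    proof
      assume "Poly_Mapping.lookup q 0 = 0"
      then have "Poly_Mapping.keys q \<subseteq> S - {0}" using q(2) by (auto simp: in_keys_iff)
      then have "lp q \<in> P"
      proof (induction q rule: laurent_induct_on)
        case zero then show ?case using ideal_ring_onD(2)[OF PI] by simp
      next
        case (single m c)
        then show ?case
          using ideal_ring_onD(4)[OF PI scal_in_semigroup_ring[OF S] chiP] by (simp add: lp_single)
      next
        case (add f g) then show ?case using ideal_ring_onD(3)[OF PI] by (simp add: lp_add)
      qed
      then show False using as(4) q(1) by simp
    qed
    then have "lp q \<noteq> 0" by auto
    then have "chi m * lp q = lp p" using as(1) p q by simp
    then have "lp (Poly_Mapping.single m 1 * q) = lp p" by (simp add: lp_mult chi_lp)
    then have "Poly_Mapping.single m 1 * q = p" by simp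
    then have "Poly_Mapping.lookup p m \<noteq> 0" using lookup_single_times[of m 1 q 0] q0 by auto
    then show "m \<in> S" using p(2) by (auto simp: in_keys_iff subset_iff)
  qed
qed

subsection \<open>Charts of a toric quotient\<close>

lemma torus_ring_subset_torus_field: "torus_ring n \<subseteq> (torus_field n :: 'k::field ratfun set)"
proof
  fix x :: "'k ratfun" assume "x \<in> torus_ring n"
  moreover have "(1 :: 'k ratfun) \<in> torus_ring n"
    by (rule subring_setD[OF subring_set_semigroup_ring[OF monoid_on_char_lattice]])
  ultimately show "x \<in> torus_field n"
    unfolding torus_field_def quotients_def by (intro CollectI exI[of _ x] exI[of _ 1]) simp
qed

lemma torus_field_lp_divide:
  assumes "Poly_Mapping.keys a \<subseteq> char_lattice n" "Poly_Mapping.keys b \<subseteq> char_lattice n"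
  shows "lp a / lp b \<in> torus_field n"
  unfolding torus_field_def quotients_def
  using assms by (intro CollectI exI[of _ "lp a"] exI[of _ "lp b"]) simp

lemma torus_field_diff:
  assumes "x \<in> torus_field n" "y \<in> torus_field n"
  shows "x - y \<in> torus_field n"
proof -
  obtain a b where ab: "b \<noteq> 0" "Poly_Mapping.keys a \<subseteq> char_lattice n" "Poly_Mapping.keys b \<subseteq> char_lattice n"
    "x = lp a / lp b" using torus_field_quotient[OF assms(1)] .
  obtain c d where cd: "d \<noteq> 0" "Poly_Mapping.keys c \<subseteq> char_lattice n" "Poly_Mapping.keys d \<subseteq> char_lattice n"
    "y = lp c / lp d" using torus_field_quotient[OF assms(2)] .
  have "x - y = lp (a * d + - (c * b)) / lp (b * d)"
    using ab cd by (simp add: diff_frac_eq lp_diff lp_mult)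
  moreover have "Poly_Mapping.keys (a * d + - (c * b)) \<subseteq> char_lattice n"
    using ab cd by (intro keys_add_subset) (simp_all add: keys_mult_subset[OF monoid_on_char_lattice])
  moreover have "Poly_Mapping.keys (b * d) \<subseteq> char_lattice n"
    using ab cd by (simp add: keys_mult_subset[OF monoid_on_char_lattice])
  ultimately show ?thesis using torus_field_lp_divide by metis
qed

lemma torus_field_inverse:
  assumes "x \<in> torus_field n" shows "inverse x \<in> torus_field n"
proof -
  obtain a b where "Poly_Mapping.keys a \<subseteq> char_lattice n" "Poly_Mapping.keys b \<subseteq> char_lattice n"
    "x = lp a / lp b" using torus_field_quotient[OF assms] .
  then show ?thesis using torus_field_lp_divide[of b n a] by simp
qed

text \<open>Multiplication by a character only translates the support, so the exponent of a
  character that is a fraction is a difference of exponents of numerator and denominator.\<close>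

lemma chi_lp_quotient_keys:
  fixes p q :: "'k::field laurent"
  assumes "chi m * lp q = lp p" "q \<noteq> 0"
  shows "\<exists>k\<in>Poly_Mapping.keys q. m + k \<in> Poly_Mapping.keys p"
proof -
  have "lp (Poly_Mapping.single m 1 * q) = lp p" using assms(1) by (simp add: lp_mult chi_lp)
  then have eq: "Poly_Mapping.single m 1 * q = p" by simp
  obtain k where k: "k \<in> Poly_Mapping.keys q" using assms(2) by (metis keys_eq_empty ex_in_conv)
  have "m + k \<in> Poly_Mapping.keys (Poly_Mapping.single m 1 * q)"
    by (rule keys_single_times[OF _ k]) simp
  then show ?thesis using k eq by blast
qed

lemma affine_modelD:
  assumes "affine_model n A"
  shows "subring_set A" "range scal \<subseteq> A" "A \<subseteq> torus_field n" "quotients A = torus_field n"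
proof -
  obtain F where F: "A = generate_ring (ring_on UNIV) (range scal \<union> F)"
    using assms by (auto simp: affine_model_def)
  show A: "subring_set A" unfolding F by (rule subring_set_generate_ring)
  show "range scal \<subseteq> A" unfolding F using generate_ring_incl_ring_on[of "range scal \<union> F"] by simp
  show q: "quotients A = torus_field n" using assms by (simp add: affine_model_def)
  show "A \<subseteq> torus_field n"
  proof
    fix x assume "x \<in> A"
    then have "x / 1 \<in> quotients A"
      unfolding quotients_def using subring_setD(1)[OF A] by blast
    then show "x \<in> torus_field n" by (simp add: q)
  qed
qed

section \<open>The quotient map on function fields and on characters\<close>

context
  fixes n :: nat and h :: "'k::field ratfun \<Rightarrow> 'k ratfun" and \<phi> :: "exponent \<Rightarrow> exponent"
  assumes h: "h \<in> ring_hom (ring_on (torus_field 2)) (ring_on (torus_field n))"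
    and h_scal: "\<forall>c. h (scal c) = scal c"
    and \<phi>: "\<forall>m\<in>char_lattice 2. \<phi> m \<in> char_lattice n \<and> h (chi m) = chi (\<phi> m)"
begin

lemma h_chi: "m \<in> char_lattice 2 \<Longrightarrow> h (chi m) = chi (\<phi> m)"
  using \<phi> by blast

lemma h_add: "x \<in> torus_field 2 \<Longrightarrow> y \<in> torus_field 2 \<Longrightarrow> h (x + y) = h x + h y"
  and h_mult: "x \<in> torus_field 2 \<Longrightarrow> y \<in> torus_field 2 \<Longrightarrow> h (x * y) = h x * h y"
  using ring_hom_add[OF h] ring_hom_mult[OF h] by simp_all

lemma torus_ring_field: "x \<in> torus_ring 2 \<Longrightarrow> x \<in> (torus_field 2 :: 'k ratfun set)"
  using torus_ring_subset_torus_field by blast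

lemma h_0: "h 0 = 0"
  using h_scal scal_0 by metis

lemma h_1: "h 1 = 1"
  using h_scal scal_1 by metis

lemma h_inj: "inj_on h (torus_field 2)"
proof (rule inj_onI, rule ccontr)
  fix x y assume xy: "x \<in> torus_field 2" "y \<in> torus_field 2" "h x = h y" "x \<noteq> y"
  have d: "x - y \<in> torus_field 2" by (rule torus_field_diff[OF xy(1,2)])
  have "h x = h (x - y) + h y" using h_add[OF d xy(2)] by simp
  then have "h (x - y) = 0" using xy(3) by simp
  moreover have "h ((x - y) * inverse (x - y)) = h (x - y) * h (inverse (x - y))"
    by (rule h_mult[OF d torus_field_inverse[OF d]])
  ultimately show False using xy(4) h_1 by simp
qed

lemma h_lp:
  assumes "Poly_Mapping.keys p \<subseteq> char_lattice 2" shows "h (lp p) = lp (laurent_map \<phi> p)"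
  using assms
proof (induction p rule: laurent_induct_on)
  case zero then show ?case by (simp add: h_0)
next
  case (single m c)
  have "scal c \<in> (torus_field 2 :: 'k ratfun set)" "chi m \<in> (torus_field 2 :: 'k ratfun set)"
    using single scal_in_semigroup_ring[OF monoid_on_char_lattice] by (auto intro!: torus_ring_field)
  then show ?case using single by (simp add: lp_single h_mult h_scal h_chi)
next
  case (add f g)
  then show ?case using h_add[of "lp f" "lp g"] torus_ring_field[of "lp f"] torus_ring_field[of "lp g"]
    by (simp add: lp_add laurent_map_add)
qed

lemma \<phi>_add:
  assumes "a \<in> char_lattice 2" "b \<in> char_lattice 2" shows "\<phi> (a + b) = \<phi> a + \<phi> b"
proof -
  have "chi a \<in> (torus_field 2 :: 'k ratfun set)" "chi b \<in> (torus_field 2 :: 'k ratfun set)"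
    using assms by (auto intro!: torus_ring_field)
  then have "(chi (\<phi> (a + b)) :: 'k ratfun) = chi (\<phi> a + \<phi> b)"
    using h_chi[of "a + b"] assms by (simp add: char_lattice_add chi_add h_mult h_chi)
  then show ?thesis by simp
qed

lemma \<phi>_0: "\<phi> 0 = 0"
  using \<phi>_add[of 0 0] by simp

lemma \<phi>_diff:
  assumes "a \<in> char_lattice 2" "b \<in> char_lattice 2" shows "\<phi> (a - b) = \<phi> a - \<phi> b"
  using \<phi>_add[OF char_lattice_diff[OF assms] assms(2)] by simp

lemma \<phi>_inj: "inj_on \<phi> (char_lattice 2)"
proof (rule inj_onI)
  fix a b assume ab: "a \<in> char_lattice 2" "b \<in> char_lattice 2" "\<phi> a = \<phi> b"
  then have "h (chi a) = h (chi b)" by (simp add: h_chi)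
  moreover have "chi a \<in> (torus_field 2 :: 'k ratfun set)" "chi b \<in> (torus_field 2 :: 'k ratfun set)"
    using ab by (auto intro!: torus_ring_field)
  ultimately have "(chi a :: 'k ratfun) = chi b"
    by (rule inj_onD[OF h_inj])
  then show "a = b" by simp
qed

lemma quotient_affine_chart:
  assumes I: "ideal I (ring_on (torus_ring n))"
    and B: "affine_model 2 B" "h ` B = invariants n I A"
    and A: "affine_model n A" "coaction n ` A \<subseteq> tensor_torus n A"
    and C: "pointed_monoid C" "origin_ring C \<in> Spec B"
  shows "\<exists>S. A = semigroup_ring S \<and> monoid_on S \<and> S \<subseteq> char_lattice n \<and> S \<inter> trivial_chars n I = \<phi> ` C
    \<and> (\<forall>m\<in>char_lattice n. \<exists>s\<in>S. \<exists>t\<in>S. m = s - t)"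
proof -
  define S where "S = {m \<in> char_lattice n. chi m \<in> A}"
  define L where "L = S \<inter> trivial_chars n I"
  note A_D = affine_modelD[OF A(1)]
  note B_D = affine_modelD[OF B(1)]
  have AS: "A = semigroup_ring S"
    unfolding S_def by (rule coaction_stable_imp_semigroup_ring[OF A_D(1-3) A(2)])
  have S: "monoid_on S" "S \<subseteq> char_lattice n"
    using subring_setD[OF A_D(1)] char_lattice_add by (auto simp: S_def monoid_on_def chi_add)
  have hB: "h ` B = semigroup_ring L"
    using B(2) invariants_semigroup_ring[OF I S] by (simp add: AS L_def)
  have L: "monoid_on L"
    using S(1) trivial_chars_add[OF I] ideal_ring_onD(2)[OF I] by (auto simp: L_def monoid_on_def trivial_chars_def)
  have L\<phi>: "m \<in> \<phi> ` char_lattice 2" if "m \<in> L" for m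
  proof -
    have "chi m \<in> h ` B" using that by (simp add: hB)
    then obtain b where b: "b \<in> B" "chi m = h b" by blast
    obtain p q where pq: "q \<noteq> 0" "Poly_Mapping.keys p \<subseteq> char_lattice 2" "Poly_Mapping.keys q \<subseteq> char_lattice 2"
        "b = lp p / lp q" using torus_field_quotient[OF subsetD[OF B_D(3) b(1)]] .
    have lpq: "lp q \<in> torus_field 2" using pq(3) by (auto intro!: torus_ring_field)
    have "h b * h (lp q) = h (b * lp q)" using h_mult[of b "lp q"] lpq B_D(3) b(1) by auto
    also have "b * lp q = lp p" using pq by simp
    finally have "chi m * lp (laurent_map \<phi> q) = lp (laurent_map \<phi> p)"
      using b(2) by (simp add: h_lp pq)
    moreover have "laurent_map \<phi> q \<noteq> 0"
    proof
      assume "laurent_map \<phi> q = 0"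
      then have "h (lp q) = h 0" by (simp add: h_lp pq h_0)
      moreover have "0 \<in> (torus_field 2 :: 'k ratfun set)" using torus_field_lp_divide[of 0 2 0] by simp
      ultimately have "lp q = 0" using inj_onD[OF h_inj] lpq by blast
      then show False using pq(1) by simp
    qed
    ultimately obtain k where "k \<in> Poly_Mapping.keys (laurent_map \<phi> q)" "m + k \<in> Poly_Mapping.keys (laurent_map \<phi> p)"
      using chi_lp_quotient_keys by blast
    then obtain s t where st: "s \<in> char_lattice 2" "t \<in> char_lattice 2" "k = \<phi> s" "m + k = \<phi> t"
      using keys_laurent_map[of \<phi> p] keys_laurent_map[of \<phi> q] pq by blast
    then have "m = \<phi> (t - s)" by (simp add: \<phi>_diff) (metis add_diff_cancel_right')
    then show ?thesis using char_lattice_diff[OF st(2,1)] by blast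
  qed
  define SB where "SB = {c \<in> char_lattice 2. \<phi> c \<in> L}"
  have SB: "monoid_on SB"
    using L by (auto simp: SB_def monoid_on_def \<phi>_0 \<phi>_add char_lattice_add)
  have \<phi>SB: "\<phi> ` SB = L" using L\<phi> by (auto simp: SB_def)
  have "B = semigroup_ring SB"
  proof
    have "chi c \<in> B" if c: "c \<in> SB" for c
    proof -
      have "h (chi c) \<in> h ` B" using c by (simp add: hB h_chi SB_def)
      then obtain b where b: "b \<in> B" "h (chi c) = h b" by blast
      have "chi c \<in> (torus_field 2 :: 'k ratfun set)" using c by (auto intro!: torus_ring_field simp: SB_def)
      then show ?thesis using inj_onD[OF h_inj b(2)] b(1) B_D(3) by auto
    qed
    then show "semigroup_ring SB \<subseteq> B" by (rule semigroup_ring_subset[OF B_D(1,2)])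
  next
    have lift: "lp p \<in> h ` semigroup_ring SB" if "Poly_Mapping.keys p \<subseteq> L" for p
      using that
    proof (induction p rule: laurent_induct_on)
      case zero
      have "lp (0 :: 'k laurent) \<in> semigroup_ring SB" by (simp del: lp_0)
      then show ?case using h_0 by (metis image_eqI lp_0)
    next
      case (single m c)
      then obtain d where d: "d \<in> SB" "m = \<phi> d" using \<phi>SB by blast
      then have "h (lp (Poly_Mapping.single d c)) = lp (Poly_Mapping.single m c)"
        by (subst h_lp) (auto simp: SB_def)
      moreover have "lp (Poly_Mapping.single d c) \<in> semigroup_ring SB" using d by auto
      ultimately show ?case by (metis image_eqI)
    next
      case (add f g)
      then obtain p q where pq: "lp f = h (lp p)" "lp g = h (lp q)" "Poly_Mapping.keys p \<subseteq> SB" "Poly_Mapping.keys q \<subseteq> SB"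
        by (auto elim!: semigroup_ringE)
      have "SB \<subseteq> char_lattice 2" by (auto simp: SB_def)
      then have "lp p \<in> torus_field 2" "lp q \<in> torus_field 2" using pq(3,4) by (auto intro!: torus_ring_field)
      then have "lp (f + g) = h (lp (p + q))" by (simp add: lp_add h_add pq(1,2))
      moreover have "lp (p + q) \<in> semigroup_ring SB" by (simp add: keys_add_subset pq)
      ultimately show ?case by blast
    qed
    show "B \<subseteq> semigroup_ring SB"
    proof
      fix b assume b: "b \<in> B"
      then have "h b \<in> semigroup_ring L" using hB by blast
      then have "h b \<in> h ` semigroup_ring SB" using lift by (auto elim!: semigroup_ringE)
      then obtain x where x: "x \<in> semigroup_ring SB" "h b = h x" by blast
      have "SB \<subseteq> char_lattice 2" by (auto simp: SB_def)
      then have "x \<in> torus_field 2" using semigroup_ring_mono[of SB "char_lattice 2"] x(1) by (auto intro!: torus_ring_field)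
      then show "b \<in> semigroup_ring SB" using inj_onD[OF h_inj x(2)] x(1) b B_D(3) by auto
    qed
  qed
  then have "SB = C" using origin_ring_in_Spec_semigroup_ring[OF C(1) SB] C(2) by simp
  then have "S \<inter> trivial_chars n I = \<phi> ` C" using \<phi>SB by (simp add: L_def)
  moreover have "\<exists>s\<in>S. \<exists>t\<in>S. m = s - t" if m: "m \<in> char_lattice n" for m
  proof -
    have "chi m \<in> (torus_field n :: 'k ratfun set)"
      using m torus_ring_subset_torus_field[of n] by auto
    then obtain a b where ab: "a \<in> A" "b \<in> A" "chi m = a / b"
      using A_D(4) unfolding quotients_def by blast
    obtain p q where pq: "a = lp p" "b = lp q" "Poly_Mapping.keys p \<subseteq> S" "Poly_Mapping.keys q \<subseteq> S"
      using ab(1,2) by (auto simp: AS elim!: semigroup_ringE)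
    have "b \<noteq> 0"
    proof
      assume "b = 0"
      then have "chi m = (0 :: 'k ratfun)" using ab(3) by simp
      then show False by simp
    qed
    then have "chi m * lp q = lp p" "q \<noteq> 0" using ab(3) pq by auto
    then obtain k where "k \<in> Poly_Mapping.keys q" "m + k \<in> Poly_Mapping.keys p"
      using chi_lp_quotient_keys by blast
    then show ?thesis using pq by (intro bexI[of _ "m + k"] bexI[of _ k]) auto
  qed
  ultimately show ?thesis using AS S by blast
qed

end

subsection \<open>Lattice geometry\<close>

lemma lookup_of_nat_mult: "Poly_Mapping.lookup (of_nat j * m :: exponent) i = int j * Poly_Mapping.lookup m i"
  by (induction j) (simp_all add: distrib_right lookup_add)

lemma lookup_of_int_mult: "Poly_Mapping.lookup (of_int x * m :: exponent) i = x * Poly_Mapping.lookup m i"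
  by (cases x rule: int_cases2) (simp_all add: lookup_of_nat_mult)

lemma of_nat_mult_eq_0: "N > 0 \<Longrightarrow> of_nat N * (m :: exponent) = 0 \<Longrightarrow> m = 0"
  by (rule poly_mapping_eqI) (metis lookup_of_nat_mult lookup_zero mult_eq_0_iff of_nat_0_less_iff order_less_irrefl)

lemma char_lattice_of_int_mult: "a \<in> char_lattice n \<Longrightarrow> of_int x * a \<in> char_lattice n"
  by (simp add: char_lattice_iff lookup_of_int_mult)

definition dot :: "int \<times> int \<Rightarrow> exponent \<Rightarrow> int" where
  "dot u m = fst u * Poly_Mapping.lookup m 0 + snd u * Poly_Mapping.lookup m 1"

definition det2 :: "int \<times> int \<Rightarrow> int \<times> int \<Rightarrow> int" where
  "det2 u v = fst u * snd v - snd u * fst v"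

definition coords :: "exponent \<Rightarrow> int \<times> int" where
  "coords m = (Poly_Mapping.lookup m 0, Poly_Mapping.lookup m 1)"

definition dual_cone :: "int \<times> int \<Rightarrow> int \<times> int \<Rightarrow> exponent set" where
  "dual_cone u v = {m \<in> char_lattice 2. dot u m \<ge> 0 \<and> dot v m \<ge> 0}"

lemma dot_0 [simp]: "dot u 0 = 0"
  and dot_add: "dot u (a + b) = dot u a + dot u b"
  and dot_uminus: "dot u (- a) = - dot u a"
  and dot_of_nat: "dot u (of_nat N * a) = int N * dot u a"
  unfolding dot_def lookup_add lookup_of_nat_mult by (simp_all add: algebra_simps)

text \<open>The left side is the determinant of the product of the matrix with rows u, v and the
  matrix with columns a, b.\<close>

lemma dot_det: "dot u a * dot v b - dot u b * dot v a = det2 u v * det2 (coords a) (coords b)"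
  by (simp add: dot_def det2_def coords_def algebra_simps)

lemma char_lattice_2_eq_0:
  assumes "m \<in> char_lattice 2" "Poly_Mapping.lookup m 0 = 0" "Poly_Mapping.lookup m 1 = 0"
  shows "m = 0"
proof (rule poly_mapping_eqI)
  fix i
  show "Poly_Mapping.lookup m i = Poly_Mapping.lookup 0 i"
    using assms by (cases "i \<ge> 2") (auto simp: char_lattice_iff not_le numeral_2_eq_2 less_Suc_eq)
qed

lemma dot_eq_0:
  assumes "det2 u v \<noteq> 0" "m \<in> char_lattice 2" "dot u m = 0" "dot v m = 0"
  shows "m = 0"
proof (rule char_lattice_2_eq_0[OF assms(2)])
  have "det2 u v * Poly_Mapping.lookup m 0 = snd v * dot u m - snd u * dot v m"
    "det2 u v * Poly_Mapping.lookup m 1 = fst u * dot v m - fst v * dot u m"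
    by (simp_all add: dot_def det2_def algebra_simps)
  then show "Poly_Mapping.lookup m 0 = 0" "Poly_Mapping.lookup m 1 = 0" using assms by simp_all
qed

lemma pointed_monoid_dual_cone:
  assumes "det2 u v \<noteq> 0"
  shows "pointed_monoid (dual_cone u v)"
  using dot_eq_0[OF assms]
  by (auto simp: pointed_monoid_def monoid_on_def dual_cone_def char_lattice_add dot_add dot_uminus)

text \<open>The coefficients are the 2 x 2 minors, that is, the cross product of p and q. If all
  minors vanish, either the first vector is 0 or the first two are proportional.\<close>

lemma int_plane_dependent:
  fixes p q :: "nat \<Rightarrow> int"
  shows "\<exists>t0 t1 t2. (t0 \<noteq> 0 \<or> t1 \<noteq> 0 \<or> t2 \<noteq> 0) \<and>
    t0 * p 0 + t1 * p 1 + t2 * p 2 = 0 \<and> t0 * q 0 + t1 * q 1 + t2 * q 2 = 0"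
proof -
  let ?d = "\<lambda>i j. p i * q j - p j * q i"
  consider "?d 1 2 \<noteq> 0 \<or> ?d 2 0 \<noteq> 0 \<or> ?d 0 1 \<noteq> 0" | "p 0 = 0" "q 0 = 0"
    | "?d 0 1 = 0" "p 0 \<noteq> 0" | "?d 0 1 = 0" "q 0 \<noteq> 0"
    by blast
  then show ?thesis
  proof cases
    case 1
    then show ?thesis
      by (intro exI[of _ "?d 1 2"] exI[of _ "?d 2 0"] exI[of _ "?d 0 1"]) (simp add: algebra_simps)
  next
    case 2
    then show ?thesis by (intro exI[of _ 1] exI[of _ 0]) simp
  next
    case 3
    then show ?thesis
      by (intro exI[of _ "p 1"] exI[of _ "- p 0"] exI[of _ 0]) (simp add: algebra_simps)
  next
    case 4
    then show ?thesis
      by (intro exI[of _ "q 1"] exI[of _ "- q 0"] exI[of _ 0]) (simp add: algebra_simps)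
  qed
qed

text \<open>Nonzero elements have positive weight, so both summands of a proper splitting have
  smaller weight than the sum.\<close>

lemma generated_by_irreducibles:
  assumes S: "monoid_on S" and w: "\<And>a b. a \<in> S \<Longrightarrow> b \<in> S \<Longrightarrow> w (a + b) = w a + w b"
      "\<And>s. s \<in> S \<Longrightarrow> w s \<ge> (0::int)" "\<And>s. s \<in> S \<Longrightarrow> w s = 0 \<Longrightarrow> s = 0"
    and irr: "irreducibles S \<subseteq> {a, b}" and s: "s \<in> S"
  shows "\<exists>x y :: nat. s = of_nat x * a + of_nat y * (b :: exponent)"
  using s
proof (induction "nat (w s)" arbitrary: s rule: less_induct)
  case less
  consider "s = 0" | "s \<in> irreducibles S"
    | c d where "c \<in> S" "d \<in> S" "s = c + d" "c \<noteq> 0" "d \<noteq> 0"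
    using less.prems by (auto simp: irreducibles_def)
  then show ?case
  proof cases
    case 1
    then show ?thesis by (intro exI[of _ 0]) simp
  next
    case 2
    then consider "s = of_nat 1 * a + of_nat 0 * b" | "s = of_nat 0 * a + of_nat 1 * b" using irr by auto
    then show ?thesis by cases blast+
  next
    case 3
    have "w c > 0" "w d > 0" using w(2,3)[OF 3(1)] w(2,3)[OF 3(2)] 3(4,5) by force+
    then have "nat (w c) < nat (w s)" "nat (w d) < nat (w s)" using w(1)[OF 3(1,2)] 3(3) by auto
    then obtain x y x' y' where "c = of_nat x * a + of_nat y * b" "d = of_nat x' * a + of_nat y' * b"
      using less.hyps 3(1,2) by metis
    then have "s = of_nat (x + x') * a + of_nat (y + y') * b" by (simp add: 3(3) algebra_simps)
    then show ?thesis by blast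
  qed
qed

text \<open>With fewer than two irreducibles the pair is padded from \<open>S\<close>, by 0 if there
  are none.\<close>

lemma few_irreducibles:
  assumes "0 \<in> S" and no3: "\<And>s. s 0 \<in> irreducibles S \<Longrightarrow> s 1 \<in> irreducibles S \<Longrightarrow> s (2::nat) \<in> irreducibles S
      \<Longrightarrow> s 0 \<noteq> s 1 \<Longrightarrow> s 0 \<noteq> s 2 \<Longrightarrow> s 1 \<noteq> s 2 \<Longrightarrow> False"
  shows "\<exists>a\<in>S. \<exists>b\<in>S. irreducibles S \<subseteq> {a, b}"
proof -
  have sub: "irreducibles S \<subseteq> S" by (auto simp: irreducibles_def)
  consider "irreducibles S \<subseteq> {0}" | a where "a \<in> irreducibles S" "irreducibles S \<subseteq> {a}"
    | a b where "a \<in> irreducibles S" "b \<in> irreducibles S" "a \<noteq> b" by blast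
  then show ?thesis
  proof cases
    case 1 then show ?thesis using assms(1) by blast
  next
    case 2 then show ?thesis using sub by blast
  next
    case 3
    have "c \<in> {a, b}" if "c \<in> irreducibles S" for c
      using no3[of "\<lambda>i. if i = 0 then a else if i = 1 then b else c"] 3 that by auto
    then show ?thesis using 3 sub by blast
  qed
qed

text \<open>\<open>\<psi>\<close> is the embedding into \<open>M\<close> of the character lattice of the torus of \<open>U\<close>, multiplied by \<open>N\<close>.\<close>

locale isogeny =
  fixes n N :: nat and \<phi> \<psi> :: "exponent \<Rightarrow> exponent"
  assumes N: "N > 0"
    and \<phi>: "\<And>c. c \<in> char_lattice 2 \<Longrightarrow> \<phi> c \<in> char_lattice n"
    and \<psi>: "\<And>m. m \<in> char_lattice n \<Longrightarrow> \<psi> m \<in> char_lattice 2"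
    and \<psi>_add: "\<And>a b. a \<in> char_lattice n \<Longrightarrow> b \<in> char_lattice n \<Longrightarrow> \<psi> (a + b) = \<psi> a + \<psi> b"
    and \<phi>\<psi>: "\<And>m. m \<in> char_lattice n \<Longrightarrow> \<phi> (\<psi> m) = of_nat N * m"
    and \<psi>\<phi>: "\<And>c. c \<in> char_lattice 2 \<Longrightarrow> \<psi> (\<phi> c) = of_nat N * c"
begin

lemma \<psi>_0: "\<psi> 0 = 0"
  using \<psi>_add[of 0 0] by simp

lemma \<psi>_uminus: "a \<in> char_lattice n \<Longrightarrow> \<psi> (- a) = - \<psi> a"
  using \<psi>_add[of a "- a"] by (simp add: char_lattice_uminus \<psi>_0 eq_neg_iff_add_eq_0 add.commute)

lemma \<psi>_of_nat: "a \<in> char_lattice n \<Longrightarrow> \<psi> (of_nat j * a) = of_nat j * \<psi> a"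
  by (induction j) (simp_all add: \<psi>_0 \<psi>_add distrib_right char_lattice_of_nat_mult)

lemma \<psi>_of_int:
  assumes "a \<in> char_lattice n" shows "\<psi> (of_int x * a) = of_int x * \<psi> a"
  using assms by (cases x rule: int_cases2)
    (simp_all add: \<psi>_of_nat \<psi>_uminus char_lattice_of_nat_mult)

lemma \<psi>_eq_0:
  assumes "m \<in> char_lattice n" "\<psi> m = 0" shows "m = 0"
proof -
  have "\<phi> 0 = \<phi> (\<psi> 0)" by (simp add: \<psi>_0)
  also have "\<dots> = 0" using \<phi>\<psi>[of 0] by simp
  finally have "of_nat N * m = 0" using \<phi>\<psi>[OF assms(1)] assms(2) by simp
  then show ?thesis by (rule of_nat_mult_eq_0[OF N])
qed

text \<open>\<psi> is injective and takes values in a lattice of rank 2, so three independent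
  characters would have a nontrivial relation.\<close>

lemma rank_le_2: "n \<le> 2"
proof (rule ccontr)
  assume "\<not> n \<le> 2"
  define e :: "nat \<Rightarrow> exponent" where "e i = Poly_Mapping.single i 1" for i
  have e: "e i \<in> char_lattice n" if "i \<le> 2" for i
    using that \<open>\<not> n \<le> 2\<close> by (auto simp: char_lattice_iff e_def lookup_single when_def)
  obtain t0 t1 t2 where t: "t0 \<noteq> 0 \<or> t1 \<noteq> 0 \<or> t2 \<noteq> 0"
    "t0 * Poly_Mapping.lookup (\<psi> (e 0)) 0 + t1 * Poly_Mapping.lookup (\<psi> (e 1)) 0 + t2 * Poly_Mapping.lookup (\<psi> (e 2)) 0 = 0"
    "t0 * Poly_Mapping.lookup (\<psi> (e 0)) 1 + t1 * Poly_Mapping.lookup (\<psi> (e 1)) 1 + t2 * Poly_Mapping.lookup (\<psi> (e 2)) 1 = 0"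
    using int_plane_dependent[of "\<lambda>i. Poly_Mapping.lookup (\<psi> (e i)) 0" "\<lambda>i. Poly_Mapping.lookup (\<psi> (e i)) 1"]
    by blast
  let ?m = "of_int t0 * e 0 + of_int t1 * e 1 + of_int t2 * e 2"
  have m: "?m \<in> char_lattice n" by (intro char_lattice_add char_lattice_of_int_mult e) auto
  have "\<psi> ?m = of_int t0 * \<psi> (e 0) + of_int t1 * \<psi> (e 1) + of_int t2 * \<psi> (e 2)"
    using e[of 0] e[of 1] e[of 2] by (simp add: \<psi>_add \<psi>_of_int char_lattice_add char_lattice_of_int_mult)
  then have "\<psi> ?m = 0"
    using t by (intro char_lattice_2_eq_0 \<psi>[OF m]) (simp_all add: lookup_add lookup_of_int_mult)
  then have "?m = 0" by (rule \<psi>_eq_0[OF m])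
  then have "Poly_Mapping.lookup ?m i = 0" for i by (simp only: lookup_zero)
  from this[of 0] this[of 1] this[of 2] show False
    using t(1) unfolding lookup_add lookup_of_int_mult e_def by (simp add: lookup_single)
qed

text \<open>Stated as spanning; independence follows once the images under \<psi> have nonzero
  determinant.\<close>

definition lattice_basis :: "exponent \<Rightarrow> exponent \<Rightarrow> bool" where
  "lattice_basis a b \<longleftrightarrow> a \<in> char_lattice n \<and> b \<in> char_lattice n \<and>
     (\<forall>m\<in>char_lattice n. \<exists>x y. m = of_int x * a + of_int y * b)"

text \<open>The functional u \<circ> \<psi> on M' is this multiple of a primitive one, the generator
  of the corresponding ray in the cocharacter lattice of the torus of U. It is the g_u of the
  overview.\<close>

definition content :: "int \<times> int \<Rightarrow> int" where
  "content u = Gcd ((\<lambda>m. dot u (\<psi> m)) ` char_lattice n)"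

lemma \<psi>_lattice_basis:
  assumes "a \<in> char_lattice n" "b \<in> char_lattice n"
  shows "\<psi> (of_int x * a + of_int y * b) = of_int x * \<psi> a + of_int y * \<psi> b"
  using assms by (simp add: \<psi>_add \<psi>_of_int char_lattice_of_int_mult)

lemma dot_of_int: "dot u (of_int x * a) = x * dot u a"
  unfolding dot_def lookup_of_int_mult by (simp add: algebra_simps)

text \<open>Each pair is an integer combination of the other, so the determinants divide each other.
  If nonzero, their absolute value is the index of \<psi>(M') in M.\<close>

lemma det_lattice_basis_unique:
  assumes "lattice_basis a b" "lattice_basis c d"
  shows "\<bar>det2 (coords (\<psi> a)) (coords (\<psi> b))\<bar> = \<bar>det2 (coords (\<psi> c)) (coords (\<psi> d))\<bar>"
proof -
  have "det2 (coords (\<psi> a)) (coords (\<psi> b)) dvd det2 (coords (\<psi> c)) (coords (\<psi> d))"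
    if ab: "lattice_basis a b" and cd: "lattice_basis c d" for a b c d
  proof -
    obtain x y z w where c: "c = of_int x * a + of_int y * b" and d: "d = of_int z * a + of_int w * b"
      using ab cd unfolding lattice_basis_def by metis
    have "det2 (coords (\<psi> c)) (coords (\<psi> d)) = det2 (coords (\<psi> a)) (coords (\<psi> b)) * (x * w - y * z)"
    proof -
      have "a \<in> char_lattice n" "b \<in> char_lattice n" using ab by (simp_all add: lattice_basis_def)
      then have "\<psi> c = of_int x * \<psi> a + of_int y * \<psi> b" "\<psi> d = of_int z * \<psi> a + of_int w * \<psi> b"
        unfolding c d by (simp_all only: \<psi>_lattice_basis)
      then show ?thesis
        unfolding det2_def coords_def by (simp only: lookup_add lookup_of_int_mult fst_conv snd_conv)
          (simp add: algebra_simps)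
    qed
    then show ?thesis by simp
  qed
  then show ?thesis using assms by (intro zdvd_antisym_abs) blast+
qed

text \<open>At x a + y b the functional takes the value y times its value at b, so the latter
  generates all values.\<close>

lemma content_eq:
  assumes ab: "lattice_basis a b" and "dot u (\<psi> a) = 0" "dot u (\<psi> b) \<ge> 0"
  shows "content u = dot u (\<psi> b)"
proof -
  have "dot u (\<psi> b) dvd content u"
    unfolding content_def
  proof (rule Gcd_greatest)
    fix k assume "k \<in> (\<lambda>m. dot u (\<psi> m)) ` char_lattice n"
    then obtain m where m: "m \<in> char_lattice n" "k = dot u (\<psi> m)" by blast
    then obtain x y where "m = of_int x * a + of_int y * b" using ab unfolding lattice_basis_def by blast
    then have "k = y * dot u (\<psi> b)"
      using ab assms(2) m(2) by (simp add: lattice_basis_def \<psi>_lattice_basis dot_add dot_of_int)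
    then show "dot u (\<psi> b) dvd k" by simp
  qed
  moreover have "content u dvd dot u (\<psi> b)"
    unfolding content_def using ab by (intro Gcd_dvd) (auto simp: lattice_basis_def)
  moreover have "content u \<ge> 0" unfolding content_def by simp
  ultimately show ?thesis using assms(3) by (simp add: zdvd_antisym_nonneg)
qed

lemma lattice_basis_commute: "lattice_basis a b \<Longrightarrow> lattice_basis b a"
  unfolding lattice_basis_def by (metis add.commute)

text \<open>Two generators of \<open>S\<close> must lie one on each edge of the dual cone. In terms
  of a, b the pair of functionals u \<circ> \<psi>, v \<circ> \<psi> is then, up to order, a
  diagonal matrix whose entries are the contents, and \<open>dot_det\<close> evaluates its
  determinant.\<close>

lemma smooth_chart_content:
  assumes uv: "det2 u v > 0" and S: "S = {m \<in> char_lattice n. \<psi> m \<in> dual_cone u v}"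
    and ab: "lattice_basis a b" "a \<in> S" "b \<in> S"
    and gen: "\<And>s. s \<in> S \<Longrightarrow> \<exists>x y :: nat. s = of_nat x * a + of_nat y * b"
  shows "content u * content v = det2 u v * \<bar>det2 (coords (\<psi> a)) (coords (\<psi> b))\<bar>"
    and "content u > 0" "content v > 0"
proof -
  \<comment> \<open>The point w lies on an edge of the dual cone, and \<phi> w is a nonnegative
    combination of a and b. Since u' vanishes on it, u' vanishes on every generator that occurs; v'
    is positive on at least one of these.\<close>
  have edge: "(dot u' (\<psi> a) = 0 \<and> dot v' (\<psi> a) > 0) \<or> (dot u' (\<psi> b) = 0 \<and> dot v' (\<psi> b) > 0)"
    if w: "w \<in> char_lattice 2" "dot u' w = 0" "dot v' w > 0"
      and uv': "(u', v') = (u, v) \<or> (u', v') = (v, u)" for u' v' w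
  proof -
    have \<psi>w: "\<psi> (\<phi> w) = of_nat N * w" using \<psi>\<phi> w(1) .
    have "\<phi> w \<in> S"
      using w uv' N \<phi>[OF w(1)] char_lattice_of_nat_mult[OF w(1)]
      by (auto simp: S dual_cone_def \<psi>w dot_of_nat)
    then obtain x y where xy: "\<phi> w = of_nat x * a + of_nat y * b" using gen by blast
    have eq: "int N * dot t w = int x * dot t (\<psi> a) + int y * dot t (\<psi> b)" for t
      using ab(1) arg_cong[OF xy, of "\<lambda>m. dot t (\<psi> m)"]
      by (simp add: lattice_basis_def \<psi>w \<psi>_add \<psi>_of_nat char_lattice_of_nat_mult dot_add dot_of_nat)
    have nn: "dot u' (\<psi> a) \<ge> 0" "dot u' (\<psi> b) \<ge> 0" "dot v' (\<psi> a) \<ge> 0" "dot v' (\<psi> b) \<ge> 0"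
      using ab(2,3) uv' by (auto simp: S dual_cone_def)
    have "int x * dot u' (\<psi> a) + int y * dot u' (\<psi> b) = 0" using eq[of u'] w(2) by simp
    then have 0: "int x * dot u' (\<psi> a) = 0" "int y * dot u' (\<psi> b) = 0"
      using nn by (simp_all add: add_nonneg_eq_0_iff)
    have "int x * dot v' (\<psi> a) + int y * dot v' (\<psi> b) > 0"
      using eq[of v'] w(3) N by (metis mult_pos_pos of_nat_0_less_iff)
    then have "int x * dot v' (\<psi> a) > 0 \<or> int y * dot v' (\<psi> b) > 0" by linarith
    then show ?thesis using 0 nn by (auto simp: zero_less_mult_iff)
  qed
  \<comment> \<open>u turned by 90 degrees and v turned by -90 degrees: one point on each edge of
    the dual cone.\<close>
  define w1 w2 :: exponent where
    "w1 = Poly_Mapping.single 0 (- snd u) + Poly_Mapping.single 1 (fst u)" and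
    "w2 = Poly_Mapping.single 0 (snd v) + Poly_Mapping.single 1 (- fst v)"
  have w: "w1 \<in> char_lattice 2" "w2 \<in> char_lattice 2"
    by (auto simp: w1_def w2_def char_lattice_iff lookup_add lookup_single when_def)
  have dots: "dot u w1 = 0" "dot v w1 = det2 u v" "dot v w2 = 0" "dot u w2 = det2 u v"
    by (simp_all add: w1_def w2_def dot_def det2_def lookup_add lookup_single)
  have e1: "(dot u (\<psi> a) = 0 \<and> dot v (\<psi> a) > 0) \<or> (dot u (\<psi> b) = 0 \<and> dot v (\<psi> b) > 0)"
    using edge[OF w(1)] dots uv by simp
  have e2: "(dot v (\<psi> a) = 0 \<and> dot u (\<psi> a) > 0) \<or> (dot v (\<psi> b) = 0 \<and> dot u (\<psi> b) > 0)"
    using edge[OF w(2)] dots uv by simp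
  let ?d = "det2 (coords (\<psi> a)) (coords (\<psi> b))"
  have det: "\<bar>dot u (\<psi> a) * dot v (\<psi> b) - dot u (\<psi> b) * dot v (\<psi> a)\<bar> = det2 u v * \<bar>?d\<bar>"
    using uv by (simp add: dot_det abs_mult)
  consider "dot u (\<psi> a) = 0" "dot v (\<psi> a) > 0" "dot v (\<psi> b) = 0" "dot u (\<psi> b) > 0"
    | "dot u (\<psi> b) = 0" "dot v (\<psi> b) > 0" "dot v (\<psi> a) = 0" "dot u (\<psi> a) > 0"
    using e1 e2 by linarith
  then have "content u * content v = det2 u v * \<bar>?d\<bar> \<and> content u > 0 \<and> content v > 0"
  proof cases
    case 1
    then show ?thesis
      using content_eq[OF ab(1), of u] content_eq[OF lattice_basis_commute[OF ab(1)], of v] det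
      by (simp add: abs_mult)
  next
    case 2
    then show ?thesis
      using content_eq[OF ab(1), of v] content_eq[OF lattice_basis_commute[OF ab(1)], of u] det
      by (simp add: abs_mult)
  qed
  then show "content u * content v = det2 u v * \<bar>?d\<bar>" "content u > 0" "content v > 0" by simp_all
qed

end

lemma monoid_on_of_nat_mult:
  assumes "monoid_on S" "s \<in> S" shows "of_nat j * (s :: exponent) \<in> S"
  using assms by (induction j) (simp_all add: monoid_on_def distrib_right)

text \<open>For m in \<open>S\<close> the multiple N m lies in S \<inter> L, which puts \<psi> m
  into the dual cone; conversely normality divides by N. The tangent space bounds the irreducibles
  of \<open>S\<close>, and since differences of elements of \<open>S\<close> exhaust the lattice,
  generators of \<open>S\<close> also span the lattice.\<close>

lemma (in isogeny) smooth_quotient_chart: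
  fixes U :: "'k::field ratfun set set"
  assumes U: "normal_variety n U" "smooth n U" and uv: "det2 u v > 0"
    and L: "\<And>m. m \<in> char_lattice n \<Longrightarrow> of_nat N * m \<in> L"
    and S: "monoid_on S" "S \<subseteq> char_lattice n" "S \<inter> L = \<phi> ` dual_cone u v"
      "\<And>m. m \<in> char_lattice n \<Longrightarrow> \<exists>s\<in>S. \<exists>t\<in>S. m = s - t"
    and origin: "pointed_monoid S \<Longrightarrow> origin_ring S \<in> U"
  shows "\<exists>a b. lattice_basis a b \<and> content u > 0 \<and> content v > 0 \<and>
     content u * content v = det2 u v * \<bar>det2 (coords (\<psi> a)) (coords (\<psi> b))\<bar>"
proof -
  let ?C = "dual_cone u v"
  have C: "pointed_monoid ?C" using uv by (intro pointed_monoid_dual_cone) simp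
  have SC: "\<psi> m \<in> ?C" if m: "m \<in> S" for m
  proof -
    have mn: "m \<in> char_lattice n" using m S(2) by blast
    have "of_nat N * m \<in> S \<inter> L" using monoid_on_of_nat_mult[OF S(1) m] L[OF mn] by blast
    then obtain c where c: "c \<in> ?C" "of_nat N * m = \<phi> c" using S(3) by blast
    have c2: "c \<in> char_lattice 2" using c(1) by (simp add: dual_cone_def)
    have "of_nat N * \<psi> m = of_nat N * c"
      using \<psi>_of_nat[OF mn, of N] \<psi>\<phi>[OF c2] c(2) by metis
    then have "\<psi> m = c" using N by auto
    then show ?thesis using c(1) by simp
  qed
  have pointed: "pointed_monoid S"
    unfolding pointed_monoid_def
  proof (intro conjI ballI impI S(1))
    fix s assume s: "s \<in> S" "- s \<in> S"
    then have sn: "s \<in> char_lattice n" using S(2) by blast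
    have "\<psi> s \<in> ?C" "- \<psi> s \<in> ?C" using SC[OF s(1)] SC[OF s(2)] \<psi>_uminus[OF sn] by simp_all
    then have "\<psi> s = 0" using C by (auto simp: pointed_monoid_def)
    then show "s = 0" by (rule \<psi>_eq_0[OF sn])
  qed
  have R: "origin_ring S \<in> U" by (rule origin[OF pointed])
  have S_eq: "S = {m \<in> char_lattice n. \<psi> m \<in> ?C}"
  proof (intro equalityI subsetI)
    fix m assume "m \<in> {m \<in> char_lattice n. \<psi> m \<in> ?C}"
    then have m: "m \<in> char_lattice n" "\<psi> m \<in> ?C" by auto
    then have "\<phi> (\<psi> m) \<in> S" using S(3) by blast
    then have "of_nat N * m \<in> S" using \<phi>\<psi>[OF m(1)] by simp
    then show "m \<in> S" by (rule normal_origin_ring_saturated[OF pointed U(1) R m(1) N])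
  qed (use SC S(2) in auto)
  have T: "tangent_dim (origin_ring S :: 'k ratfun set) n"
    using U(2) R by (simp add: smooth_def)
  have "\<exists>a\<in>S. \<exists>b\<in>S. irreducibles S \<subseteq> {a, b}"
    by (rule few_irreducibles)
      (use S(1) tangent_dim_imp_few_irreducibles[OF pointed T rank_le_2] in \<open>auto simp: monoid_on_def\<close>)
  then obtain a b where ab: "a \<in> S" "b \<in> S" "irreducibles S \<subseteq> {a, b}" by blast
  define w where "w s = dot u (\<psi> s) + dot v (\<psi> s)" for s
  have gen: "\<exists>x y :: nat. s = of_nat x * a + of_nat y * b" if "s \<in> S" for s
  proof (rule generated_by_irreducibles[OF S(1) _ _ _ ab(3) that])
    show "w (c + d) = w c + w d" if "c \<in> S" "d \<in> S" for c d
      using that S(2) by (auto simp: w_def \<psi>_add dot_add subset_iff)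
    show "w s \<ge> 0" if "s \<in> S" for s
      using SC[OF that] by (simp add: w_def dual_cone_def)
    show "s = 0" if "s \<in> S" "w s = 0" for s
    proof -
      have "dot u (\<psi> s) = 0" "dot v (\<psi> s) = 0"
        using SC[OF that(1)] that(2) by (auto simp: w_def dual_cone_def)
      then have "\<psi> s = 0" using dot_eq_0[of u v "\<psi> s"] uv SC[OF that(1)] by (simp add: dual_cone_def)
      then show ?thesis using \<psi>_eq_0 that(1) S(2) by blast
    qed
  qed
  have "lattice_basis a b"
    unfolding lattice_basis_def
  proof (intro conjI ballI)
    show "a \<in> char_lattice n" "b \<in> char_lattice n" using ab S(2) by auto
    fix m assume "m \<in> char_lattice n"
    then obtain s t where st: "s \<in> S" "t \<in> S" "m = s - t" using S(4) by blast
    obtain x y x' y' :: nat where "s = of_nat x * a + of_nat y * b" "t = of_nat x' * a + of_nat y' * b"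
      using gen[OF st(1)] gen[OF st(2)] by blast
    then have "m = of_int (int x - int x') * a + of_int (int y - int y') * b"
      by (simp add: st(3) algebra_simps)
    then show "\<exists>x y. m = of_int x * a + of_int y * b" by blast
  qed
  then show ?thesis
    using smooth_chart_content[OF uv S_eq _ ab(1,2) gen] by blast
qed

section \<open>The four charts of X and the contradiction\<close>

lemma dual_semigroup_convex_cone_hull:
  "dual_semigroup (convex_cone hull {(real_of_int (fst u), real_of_int (snd u)), (real_of_int (fst v), real_of_int (snd v))})
    = dual_cone u v"
proof -
  define r where "r u = (real_of_int (fst u), real_of_int (snd u))" for u :: "int \<times> int"
  define vec where "vec m = (real_of_int (Poly_Mapping.lookup m 0), real_of_int (Poly_Mapping.lookup m 1))" for m :: exponent
  have dot: "vec m \<bullet> r u = real_of_int (dot u m)" for m u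
    by (simp add: vec_def r_def dot_def mult.commute)
  have "(\<forall>w\<in>convex_cone hull {r u, r v}. vec m \<bullet> w \<ge> 0) \<longleftrightarrow> dot u m \<ge> 0 \<and> dot v m \<ge> 0" for m
  proof
    assume *: "\<forall>w\<in>convex_cone hull {r u, r v}. vec m \<bullet> w \<ge> 0"
    have "r u \<in> convex_cone hull {r u, r v}" "r v \<in> convex_cone hull {r u, r v}"
      by (simp_all add: hull_inc)
    then show "dot u m \<ge> 0 \<and> dot v m \<ge> 0" using * by (metis dot of_int_0_le_iff)
  next
    assume "dot u m \<ge> 0 \<and> dot v m \<ge> 0"
    then have "{r u, r v} \<subseteq> {w. vec m \<bullet> w \<ge> 0}" by (simp add: dot)
    moreover have "convex_cone {w. vec m \<bullet> w \<ge> 0}"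
      by (rule convex_cone_halfspace_ge)
    ultimately have "convex_cone hull {r u, r v} \<subseteq> {w. vec m \<bullet> w \<ge> 0}" by (rule hull_minimal)
    then show "\<forall>w\<in>convex_cone hull {r u, r v}. vec m \<bullet> w \<ge> 0" by blast
  qed
  then show ?thesis by (auto simp: dual_semigroup_def dual_cone_def vec_def r_def)
qed

theorem proposition4p1:
  fixes X :: "'k::field ratfun set set"
  assumes X: "X = toric_surface ((hull) convex_cone `
      {{}, {(1, 0)}, {(0, 1)}, {(-1, 1)}, {(-1, -1)},
       {(1, 0), (0, 1)}, {(0, 1), (-1, 1)}, {(-1, 1), (-1, -1)}, {(-1, -1), (1, 0)}})"
  shows "\<not> (\<exists>n U G. toric_variety n U \<and> smooth n U \<and> finite_torus_subgroup n G \<and>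
                 is_toric_quotient n U G 2 X)"
proof
  assume "\<exists>n U G. toric_variety n U \<and> smooth n U \<and> finite_torus_subgroup n G \<and>
                 is_toric_quotient n U G 2 X"
  then obtain n U G h where U: "toric_variety n U" "smooth n U" and G: "finite_torus_subgroup n G"
    and q: "toric_quotient_map n U G 2 X h"
    by (auto simp: is_toric_quotient_def)
  have normal: "normal_variety n U" using U(1) by (simp add: toric_variety_def)
  have I: "ideal G (ring_on (torus_ring n))" using G by (simp add: finite_torus_subgroup_def)
  have h: "h \<in> ring_hom (ring_on (torus_field 2)) (ring_on (torus_field n))" "\<forall>c. h (scal c) = scal c"
    and h_chi: "\<forall>m\<in>char_lattice 2. \<exists>m'. m' \<in> char_lattice n \<and> h (chi m) = chi m'"
    using q unfolding toric_quotient_map_def dominant_toric_morphism_def Bex_def by simp_all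
  from bchoice[OF h_chi] obtain \<phi> where
    \<phi>: "\<forall>m\<in>char_lattice 2. \<phi> m \<in> char_lattice n \<and> h (chi m) = chi (\<phi> m)" ..
  obtain N where N: "N > 0" and N_trivial: "\<And>m. m \<in> char_lattice n \<Longrightarrow> of_nat N * m \<in> trivial_chars n G"
    using finite_torus_subgroup_exponent[OF G] by blast
  note \<phi>_add = \<phi>_add[OF h \<phi>] and \<phi>_inj = inj_onD[OF \<phi>_inj[OF h \<phi>]]

  \<comment> \<open>Pairs of neighbouring rays in counterclockwise order, so that all determinants
    are positive.\<close>
  define rays :: "((int \<times> int) \<times> (int \<times> int)) set" where
    "rays = {((1, 0), (0, 1)), ((0, 1), (-1, 1)), ((-1, 1), (-1, -1)), ((-1, -1), (1, 0))}"
  obtain \<B> where \<B>: "X = (\<Union>B\<in>\<B>. Spec B)"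
    "\<forall>B\<in>\<B>. affine_model 2 B \<and> (\<exists>A. affine_model n A \<and> Spec A = preimage U h (Spec B) \<and>
       coaction n ` A \<subseteq> tensor_torus n A \<and> h ` B = invariants n G A)"
    using q unfolding toric_quotient_map_def by (elim conjE exE)
  have chart: "\<exists>S. monoid_on S \<and> S \<subseteq> char_lattice n \<and> S \<inter> trivial_chars n G = \<phi> ` dual_cone u v
      \<and> (\<forall>m\<in>char_lattice n. \<exists>s\<in>S. \<exists>t\<in>S. m = s - t) \<and> (pointed_monoid S \<longrightarrow> origin_ring S \<in> U)"
    if uv: "(u, v) \<in> rays" for u v
  proof -
    have C: "pointed_monoid (dual_cone u v)"
      using uv by (intro pointed_monoid_dual_cone) (auto simp: rays_def det2_def)
    let ?T = "{{}, {(1, 0)}, {(0, 1)}, {(-1, 1)}, {(-1, -1)}, {(1, 0), (0, 1)}, {(0, 1), (-1, 1)},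
      {(-1, 1), (-1, -1)}, {(-1, -1), (1, 0)}} :: (real \<times> real) set set"
    consider "u = (1, 0)" "v = (0, 1)" | "u = (0, 1)" "v = (-1, 1)" | "u = (-1, 1)" "v = (-1, -1)"
      | "u = (-1, -1)" "v = (1, 0)"
      using uv unfolding rays_def by blast
    then have "{(real_of_int (fst u), real_of_int (snd u)), (real_of_int (fst v), real_of_int (snd v))} \<in> ?T"
      by cases (simp_all only: fst_conv snd_conv of_int_1 of_int_0 of_int_minus insert_iff simp_thms)
    then have "convex_cone hull {(real_of_int (fst u), real_of_int (snd u)), (real_of_int (fst v), real_of_int (snd v))}
        \<in> (hull) convex_cone ` ?T"
      by (rule imageI)
    then have "Spec (semigroup_ring (dual_cone u v)) \<subseteq> X"
      unfolding X toric_surface_def dual_semigroup_convex_cone_hull[symmetric] by (rule UN_upper)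
    \<comment> \<open>Only the fixed point of the cone is known to lie in a member of the given
      cover; \<open>quotient_affine_chart\<close> then recognizes that member as the chart of the
      cone.\<close>
    then have "origin_ring (dual_cone u v) \<in> X" using origin_ring_in_Spec[OF C] by blast
    then obtain B where B': "B \<in> \<B>" "origin_ring (dual_cone u v) \<in> Spec B"
      unfolding \<B>(1) by (rule UN_E)
    with \<B>(2) obtain A where B: "origin_ring (dual_cone u v) \<in> Spec B" "affine_model 2 B"
      and A: "affine_model n A" "Spec A = preimage U h (Spec B)" "coaction n ` A \<subseteq> tensor_torus n A"
        "h ` B = invariants n G A"
      by metis
    from quotient_affine_chart[OF h \<phi> I B(2) A(4,1,3) C B(1)] obtain S where S: "A = semigroup_ring S" "monoid_on S" "S \<subseteq> char_lattice n"
      "S \<inter> trivial_chars n G = \<phi> ` dual_cone u v" "\<forall>m\<in>char_lattice n. \<exists>s\<in>S. \<exists>t\<in>S. m = s - t"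
      by (elim exE conjE)
    have "origin_ring S \<in> U" if "pointed_monoid S"
      using origin_ring_in_Spec[OF that, where ?'a = 'k] A(2) S(1) by (auto simp: preimage_def)
    then show ?thesis using S by blast
  qed

  \<comment> \<open>One chart suffices for N M' \<subseteq> \<phi>(M): every m is a difference of
    elements of \<open>S\<close>, and N times an element of \<open>S\<close> lies in S \<inter> L,
    the image of the dual cone.\<close>
  have "\<exists>c. c \<in> char_lattice 2 \<and> \<phi> c = of_nat N * m" if m: "m \<in> char_lattice n" for m
  proof -
    have "((1, 0), (0, 1)) \<in> rays" by (simp add: rays_def)
    from chart[OF this] obtain S where S: "monoid_on S" "S \<subseteq> char_lattice n"
      "S \<inter> trivial_chars n G = \<phi> ` dual_cone (1, 0) (0, 1)" "\<exists>s\<in>S. \<exists>t\<in>S. m = s - t" using m by blast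
    then obtain s t where st: "s \<in> S" "t \<in> S" "m = s - t" by blast
    have "\<exists>c\<in>char_lattice 2. \<phi> c = of_nat N * s" if s: "s \<in> S" for s
    proof -
      have "of_nat N * s \<in> S \<inter> trivial_chars n G"
        using monoid_on_of_nat_mult[OF S(1) s] N_trivial s S(2) by blast
      then show ?thesis unfolding S(3) by (auto simp: dual_cone_def)
    qed
    then obtain c d where cd: "c \<in> char_lattice 2" "d \<in> char_lattice 2" "\<phi> c = of_nat N * s" "\<phi> d = of_nat N * t"
      using st by metis
    have "\<phi> (c - d) = of_nat N * m"
      using \<phi>_add[OF char_lattice_diff[OF cd(1,2)] cd(2)] cd(3,4) by (simp add: st(3) right_diff_distrib)
    then show ?thesis using char_lattice_diff[OF cd(1,2)] by blast
  qed
  then have "\<forall>m\<in>char_lattice n. \<exists>c. c \<in> char_lattice 2 \<and> \<phi> c = of_nat N * m" by blast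
  from bchoice[OF this] obtain \<psi> where \<psi>: "\<And>m. m \<in> char_lattice n \<Longrightarrow> \<psi> m \<in> char_lattice 2"
    "\<And>m. m \<in> char_lattice n \<Longrightarrow> \<phi> (\<psi> m) = of_nat N * m" by blast
  have \<phi>_of_nat: "\<phi> (of_nat j * c) = of_nat j * \<phi> c" if "c \<in> char_lattice 2" for j c
  proof (induction j)
    case 0
    then show ?case using \<phi>_add[of 0 0] by simp
  next
    case (Suc j)
    then show ?case using \<phi>_add[of c "of_nat j * c"] that by (simp add: distrib_right char_lattice_of_nat_mult)
  qed
  \<comment> \<open>\<psi> comes from a choice of preimages under \<phi>; injectivity of \<phi>
    makes it additive and gives \<psi> (\<phi> c) = N c.\<close>
  interpret isogeny n N \<phi> \<psi>
  proof
    show "\<psi> (a + b) = \<psi> a + \<psi> b" if "a \<in> char_lattice n" "b \<in> char_lattice n" for a b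
    proof (rule \<phi>_inj)
      show "\<psi> (a + b) \<in> char_lattice 2" using that by (intro \<psi>(1) char_lattice_add)
      show "\<psi> a + \<psi> b \<in> char_lattice 2" using that by (intro \<psi>(1) char_lattice_add)
      show "\<phi> (\<psi> (a + b)) = \<phi> (\<psi> a + \<psi> b)"
        using that by (simp add: \<psi> char_lattice_add \<phi>_add distrib_left)
    qed
    show "\<psi> (\<phi> c) = of_nat N * c" if "c \<in> char_lattice 2" for c
    proof (rule \<phi>_inj)
      have c: "\<phi> c \<in> char_lattice n" using \<phi> that by blast
      show "\<psi> (\<phi> c) \<in> char_lattice 2" by (rule \<psi>(1)[OF c])
      show "of_nat N * c \<in> char_lattice 2" by (rule char_lattice_of_nat_mult[OF that])
      show "\<phi> (\<psi> (\<phi> c)) = \<phi> (of_nat N * c)" unfolding \<psi>(2)[OF c] \<phi>_of_nat[OF that] ..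
    qed
  qed (use N \<phi> \<psi> in auto)

  have rel: "\<exists>a b. lattice_basis a b \<and> content u > 0 \<and> content v > 0 \<and>
     content u * content v = det2 u v * \<bar>det2 (coords (\<psi> a)) (coords (\<psi> b))\<bar>"
    if uv: "(u, v) \<in> rays" for u v
  proof -
    obtain S where S: "monoid_on S" "S \<subseteq> char_lattice n" "S \<inter> trivial_chars n G = \<phi> ` dual_cone u v"
      "\<And>m. m \<in> char_lattice n \<Longrightarrow> \<exists>s\<in>S. \<exists>t\<in>S. m = s - t" "pointed_monoid S \<Longrightarrow> origin_ring S \<in> U"
      using chart[OF uv] by blast
    have "det2 u v > 0" using uv by (auto simp: rays_def det2_def)
    from smooth_quotient_chart[OF normal U(2) this N_trivial S] show ?thesis .
  qed
  have "((1, 0), (0, 1)) \<in> rays" by (simp add: rays_def)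
  from rel[OF this] obtain a b where ab: "lattice_basis a b" by blast
  define D where "D = \<bar>det2 (coords (\<psi> a)) (coords (\<psi> b))\<bar>"
  have rel': "content u > 0 \<and> content v > 0 \<and> content u * content v = det2 u v * D"
    if uv: "(u, v) \<in> rays" for u v
  proof -
    obtain c d where cd: "lattice_basis c d" "content u > 0 \<and> content v > 0 \<and>
        content u * content v = det2 u v * \<bar>det2 (coords (\<psi> c)) (coords (\<psi> d))\<bar>"
      using rel[OF uv] by blast
    then show ?thesis using det_lattice_basis_unique[OF ab cd(1)] by (simp add: D_def)
  qed
  let ?g1 = "content (1, 0)" and ?g2 = "content (0, 1)" and ?g3 = "content (-1, 1)" and ?g4 = "content (-1, -1)"
  have g: "?g1 * ?g2 = D" "?g2 * ?g3 = D" "?g3 * ?g4 = 2 * D" "?g4 * ?g1 = D" "?g1 > 0" "?g2 > 0"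
    using rel'[of "(1, 0)" "(0, 1)"] rel'[of "(0, 1)" "(-1, 1)"] rel'[of "(-1, 1)" "(-1, -1)"]
      rel'[of "(-1, -1)" "(1, 0)"] by (simp_all add: rays_def det2_def)
  have "D > 0" using g(1,5,6) by (metis mult_pos_pos)
  have "D * (2 * D) = (?g1 * ?g2) * (?g3 * ?g4)" by (simp only: g)
  also have "\<dots> = (?g2 * ?g3) * (?g4 * ?g1)" by (simp add: mult_ac)
  also have "\<dots> = D * D" by (simp only: g)
  finally show False using \<open>D > 0\<close> by simp
qed

end
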